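(* Let $(\mathfrak H_1,J_1)$ and $(\mathfrak H_2,J_2)$ be Kreĭn spaces, $\mathfrak H=\mathfrak H_1\oplus\mathfrak H_2$, $J=\begin{pmatrix} J_1 & 0 \\ 0 & J_2 \end{pmatrix}$, and let $$A^0=\begin{pmatrix} A_{11} & A_{12} \\ A_{21} & \ast \end{pmatrix}$$ be an incomplete block operator in the Kreĭn space $(\mathfrak H,J)$, where $A_{11}=A_{11}^{[*]}\in[(\mathfrak H_1,J_1)]$, $A_{12}\in[(\mathfrak H_2,J_2),(\mathfrak H_1,J_1)]$ and $A_{21}=A_{12}^{[*]}$ are bounded. Assume that $\nu_-[A_{11}]:=\nu_-(J_1A_{11})=\kappa<\infty$ with $\kappa\in\mathbb Z_+$, and let $J_{11}:=\operatorname{sign}(J_1A_{11})$ be the (unitary) signature operator of $J_1A_{11}$. Then: (i) There exists a completion $A=\begin{pmatrix} A_{11} & A_{12} \\ A_{21} & A_{22} \end{pmatrix}\in[(\mathfrak H,J)]$ of $A^0$ with some operator $A_{22}=A_{22}^{[*]}\in[(\mathfrak H_2,J_2)]$ such that $\nu_-[A]=\nu_-[A_{11}]=\kappa$ if and only if $$\operatorname{ran}J_1A_{12}\subset\operatorname{ran}|A_{11}|^{1/2}.$$ (ii) In this case the operator $S=|A_{11}|^{[-1/2]}J_1A_{12}$, where $|A_{11}|^{[-1/2]}$ is the Moore–Penrose inverse of $|A_{11}|^{1/2}$, is well defined and $S\in[(\mathfrak H_2,J_2),(\mathfrak H_1,J_1)]$. Moreover, $S^{[*]}J_1J_{11}S$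 is the smallest operator, with respect to the ordering $\le_{J_2}$, in the solution set $$\mathcal A:=\Big\{A_{22}=A_{22}^{[*]}\in[(\mathfrak H_2,J_2)]:\ A=(A_{ij})_{i,j=1}^2,\ \nu_-[A]=\kappa\Big\},$$ and this solution set admits the description $$\mathcal A=\Big\{A_{22}\in[(\mathfrak H_2,J_2)]:\ A_{22}=J_2(S^*J_{11}S+Y)=S^{[*]}J_1J_{11}S+J_2Y,\ Y=Y^*\ge0\Big\}.$$
   Context: A Kreĭn space $(\mathcal H,J_{\mathcal H})$ is a Hilbert space $\mathcal H$ with a fundamental symmetry $J_{\mathcal H}=J_{\mathcal H}^*=J_{\mathcal H}^{-1}$ and indefinite inner product $[\varphi,\psi]=(J_{\mathcal H}\varphi,\psi)$. $[(\mathcal H,J_{\mathcal H}),(\mathcal K,J_{\mathcal K})]$ denotes the bounded everywhere defined linear operators from $\mathcal H$ to $\mathcal K$, and $[(\mathcal H,J_{\mathcal H})]$ denotes those from $\mathcal H$ to itself. For such $X:\mathcal H\to\mathcal K$, $X^*$ is the Hilbert space adjoint and $X^{[*]}=J_{\mathcal H}X^*J_{\mathcal K}$ is the Kreĭn space adjoint; $X\in[(\mathcal H,J_{\mathcal H})]$ is selfadjoint in the Kreĭn space if $X=X^{[*]}$, equivalently $J_{\mathcal H}X$ is Hilbert-space selfadjoint. For a bounded Hilbert-space selfadjoint operator $H$, $\nu_-(H)\in\{0,1,2,\dots,\infty\}$ is the dimension of its spectral subspace corresponding to $(-\infty,0)$ (the number of negative squares of the form $(Hf,f)$). For $X=X^{[*]}\in[(\mathcal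 H,J_{\mathcal H})]$, $\nu_-[X]:=\nu_-(J_{\mathcal H}X)$; in particular $\nu_-[A]=\nu_-(JA)$. $|C|=(C^*C)^{1/2}$ (Hilbert space adjoint). For selfadjoint $H=\int t\,dE_t$, $\operatorname{sign}(H)=\int\operatorname{sign}(t)\,dE_t$ with $\operatorname{sign}(t)=1$ for $t\ge0$ and $-1$ for $t<0$. For nonnegative bounded $D$, its Moore–Penrose inverse $D^{[-1]}$ has domain $\operatorname{ran}D\oplus\ker D$, is zero on $\ker D$, and maps $y\in\operatorname{ran}D$ to the unique $x\in\overline{\operatorname{ran}}\,D$ with $Dx=y$; $|A_{11}|^{[-1/2]}$ means $(|A_{11}|^{1/2})^{[-1]}$. Ordering: for Kreĭn-selfadjoint $X,Y\in[(\mathfrak H_2,J_2)]$, $X\ge_{J_2}Y$ means $[(X-Y)f,f]=(J_2(X-Y)f,f)\ge0$ for all $f\in\mathfrak H_2$. *)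

theory Defs
  imports "HOL-Analysis.Analysis"
begin

section \<open>Complex Hilbert spaces\<close>

text \<open>
  The class extends the real one, so that norm, topology and completeness are those of the
  library; the real inner product is the real part of the complex one. Positive definiteness
  of \<open>cinner\<close> therefore need not be assumed: it is inherited from \<open>real_inner\<close>.
  \<open>cinner\<close> is linear in its first argument.
\<close>

class chilbert_space = real_inner + complete_space +
  fixes scaleC :: "complex \<Rightarrow> 'a \<Rightarrow> 'a"  (infixr "*\<^sub>C" 75)
    and cinner :: "'a \<Rightarrow> 'a \<Rightarrow> complex"
  assumes scaleC_of_real: "complex_of_real r *\<^sub>C x = r *\<^sub>R x"
    and scaleC_add_right: "c *\<^sub>C (x + y) = c *\<^sub>C x + c *\<^sub>C y"
    and scaleC_add_left: "(c + d) *\<^sub>C x = c *\<^sub>C x + d *\<^sub>C x"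
    and scaleC_scaleC: "c *\<^sub>C d *\<^sub>C x = (c * d) *\<^sub>C x"
    and cinner_commute: "cinner x y = cnj (cinner y x)"
    and cinner_add_left: "cinner (x + y) z = cinner x z + cinner y z"
    and cinner_scaleC_left: "cinner (c *\<^sub>C x) y = c * cinner x y"
    and inner_eq_Re_cinner: "inner x y = Re (cinner x y)"

instantiation complex :: chilbert_space
begin
definition "scaleC (c :: complex) (x :: complex) = c * x"
definition "cinner (x :: complex) (y :: complex) = x * cnj y"
instance
  by standard
    (auto simp: scaleC_complex_def cinner_complex_def scaleR_conv_of_real inner_complex_def
      algebra_simps)
end

text \<open>The orthogonal sum of two Hilbert spaces is the product type.\<close>

instantiation prod :: (chilbert_space, chilbert_space) chilbert_space
begin
definition "scaleC c (x :: 'a \<times> 'b) = (c *\<^sub>C fst x, c *\<^sub>C snd x)"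
definition "cinner (x :: 'a \<times> 'b) (y :: 'a \<times> 'b) = cinner (fst x) (fst y) + cinner (snd x) (snd y)"
instance
proof
  fix x y :: "'a \<times> 'b"
  show "cinner x y = cnj (cinner y x)"
    unfolding cinner_prod_def
    by (simp flip: cinner_commute)
qed (auto simp: scaleC_prod_def cinner_prod_def inner_prod_def scaleC_of_real scaleC_add_right
      scaleC_add_left scaleC_scaleC cinner_add_left cinner_scaleC_left inner_eq_Re_cinner
      algebra_simps scaleR_prod_def prod_eq_iff)
end

lemma scaleC_one: "1 *\<^sub>C (x :: 'a :: chilbert_space) = x"
  using scaleC_of_real[of 1 x] by simp

global_interpretation complex_vector: vector_space "scaleC :: complex \<Rightarrow> 'a \<Rightarrow> 'a :: chilbert_space"
  by unfold_locales (auto simp: scaleC_add_right scaleC_add_left scaleC_scaleC scaleC_one)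

text \<open>Complex dimension of a subspace; the library's \<open>dim\<close> is 0 in infinite dimensions.\<close>

definition ecdim :: "'a :: chilbert_space set \<Rightarrow> enat" where
  "ecdim V = (if \<exists>B. finite B \<and> V \<subseteq> complex_vector.span B then enat (complex_vector.dim V) else \<infinity>)"

section \<open>Bounded operators\<close>

definition bounded_clinear :: "('a :: chilbert_space \<Rightarrow> 'b :: chilbert_space) \<Rightarrow> bool" where
  "bounded_clinear T \<longleftrightarrow> bounded_linear T \<and> (\<forall>c x. T (c *\<^sub>C x) = c *\<^sub>C T x)"

definition cadjoint :: "('a :: chilbert_space \<Rightarrow> 'b :: chilbert_space) \<Rightarrow> 'b \<Rightarrow> 'a" where
  "cadjoint T = (THE S. \<forall>x y. cinner (T x) y = cinner x (S y))"

definition selfadjoint_op :: "('a :: chilbert_space \<Rightarrow> 'a) \<Rightarrow> bool" where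
  "selfadjoint_op T \<longleftrightarrow> bounded_clinear T \<and> T = cadjoint T"

text \<open>For selfadjoint \<open>T\<close> the quadratic form is real, so \<open>Re\<close> loses nothing here.\<close>

definition nonneg_op :: "('a :: chilbert_space \<Rightarrow> 'a) \<Rightarrow> bool" where
  "nonneg_op T \<longleftrightarrow> selfadjoint_op T \<and> (\<forall>x. 0 \<le> Re (cinner (T x) x))"

definition op_sqrt :: "('a :: chilbert_space \<Rightarrow> 'a) \<Rightarrow> 'a \<Rightarrow> 'a" where
  "op_sqrt D = (THE R. nonneg_op R \<and> R \<circ> R = D)"

definition op_abs :: "('a :: chilbert_space \<Rightarrow> 'b :: chilbert_space) \<Rightarrow> 'a \<Rightarrow> 'a" where
  "op_abs C = op_sqrt (cadjoint C \<circ> C)"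

text \<open>
  The Moore--Penrose inverse is a partial operator: the value \<open>mp_inverse D y\<close> is meaningful
  only for \<open>y\<close> in \<open>mp_domain D\<close>, which is the sum of \<open>ran D\<close> and \<open>ker D\<close>.
\<close>

definition mp_domain :: "('a :: chilbert_space \<Rightarrow> 'a) \<Rightarrow> 'a set" where
  "mp_domain D = {u + k |u k. u \<in> range D \<and> D k = 0}"

definition mp_inverse :: "('a :: chilbert_space \<Rightarrow> 'a) \<Rightarrow> 'a \<Rightarrow> 'a" where
  "mp_inverse D y = (THE x. x \<in> closure (range D) \<and> (\<exists>k. D k = 0 \<and> y = D x + k))"

section \<open>Spectral integrals of bounded selfadjoint operators\<close>

definition spectral_family :: "(real \<Rightarrow> 'a :: chilbert_space \<Rightarrow> 'a) \<Rightarrow> bool" where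
  "spectral_family E \<longleftrightarrow>
     (\<forall>t. selfadjoint_op (E t) \<and> E t \<circ> E t = E t) \<and>
     (\<forall>s t. s \<le> t \<longrightarrow> E s \<circ> E t = E s \<and> E t \<circ> E s = E s) \<and>
     (\<forall>t x. ((\<lambda>s. E s x) \<longlongrightarrow> E t x) (at_right t)) \<and>
     (\<forall>x. ((\<lambda>t. E t x) \<longlongrightarrow> 0) at_bot) \<and>
     (\<forall>x. ((\<lambda>t. E t x) \<longlongrightarrow> x) at_top)"

text \<open>
  \<open>T\<close> is the integral of \<open>f\<close> with respect to \<open>E\<close>, in the weak sense: the integrals are with
  respect to the Lebesgue--Stieltjes measures of the functions \<open>t \<mapsto> (E\<^sub>t x, x)\<close>.
  By polarization these quadratic forms determine \<open>T\<close>.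
\<close>

definition has_spectral_integral ::
    "(real \<Rightarrow> real) \<Rightarrow> (real \<Rightarrow> 'a :: chilbert_space \<Rightarrow> 'a) \<Rightarrow> ('a \<Rightarrow> 'a) \<Rightarrow> bool" where
  "has_spectral_integral f E T \<longleftrightarrow> bounded_clinear T \<and>
     (\<forall>x. let \<mu> = interval_measure (\<lambda>t. Re (cinner (E t x) x)) in
        integrable \<mu> f \<and> cinner (T x) x = complex_of_real (integral\<^sup>L \<mu> f))"

text \<open>
  The spectral family of a bounded selfadjoint \<open>H\<close>. By the spectral theorem it exists and is
  unique, so the choice operator selects nothing arbitrary.
\<close>

definition spectral_family_of :: "('a :: chilbert_space \<Rightarrow> 'a) \<Rightarrow> real \<Rightarrow> 'a \<Rightarrow> 'a" where
  "spectral_family_of H = (SOME E. spectral_family E \<and> has_spectral_integral (\<lambda>t. t) E H)"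

definition op_fun :: "(real \<Rightarrow> real) \<Rightarrow> ('a :: chilbert_space \<Rightarrow> 'a) \<Rightarrow> 'a \<Rightarrow> 'a" where
  "op_fun f H = (THE T. has_spectral_integral f (spectral_family_of H) T)"

text \<open>Unlike the library's \<open>sgn\<close>, the sign function used here has the value 1 at 0.\<close>

definition sign_op :: "('a :: chilbert_space \<Rightarrow> 'a) \<Rightarrow> 'a \<Rightarrow> 'a" where
  "sign_op H = op_fun (\<lambda>t. if t \<ge> 0 then 1 else -1) H"

definition spectral_subspace :: "('a :: chilbert_space \<Rightarrow> 'a) \<Rightarrow> real set \<Rightarrow> 'a set" where
  "spectral_subspace H B = range (op_fun (indicator B) H)"

definition nu_minus :: "('a :: chilbert_space \<Rightarrow> 'a) \<Rightarrow> enat" where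
  "nu_minus H = ecdim (spectral_subspace H {..<0})"

section \<open>Krein spaces\<close>

text \<open>A Krein space is a Hilbert space type together with a fundamental symmetry \<open>J\<close> on it.\<close>

definition krein_space :: "('a :: chilbert_space \<Rightarrow> 'a) \<Rightarrow> bool" where
  "krein_space J \<longleftrightarrow> selfadjoint_op J \<and> J \<circ> J = id"

definition krein_inner :: "('a :: chilbert_space \<Rightarrow> 'a) \<Rightarrow> 'a \<Rightarrow> 'a \<Rightarrow> complex" where
  "krein_inner J x y = cinner (J x) y"

definition krein_adjoint ::
    "('a :: chilbert_space \<Rightarrow> 'a) \<Rightarrow> ('b :: chilbert_space \<Rightarrow> 'b) \<Rightarrow> ('a \<Rightarrow> 'b) \<Rightarrow> 'b \<Rightarrow> 'a" where
  "krein_adjoint JH JK X = JH \<circ> cadjoint X \<circ> JK"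

definition krein_selfadjoint ::
    "('a :: chilbert_space \<Rightarrow> 'a) \<Rightarrow> ('a \<Rightarrow> 'a) \<Rightarrow> bool" where
  "krein_selfadjoint J X \<longleftrightarrow> bounded_clinear X \<and> X = krein_adjoint J J X"

definition krein_nu_minus :: "('a :: chilbert_space \<Rightarrow> 'a) \<Rightarrow> ('a \<Rightarrow> 'a) \<Rightarrow> enat" where
  "krein_nu_minus J X = nu_minus (J \<circ> X)"

text \<open>
  The ordering of operators that are selfadjoint in the Krein space; for these the form below
  is real.
\<close>

definition krein_le :: "('a :: chilbert_space \<Rightarrow> 'a) \<Rightarrow> ('a \<Rightarrow> 'a) \<Rightarrow> ('a \<Rightarrow> 'a) \<Rightarrow> bool" where
  "krein_le J Y X \<longleftrightarrow> (\<forall>f. 0 \<le> Re (krein_inner J (X f - Y f) f))"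

definition block_op ::
    "('a \<Rightarrow> 'a) \<Rightarrow> ('b \<Rightarrow> 'a) \<Rightarrow> ('a \<Rightarrow> 'b) \<Rightarrow> ('b \<Rightarrow> 'b) \<Rightarrow>
     'a :: chilbert_space \<times> 'b :: chilbert_space \<Rightarrow> 'a \<times> 'b" where
  "block_op A11 A12 A21 A22 = (\<lambda>(x, y). (A11 x + A12 y, A21 x + A22 y))"

definition diag_op ::
    "('a :: chilbert_space \<Rightarrow> 'a) \<Rightarrow> ('b :: chilbert_space \<Rightarrow> 'b) \<Rightarrow> 'a \<times> 'b \<Rightarrow> 'a \<times> 'b" where
  "diag_op A B = block_op A (\<lambda>_. 0) (\<lambda>_. 0) B"

end

theory Submission
  imports Defs "HOL-Probability.Distribution_Functions"
begin

text \<open>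
  Put \<open>H = J\<^sub>1 A\<^sub>1\<^sub>1\<close>, \<open>B = J\<^sub>1 A\<^sub>1\<^sub>2\<close>, \<open>D = J\<^sub>2 A\<^sub>2\<^sub>2\<close>, \<open>R = \<bar>H\<bar>\<^sup>1\<^sup>/\<^sup>2\<close>, and let \<open>P\<close> be the spectral projection
  of \<open>H\<close> for the negative half-line and \<open>K = 1 - 2P\<close> its sign. If \<open>R S = B\<close>, completing squares gives
  the form \<open>(K w, w) + ((D - S\<^sup>* K S) y, y)\<close> with \<open>w = R x + K S y\<close> for the completed block operator,
  so \<open>D \<ge> S\<^sup>* K S\<close> creates no further negative squares.
  Conversely, if there are only \<open>\<kappa>\<close> negative squares, then by a dimension count every vector
  \<open>(x, y)\<close> can be moved by some \<open>(u, 0)\<close> with \<open>u\<close> in the range of \<open>P\<close> to a vector on which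
  the form is nonnegative. For fixed \<open>y\<close> this bounds the functional \<open>x \<mapsto> (B y, x)\<close> by
  \<open>\<parallel>R x\<parallel>\<close>, that is \<open>B y \<in> ran R\<close>, and letting \<open>w\<close> tend to 0 it gives \<open>D \<ge> S\<^sup>* K S\<close>.
\<close>

text \<open>Only a little of the spectrum of \<open>H\<close> reaches the block operator: a
  projection \<open>P\<close> commuting with \<open>H\<close> whose range carries a negative and
  whose kernel carries a nonnegative form. \<open>negative_projection\<close> yields such a
  projection for every bounded selfadjoint operator and expresses both \<open>sign_op\<close> and
  \<open>nu_minus\<close> through it, so the choice inside \<open>spectral_family_of\<close> never
  matters. For the completed operator it yields a projection \<open>Q\<close>, and the dimension
  count is about the map \<open>v \<mapsto> Q (v, 0)\<close> from \<open>range P\<close> to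
  \<open>range Q\<close>: on a nonzero vector of its kernel the form would be both negative and
  nonnegative. Injective between equal finite dimensions means onto, so
  \<open>Q (x, y) = Q (u, 0)\<close> for some \<open>u\<close>, and \<open>(x - u, y)\<close> lies
  in the kernel of \<open>Q\<close>. Finiteness of \<open>\<kappa>\<close> enters a second time:
  \<open>R\<close> maps \<open>range P\<close> onto itself, so the \<open>P\<close>-part of
  \<open>B y\<close> lies in the range of \<open>R\<close> automatically, and only the part in the
  kernel of \<open>P\<close>, where \<open>H\<close> is the square of \<open>R\<close>, has to be
  estimated.\<close>

section \<open>Riesz representation, projections and adjoints\<close>

text \<open>
  The representing vector is the limit of \<open>T x\<^sub>n\<close> along a minimising sequence of
  \<open>\<parallel>T x\<parallel>\<^sup>2 - 2 \<phi> x\<close>. Taking \<open>T = id\<close> gives the Riesz theorem and orthogonal projections,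
  taking \<open>V = UNIV\<close> a description of the range of an adjoint.
\<close>

lemma riesz_representation_through:
  fixes T :: "'c :: real_vector \<Rightarrow> 'a :: {real_inner, complete_space}" and \<phi> :: "'c \<Rightarrow> real"
  assumes V: "subspace V" and T: "linear T" and \<phi>: "linear \<phi>"
    and bd: "\<And>x. x \<in> V \<Longrightarrow> \<bar>\<phi> x\<bar> \<le> C * norm (T x)"
  shows "\<exists>s \<in> closure (T ` V). \<forall>x \<in> V. \<phi> x = inner s (T x)"
proof -
  define f where "f x = (norm (T x))\<^sup>2 - 2 * \<phi> x" for x
  have lower: "- (C\<^sup>2) \<le> f x" if "x \<in> V" for x
  proof -
    have "\<phi> x \<le> C * norm (T x)" using bd[OF that] by simp
    moreover have "0 \<le> (norm (T x) - C)\<^sup>2" by simp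
    ultimately show ?thesis unfolding f_def power2_diff by (simp add: algebra_simps)
  qed
  have bb: "bdd_below (f ` V)" using lower by (auto intro!: bdd_belowI2)
  have ne: "f ` V \<noteq> {}" using subspace_0[OF V] by auto
  define m where "m = Inf (f ` V)"
  have m: "m \<le> f x" if "x \<in> V" for x
    unfolding m_def using bb that by (simp add: cInf_lower)
  have "\<exists>x \<in> V. f x < m + 1 / real (Suc n)" for n
    using cInf_lessD[OF ne, of "m + 1 / real (Suc n)"] by (auto simp: m_def)
  then obtain X where XV: "\<And>n. X n \<in> V" and X: "\<And>n. f (X n) < m + 1 / real (Suc n)"
    by metis
  \<comment> \<open>Parallelogram law: the midpoint of \<open>x\<close> and \<open>y\<close> cannot
    have a value below the infimum \<open>m\<close>, so two nearly minimal points have nearly equal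
    images under \<open>T\<close>.\<close>
  have dist2: "(norm (T x - T y))\<^sup>2 \<le> 2 * (f x - m) + 2 * (f y - m)" if "x \<in> V" "y \<in> V" for x y
  proof -
    have "m \<le> f ((1/2) *\<^sub>R (x + y))" using m V that by (simp add: subspace_add subspace_scale)
    moreover have "4 * f ((1/2) *\<^sub>R (x + y)) = (norm (T x + T y))\<^sup>2 - 4 * (\<phi> x + \<phi> y)"
      unfolding f_def
      by (simp add: linear_scale[OF T] linear_add[OF T] linear_scale[OF \<phi>] linear_add[OF \<phi>]
          power_divide add_divide_distrib)
    moreover have "(norm (T x + T y))\<^sup>2 + (norm (T x - T y))\<^sup>2 = 2 * (norm (T x))\<^sup>2 + 2 * (norm (T y))\<^sup>2"
      by (simp add: power2_norm_eq_inner inner_add inner_diff algebra_simps)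
    moreover have "f x = (norm (T x))\<^sup>2 - 2 * \<phi> x" "f y = (norm (T y))\<^sup>2 - 2 * \<phi> y"
      by (simp_all add: f_def)
    ultimately show ?thesis by argo
  qed
  have fX: "(\<lambda>n. f (X n)) \<longlonglongrightarrow> m"
  proof (rule tendsto_sandwich[of "\<lambda>_. m" _ _ "\<lambda>n. m + 1 / real (Suc n)"])
    show "(\<lambda>n. m + 1 / real (Suc n)) \<longlonglongrightarrow> m"
      using tendsto_add[OF tendsto_const LIMSEQ_inverse_real_of_nat]
      by (simp add: inverse_eq_divide)
  qed (use m XV X in \<open>auto intro!: eventuallyI less_imp_le\<close>)
  have "Cauchy (\<lambda>n. T (X n))"
  proof (rule metric_CauchyI)
    fix e :: real assume e: "0 < e"
    have "\<forall>\<^sub>F n in sequentially. f (X n) < m + e\<^sup>2 / 4"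
      using order_tendstoD(2)[OF fX] e by simp
    then obtain N where N: "\<And>n. n \<ge> N \<Longrightarrow> f (X n) < m + e\<^sup>2 / 4"
      by (auto simp: eventually_sequentially)
    show "\<exists>M. \<forall>i\<ge>M. \<forall>n\<ge>M. dist (T (X i)) (T (X n)) < e"
    proof (intro exI allI impI)
      fix i n assume i: "N \<le> i" and n: "N \<le> n"
      have "(norm (T (X i) - T (X n)))\<^sup>2 < e\<^sup>2"
        using dist2[OF XV XV, of i n] N[OF i] N[OF n] by argo
      then show "dist (T (X i)) (T (X n)) < e"
        using e by (simp add: dist_norm power2_less_imp_less)
    qed
  qed
  then obtain s where s: "(\<lambda>n. T (X n)) \<longlonglongrightarrow> s"
    using Cauchy_convergent convergent_def by blast
  have "s \<in> closure (T ` V)"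
    unfolding closure_sequential using XV s by (intro exI[of _ "\<lambda>n. T (X n)"]) auto
  moreover have "\<phi> h = inner s (T h)" if h: "h \<in> V" for h
  proof -
    define d where "d = inner s (T h) - \<phi> h"
    \<comment> \<open>First variation: moving the minimising sequence by
      \<open>e *\<^sub>R h\<close> cannot push \<open>f\<close> below \<open>m\<close>. In the limit
      a quadratic in \<open>e\<close> without constant term stays nonnegative, which forces its
      linear coefficient \<open>d\<close> to vanish.\<close>
    have quad: "0 \<le> 2 * e * d + e\<^sup>2 * (norm (T h))\<^sup>2" for e
    proof -
      have "m \<le> f (X n) + 2 * e * (inner (T (X n)) (T h) - \<phi> h) + e\<^sup>2 * (norm (T h))\<^sup>2" for n
      proof -
        have "m \<le> f (X n + e *\<^sub>R h)" using m V XV h by (simp add: subspace_add subspace_scale)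
        also have "\<dots> = f (X n) + 2 * e * (inner (T (X n)) (T h) - \<phi> h) + e\<^sup>2 * (norm (T h))\<^sup>2"
        proof -
          have "(norm (T (X n) + e *\<^sub>R T h))\<^sup>2
              = (norm (T (X n)))\<^sup>2 + 2 * e * inner (T (X n)) (T h) + e\<^sup>2 * (norm (T h))\<^sup>2"
            unfolding power2_norm_eq_inner
            by (simp add: inner_add inner_commute power2_eq_square algebra_simps)
          then show ?thesis
            unfolding f_def
            by (simp add: linear_scale[OF T] linear_add[OF T] linear_scale[OF \<phi>] linear_add[OF \<phi>]
                algebra_simps)
        qed
        finally show ?thesis .
      qed
      moreover have "(\<lambda>n. f (X n) + 2 * e * (inner (T (X n)) (T h) - \<phi> h) + e\<^sup>2 * (norm (T h))\<^sup>2)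
         \<longlonglongrightarrow> m + 2 * e * d + e\<^sup>2 * (norm (T h))\<^sup>2"
        unfolding d_def by (intro tendsto_intros fX s)
      ultimately have "m \<le> m + 2 * e * d + e\<^sup>2 * (norm (T h))\<^sup>2"
        by (intro LIMSEQ_le_const[where X = "\<lambda>n. f (X n) + 2 * e * (inner (T (X n)) (T h) - \<phi> h)
           + e\<^sup>2 * (norm (T h))\<^sup>2"]) auto
      then show ?thesis by simp
    qed
    have "d = 0"
    proof (cases "T h = 0")
      case True
      then show ?thesis using quad[of "- d"] by (simp flip: power2_eq_square add: mult.assoc)
    next
      case False
      define k where "k = (norm (T h))\<^sup>2"
      have k: "k > 0" using False by (simp add: k_def)
      have "0 \<le> 2 * (- d / k) * d + (- d / k)\<^sup>2 * k" unfolding k_def by (rule quad)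
      also have "\<dots> = - (d\<^sup>2 / k)" using k by (simp add: power2_eq_square field_simps)
      finally show ?thesis using k by (simp add: divide_le_0_iff)
    qed
    then show ?thesis by (simp add: d_def)
  qed
  ultimately show ?thesis by blast
qed

lemma orthogonal_decomposition:
  fixes V :: "'a :: {real_inner, complete_space} set"
  assumes "subspace V" and "closed V"
  shows "\<exists>s \<in> V. \<forall>v \<in> V. inner (x - s) v = 0"
proof -
  have "\<exists>s \<in> closure (id ` V). \<forall>v \<in> V. inner x v = inner s (id v)"
    by (rule riesz_representation_through[where C = "norm x"])
      (use assms in \<open>auto intro: linear_id bounded_linear.linear bounded_linear_inner_right
        Cauchy_Schwarz_ineq2\<close>)
  then show ?thesis using assms(2) by (auto simp: inner_diff_left)
qed

lemma inner_extI:
  assumes "\<And>z :: 'a :: real_inner. inner z x = inner z y"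
  shows "x = y"
proof -
  have "inner (x - y) (x - y) = 0" using assms[of "x - y"] by (simp add: inner_diff_right)
  then show ?thesis by simp
qed

section \<open>Complex scalars and the real inner product\<close>

lemma cinner_scaleC_right: "cinner x (c *\<^sub>C y) = cnj c * cinner x y"
  by (metis cinner_commute cinner_scaleC_left complex_cnj_mult)

lemma cinner_eq_inner: "cinner x y = Complex (inner x y) (inner x (\<i> *\<^sub>C y))"
  by (simp add: inner_eq_Re_cinner cinner_scaleC_right)

lemma inner_scaleC_i: "inner (\<i> *\<^sub>C x) y = - inner x (\<i> *\<^sub>C y)"
  by (simp add: inner_eq_Re_cinner cinner_scaleC_right cinner_scaleC_left)

lemma inner_scaleC_adj: "inner (c *\<^sub>C x) y = inner x (cnj c *\<^sub>C y)"
  by (simp add: inner_eq_Re_cinner cinner_scaleC_right cinner_scaleC_left)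

lemma scaleR_scaleC: "r *\<^sub>R x = complex_of_real r *\<^sub>C x"
  by (simp add: scaleC_of_real)

lemma scaleC_scaleR: "c *\<^sub>C r *\<^sub>R x = r *\<^sub>R c *\<^sub>C x"
  by (simp add: scaleR_scaleC scaleC_scaleC mult.commute)

lemma scaleC_diff_right: "c *\<^sub>C (x - y) = c *\<^sub>C x - c *\<^sub>C y"
  by (rule complex_vector.scale_right_diff_distrib)

lemma norm_scaleC: "norm (c *\<^sub>C x) = cmod c * norm x"
proof -
  have "cinner x x = of_real ((norm x)\<^sup>2)"
  proof -
    have "Im (cinner x x) = 0" using arg_cong[OF cinner_commute[of x x], of Im] by simp
    then show ?thesis by (simp add: complex_eq_iff power2_norm_eq_inner inner_eq_Re_cinner)
  qed
  then have "(norm (c *\<^sub>C x))\<^sup>2 = Re (c * cnj c * of_real ((norm x)\<^sup>2))"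
    unfolding power2_norm_eq_inner inner_eq_Re_cinner[of "c *\<^sub>C x"]
    by (simp add: cinner_scaleC_left cinner_scaleC_right mult.assoc)
  also have "\<dots> = (cmod c * norm x)\<^sup>2"
    by (simp add: complex_mult_cnj cmod_power2 power_mult_distrib)
  finally show ?thesis by simp
qed

lemma csubspace_imp_subspace: "complex_vector.subspace V \<Longrightarrow> subspace V"
  unfolding complex_vector.subspace_def real_vector.subspace_def by (metis scaleR_scaleC)

section \<open>Calculus of bounded complex-linear operators\<close>

lemma bounded_clinearI:
  assumes "\<And>x y. T (x + y) = T x + T y" and "\<And>c x. T (c *\<^sub>C x) = c *\<^sub>C T x"
    and "\<And>x. norm (T x) \<le> K * norm x"
  shows "bounded_clinear T"
  unfolding bounded_clinear_def
proof
  show "bounded_linear T"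
    by (rule bounded_linear_intro[of _ K])
      (use assms in \<open>auto simp: scaleR_scaleC mult.commute[of K]\<close>)
qed (use assms in auto)

lemma bounded_clinear_scaleC: "bounded_clinear (\<lambda>x. c *\<^sub>C x)"
  by (rule bounded_clinearI[where K = "cmod c"])
    (simp_all add: scaleC_add_right scaleC_scaleC mult.commute norm_scaleC)

lemma bounded_clinear_imp_bounded_linear: "bounded_clinear T \<Longrightarrow> bounded_linear T"
  by (simp add: bounded_clinear_def)

lemma
  assumes "bounded_clinear T"
  shows clin_add: "T (x + y) = T x + T y" and clin_diff: "T (x - y) = T x - T y"
    and clin_scaleC: "T (c *\<^sub>C x) = c *\<^sub>C T x" and clin_scaleR: "T (r *\<^sub>R x) = r *\<^sub>R T x"
    and clin_zero: "T 0 = 0" and clin_neg: "T (- x) = - T x"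
proof -
  have l: "linear T" using assms by (simp add: bounded_clinear_def bounded_linear.linear)
  show "T (x + y) = T x + T y" "T (x - y) = T x - T y" "T (c *\<^sub>C x) = c *\<^sub>C T x"
    "T (r *\<^sub>R x) = r *\<^sub>R T x" "T 0 = 0" "T (- x) = - T x"
    using assms linear_add[OF l] linear_diff[OF l] linear_scale[OF l] linear_0[OF l] linear_neg[OF l]
    by (simp_all add: bounded_clinear_def)
qed

lemmas clin_simps = clin_add clin_diff clin_scaleC clin_scaleR clin_zero clin_neg

lemma clin_bound:
  assumes "bounded_clinear T"
  obtains K where "0 \<le> K" and "\<And>x. norm (T x) \<le> K * norm x"
proof -
  have "\<exists>K\<ge>0. \<forall>x. norm (T x) \<le> norm x * K"
    using bounded_linear.nonneg_bounded[of T] assms by (simp add: bounded_clinear_def)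
  then show thesis using that by (auto simp: mult.commute)
qed

lemma clin_tendsto:
  assumes "bounded_clinear T" and "(f \<longlongrightarrow> a) F"
  shows "((\<lambda>x. T (f x)) \<longlongrightarrow> T a) F"
  using assms bounded_linear.tendsto by (auto simp: bounded_clinear_def)

lemma bounded_clinear_compose:
  assumes "bounded_clinear S" and "bounded_clinear T"
  shows "bounded_clinear (\<lambda>x. S (T x))"
  using assms bounded_linear_compose[of S T] by (auto simp: bounded_clinear_def)

lemma bounded_clinear_comp:
  assumes "bounded_clinear S" and "bounded_clinear T"
  shows "bounded_clinear (S \<circ> T)"
  using bounded_clinear_compose[OF assms] by (simp add: comp_def)

lemma bounded_clinear_id: "bounded_clinear (\<lambda>x. x)"
  by (auto simp: bounded_clinear_def bounded_linear_ident)

lemma bounded_clinear_zero: "bounded_clinear (\<lambda>x. 0)"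
  by (auto simp: bounded_clinear_def bounded_linear_zero)

lemma bounded_clinear_add:
  assumes "bounded_clinear S" and "bounded_clinear T"
  shows "bounded_clinear (\<lambda>x. S x + T x)"
  using assms bounded_linear_add[of S T] by (auto simp: bounded_clinear_def scaleC_add_right)

lemma bounded_clinear_diff:
  assumes "bounded_clinear S" and "bounded_clinear T"
  shows "bounded_clinear (\<lambda>x. S x - T x)"
  using assms bounded_linear_sub[of S T] by (auto simp: bounded_clinear_def scaleC_diff_right)

lemma bounded_clinear_scaleR:
  assumes "bounded_clinear T"
  shows "bounded_clinear (\<lambda>x. r *\<^sub>R T x)"
  using assms bounded_linear_compose[OF bounded_linear_scaleR_right, of T]
  by (auto simp: bounded_clinear_def scaleC_scaleR)

lemmas bounded_clinear_intros =
  bounded_clinear_id bounded_clinear_zero bounded_clinear_add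
  bounded_clinear_diff bounded_clinear_scaleR

text \<open>The imaginary part of the complex identity is the real identity at
  \<open>\<i> x\<close>, because \<open>T\<close> commutes with \<open>\<i>\<close>. Adjoints can
  therefore be handled with the real inner product alone.\<close>

lemma cinner_adjoint_iff_inner:
  assumes "bounded_clinear T"
  shows "(\<forall>x y. cinner (T x) y = cinner x (S y)) \<longleftrightarrow> (\<forall>x y. inner (T x) y = inner x (S y))"
proof
  assume R: "\<forall>x y. inner (T x) y = inner x (S y)"
  show "\<forall>x y. cinner (T x) y = cinner x (S y)"
  proof (intro allI)
    fix x y
    have "inner (T x) (\<i> *\<^sub>C y) = - inner (T (\<i> *\<^sub>C x)) y"
      by (simp add: clin_scaleC[OF assms] inner_scaleC_i)
    also have "\<dots> = inner x (\<i> *\<^sub>C S y)" by (simp add: R inner_scaleC_i)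
    finally show "cinner (T x) y = cinner x (S y)" by (simp add: cinner_eq_inner R)
  qed
qed (simp add: inner_eq_Re_cinner)

lemma adjoint_exists:
  assumes "bounded_clinear T"
  shows "\<exists>S. bounded_clinear S \<and> (\<forall>x y. inner (T x) y = inner x (S y))"
proof -
  obtain K where K: "0 \<le> K" "\<And>x. norm (T x) \<le> K * norm x" using clin_bound[OF assms] by blast
  have "\<exists>s. \<forall>x. inner (T x) y = inner x s" for y
  proof -
    have "\<exists>s \<in> closure (id ` UNIV). \<forall>x \<in> UNIV. inner (T x) y = inner s (id x)"
    proof (rule riesz_representation_through[where C = "K * norm y"])
      show "linear (\<lambda>x. inner (T x) y)"
        by (rule linearI) (simp_all add: clin_simps[OF assms] inner_add_left)
      show "\<bar>inner (T x) y\<bar> \<le> K * norm y * norm (id x)" for x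
        using Cauchy_Schwarz_ineq2[of "T x" y] mult_right_mono[OF K(2)[of x], of "norm y"]
        by (simp add: mult_ac)
    qed (auto intro: linear_id)
    then show ?thesis by (auto simp: inner_commute)
  qed
  then obtain S where S: "\<And>x y. inner (T x) y = inner x (S y)" by metis
  have "bounded_clinear S"
  proof (rule bounded_clinearI)
    show "S (x + y) = S x + S y" for x y
      by (rule inner_extI) (simp add: inner_add_right flip: S)
    show "S (c *\<^sub>C x) = c *\<^sub>C S x" for c x
    proof -
      have "inner z (S (c *\<^sub>C x)) = inner z (c *\<^sub>C S x)" for z
      proof -
        have "inner z (c *\<^sub>C S x) = inner (cnj c *\<^sub>C z) (S x)" by (simp add: inner_scaleC_adj)
        also have "\<dots> = inner (T z) (c *\<^sub>C x)"
          by (simp add: clin_simps[OF assms] inner_scaleC_adj flip: S)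
        finally show ?thesis by (simp add: S)
      qed
      then show ?thesis by (rule inner_extI)
    qed
    show "norm (S y) \<le> K * norm y" for y
    proof -
      have "(norm (S y))\<^sup>2 = inner (T (S y)) y" by (simp add: S power2_norm_eq_inner)
      also have "\<dots> \<le> norm (T (S y)) * norm y" by (rule norm_cauchy_schwarz)
      also have "\<dots> \<le> (K * norm (S y)) * norm y" by (intro mult_right_mono K) simp
      finally have *: "norm (S y) * norm (S y) \<le> norm (S y) * (K * norm y)"
        by (simp add: power2_eq_square mult_ac)
      show ?thesis
      proof (cases "S y = 0")
        case True
        then show ?thesis using K(1) by simp
      next
        case False
        then show ?thesis using * by simp
      qed
    qed
  qed
  then show ?thesis using S by blast
qed

lemma cadjoint_eqI:
  assumes "bounded_clinear T" and "\<And>x y. inner (T x) y = inner x (S y)"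
  shows "cadjoint T = S"
  unfolding cadjoint_def
proof (rule the_equality)
  show "\<forall>x y. cinner (T x) y = cinner x (S y)"
    using cinner_adjoint_iff_inner[OF assms(1)] assms(2) by blast
  fix S' assume "\<forall>x y. cinner (T x) y = cinner x (S' y)"
  then have "cinner (T x) y = cinner x (S' y)" for x y by blast
  then have "Re (cinner (T x) y) = Re (cinner x (S' y))" for x y by (rule arg_cong)
  then have "inner x (S' y) = inner x (S y)" for x y
    unfolding inner_eq_Re_cinner[symmetric] assms(2) by (rule sym)
  then have "S' y = S y" for y by (rule inner_extI)
  then show "S' = S" by (rule ext)
qed

lemma
  assumes "bounded_clinear T"
  shows bounded_clinear_cadjoint: "bounded_clinear (cadjoint T)"
    and inner_cadjoint: "inner (T x) y = inner x (cadjoint T y)"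
proof -
  obtain S where S: "bounded_clinear S" "\<And>x y. inner (T x) y = inner x (S y)"
    using adjoint_exists[OF assms] by blast
  have "cadjoint T = S" using cadjoint_eqI[OF assms S(2)] .
  then show "bounded_clinear (cadjoint T)" "inner (T x) y = inner x (cadjoint T y)"
    using S by auto
qed

section \<open>Selfadjoint operators and orthogonal projections\<close>

lemma selfadjoint_op_iff:
  "selfadjoint_op T \<longleftrightarrow> bounded_clinear T \<and> (\<forall>x y. inner (T x) y = inner x (T y))"
proof
  assume "selfadjoint_op T"
  then have T: "bounded_clinear T" "cadjoint T = T" by (simp_all add: selfadjoint_op_def)
  show "bounded_clinear T \<and> (\<forall>x y. inner (T x) y = inner x (T y))"
    using inner_cadjoint[OF T(1)] T by simp
next
  assume "bounded_clinear T \<and> (\<forall>x y. inner (T x) y = inner x (T y))"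
  then show "selfadjoint_op T"
    using cadjoint_eqI[of T T] by (simp add: selfadjoint_op_def)
qed

lemma selfadjoint_opI:
  "bounded_clinear T \<Longrightarrow> (\<And>x y. inner (T x) y = inner x (T y)) \<Longrightarrow> selfadjoint_op T"
  by (simp add: selfadjoint_op_iff)

lemma
  assumes "selfadjoint_op T"
  shows sa_bounded: "bounded_clinear T" and sa_inner: "inner (T x) y = inner x (T y)"
  using assms by (auto simp: selfadjoint_op_iff)

lemma selfadjoint_op_add:
  "selfadjoint_op S \<Longrightarrow> selfadjoint_op T \<Longrightarrow> selfadjoint_op (\<lambda>x. S x + T x)"
  by (auto simp: selfadjoint_op_iff inner_add intro: bounded_clinear_intros)

lemma selfadjoint_op_diff:
  "selfadjoint_op S \<Longrightarrow> selfadjoint_op T \<Longrightarrow> selfadjoint_op (\<lambda>x. S x - T x)"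
  by (auto simp: selfadjoint_op_iff inner_diff intro: bounded_clinear_intros)

lemma selfadjoint_op_scaleR: "selfadjoint_op T \<Longrightarrow> selfadjoint_op (\<lambda>x. r *\<^sub>R T x)"
  by (auto simp: selfadjoint_op_iff intro: bounded_clinear_intros)

lemma selfadjoint_op_id: "selfadjoint_op (\<lambda>x. x)"
  by (auto simp: selfadjoint_op_iff intro: bounded_clinear_intros)

lemma selfadjoint_op_compose:
  assumes "selfadjoint_op S" "selfadjoint_op T" "\<And>x. S (T x) = T (S x)"
  shows "selfadjoint_op (\<lambda>x. S (T x))"
  using assms by (auto simp: selfadjoint_op_iff intro: bounded_clinear_compose)

lemmas selfadjoint_op_intros =
  selfadjoint_op_add selfadjoint_op_diff selfadjoint_op_scaleR selfadjoint_op_id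

lemma nonneg_op_iff: "nonneg_op T \<longleftrightarrow> selfadjoint_op T \<and> (\<forall>x. 0 \<le> inner (T x) x)"
  by (simp add: nonneg_op_def inner_eq_Re_cinner)

text \<open>Polarization of the difference \<open>D\<close>: the real part of the form kills its
  symmetric part, the imaginary part with \<open>\<i> y\<close> inserted kills its antisymmetric
  part. This makes weakly defined spectral integrals unique.\<close>

lemma bounded_clinear_eq_if_quadratic_eq:
  assumes S: "bounded_clinear S" and T: "bounded_clinear T"
    and eq: "\<And>x. cinner (S x) x = cinner (T x) x"
  shows "S = T"
proof -
  define D where "D x = S x - T x" for x
  have D: "bounded_clinear D" unfolding D_def by (intro bounded_clinear_intros S T)
  have q: "inner (D x) x = 0" for x
    using arg_cong[OF eq[of x], of Re] by (simp add: cinner_eq_inner D_def inner_diff_left)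
  have q2: "inner (D x) (\<i> *\<^sub>C x) = 0" for x
    using arg_cong[OF eq[of x], of Im] by (simp add: cinner_eq_inner D_def inner_diff_left)
  have a: "inner (D x) y + inner (D y) x = 0" for x y
    using q[of "x + y"] q[of x] q[of y] by (simp add: clin_simps[OF D] inner_add)
  have b: "inner (D x) y - inner (D y) x = 0" for x y
  proof -
    have "inner (D x) (\<i> *\<^sub>C z) + inner (D z) (\<i> *\<^sub>C x) = 0" for z
      using q2[of "x + z"] q2[of x] q2[of z]
      by (simp add: clin_add[OF D] inner_add scaleC_add_right)
    note this[of "\<i> *\<^sub>C y"]
    moreover have "\<i> *\<^sub>C \<i> *\<^sub>C y = - y"
      by (simp add: scaleC_scaleC complex_vector.scale_minus_left scaleC_one)
    moreover have "inner (D (\<i> *\<^sub>C y)) (\<i> *\<^sub>C x) = inner (D y) x"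
      by (simp add: clin_scaleC[OF D] inner_scaleC_adj scaleC_scaleC scaleC_one)
    ultimately show ?thesis by simp
  qed
  have "inner (D x) y = 0" for x y using a[of x y] b[of x y] by simp
  then have "D x = 0" for x by (metis inner_eq_zero_iff)
  then show ?thesis by (auto simp: D_def)
qed

lemma orthogonal_projection_exists:
  fixes V :: "'a :: chilbert_space set"
  assumes "complex_vector.subspace V" and "closed V"
  obtains P where "selfadjoint_op P" and "P \<circ> P = P" and "range P = V"
    and "\<And>x. P x = x \<longleftrightarrow> x \<in> V" and "\<And>x. P x = 0 \<longleftrightarrow> (\<forall>v\<in>V. inner x v = 0)"
proof -
  note V = csubspace_imp_subspace[OF assms(1)]
  obtain P where PV: "\<And>x. P x \<in> V" and Po: "\<And>x v. v \<in> V \<Longrightarrow> inner (x - P x) v = 0"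
    using orthogonal_decomposition[OF V assms(2)] by metis
  \<comment> \<open>Uniqueness of the orthogonal decomposition; additivity and homogeneity of
    \<open>P\<close> are both read off from it.\<close>
  have uniq: "P x = p" if "p \<in> V" "\<And>v. v \<in> V \<Longrightarrow> inner (x - p) v = 0" for x p
  proof -
    have "P x - p \<in> V" using V PV that(1) by (simp add: subspace_diff)
    then have "inner (x - p) (P x - p) - inner (x - P x) (P x - p) = 0" using Po that(2) by simp
    then have "inner (P x - p) (P x - p) = 0" by (simp add: inner_diff_left)
    then show ?thesis by simp
  qed
  have Pin: "inner (P x) v = inner x v" if "v \<in> V" for x v
    using Po[OF that, of x] by (simp add: inner_diff_left)
  have bc: "bounded_clinear P"
  proof (rule bounded_clinearI)
    show "P (x + y) = P x + P y" for x y
      by (rule uniq) (auto simp: PV V subspace_add inner_diff_left inner_add_left Pin)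
    show "P (c *\<^sub>C x) = c *\<^sub>C P x" for c x
    proof (rule uniq)
      show "c *\<^sub>C P x \<in> V" using PV assms(1) by (rule complex_vector.subspace_scale[rotated])
      fix v assume "v \<in> V"
      then have "cnj c *\<^sub>C v \<in> V" using assms(1) by (rule complex_vector.subspace_scale[rotated])
      then show "inner (c *\<^sub>C x - c *\<^sub>C P x) v = 0"
        using Po[of "cnj c *\<^sub>C v" x] by (simp add: inner_scaleC_adj flip: scaleC_diff_right)
    qed
    show "norm (P x) \<le> 1 * norm x" for x
    proof -
      have "(norm (P x))\<^sup>2 = inner x (P x)" using Pin[OF PV] by (simp add: power2_norm_eq_inner)
      also have "\<dots> \<le> norm x * norm (P x)" by (rule norm_cauchy_schwarz)
      finally show ?thesis by (cases "P x = 0") (auto simp: power2_eq_square)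
    qed
  qed
  have fix_iff: "P x = x \<longleftrightarrow> x \<in> V" for x using PV[of x] uniq[of x x] by auto
  show thesis
  proof
    show "selfadjoint_op P"
    proof (rule selfadjoint_opI[OF bc])
      show "inner (P x) y = inner x (P y)" for x y
        using Pin[OF PV, of x y] Pin[OF PV, of y x] by (simp add: inner_commute)
    qed
    show "P \<circ> P = P" using fix_iff PV by auto
    show "range P = V"
    proof (intro equalityI subsetI)
      show "x \<in> V" if "x \<in> range P" for x using that PV by auto
      show "x \<in> range P" if "x \<in> V" for x using that fix_iff rangeI[of P x] by metis
    qed
    show "P x = x \<longleftrightarrow> x \<in> V" for x by (rule fix_iff)
    show "P x = 0 \<longleftrightarrow> (\<forall>v\<in>V. inner x v = 0)" for x
    proof
      assume "P x = 0"
      then show "\<forall>v\<in>V. inner x v = 0" using Pin by (metis inner_zero_left)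
    next
      assume "\<forall>v\<in>V. inner x v = 0"
      then have "inner (P x) (P x) = 0" using Pin[OF PV] PV by simp
      then show "P x = 0" by simp
    qed
  qed
qed

section \<open>Square roots\<close>

lemma discriminant_if_quadratic_nonneg:
  fixes a b c :: real
  assumes q: "\<And>r. 0 \<le> a + 2 * r * b + r\<^sup>2 * c" and "0 \<le> c"
  shows "b\<^sup>2 \<le> a * c"
proof (cases "c = 0")
  case True
  have "b = 0"
  proof (rule ccontr)
    assume "b \<noteq> 0"
    \<comment> \<open>This \<open>r\<close> makes the affine expression equal to -1.\<close>
    have "0 \<le> a + 2 * (- (a + 1) / (2 * b)) * b" using q[of "- (a + 1) / (2 * b)"] True by simp
    also have "2 * (- (a + 1) / (2 * b)) * b = - (a + 1)" using \<open>b \<noteq> 0\<close> by simp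
    finally show False by simp
  qed
  then show ?thesis using True by simp
next
  case False
  then have c: "0 < c" using \<open>0 \<le> c\<close> by simp
  have "0 \<le> a + 2 * (- b / c) * b + (- b / c)\<^sup>2 * c" by (rule q)
  also have "\<dots> = a - b\<^sup>2 / c" using c by (simp add: power2_eq_square field_simps)
  finally show ?thesis using c by (simp add: field_simps)
qed

lemma nonneg_op_cauchy_schwarz:
  assumes "nonneg_op T"
  shows "(inner (T x) y)\<^sup>2 \<le> inner (T x) x * inner (T y) y"
proof -
  have sa: "selfadjoint_op T" and nn: "\<And>x. 0 \<le> inner (T x) x"
    using assms by (auto simp: nonneg_op_iff)
  note T = sa_bounded[OF sa]
  define a b c where "a = inner (T x) x" and "b = inner (T x) y" and "c = inner (T y) y"
  have sym: "inner (T y) x = b" using sa_inner[OF sa, of y x] by (simp add: b_def inner_commute)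
  have q: "0 \<le> a + 2 * r * b + r\<^sup>2 * c" for r
    using nn[of "x + r *\<^sub>R y"] sym
    by (simp add: clin_simps[OF T] inner_add a_def b_def c_def power2_eq_square algebra_simps)
  have "b\<^sup>2 \<le> a * c"
    by (rule discriminant_if_quadratic_nonneg[OF q]) (simp add: c_def nn)
  then show ?thesis by (simp add: a_def b_def c_def)
qed

text \<open>Cauchy-Schwarz with \<open>y = T x\<close> bounds the fourth power of the norm of
  \<open>T x\<close> by zero.\<close>

lemma nonneg_op_eq_zero:
  assumes "nonneg_op T" and "inner (T x) x = 0"
  shows "T x = 0"
  using nonneg_op_cauchy_schwarz[OF assms(1), of x "T x"] assms(2) by simp

text \<open>
  The iteration \<open>Y\<^sub>n\<^sub>+\<^sub>1 = (B + Y\<^sub>n\<^sup>2) / 2\<close> converges in norm for every contraction \<open>B\<close>, because it is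
  dominated by the scalar iteration with \<open>B = 1\<close>; if \<open>Y\<close> is the limit then \<open>(1 - Y)\<^sup>2 = 1 - B\<close>.
\<close>

fun sqrt_iter :: "('a :: chilbert_space \<Rightarrow> 'a) \<Rightarrow> nat \<Rightarrow> 'a \<Rightarrow> 'a" where
  "sqrt_iter B 0 x = 0"
| "sqrt_iter B (Suc n) x = (1/2) *\<^sub>R (B x + sqrt_iter B n (sqrt_iter B n x))"

fun sqrt_iter_bound :: "nat \<Rightarrow> real" where
  "sqrt_iter_bound 0 = 0"
| "sqrt_iter_bound (Suc n) = (1 + (sqrt_iter_bound n)\<^sup>2) / 2"

lemma sqrt_iter_bound_le_1: "0 \<le> sqrt_iter_bound n \<and> sqrt_iter_bound n \<le> 1"
  by (induction n) (auto simp: power_le_one)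

lemma sqrt_iter_bound_mono: "sqrt_iter_bound n \<le> sqrt_iter_bound (Suc n)"
proof (induction n)
  case (Suc n)
  then show ?case using sqrt_iter_bound_le_1[of n] by (auto intro!: power_mono)
qed simp

context
  fixes B :: "'a :: chilbert_space \<Rightarrow> 'a"
  assumes sa: "selfadjoint_op B" and contr: "\<And>x. norm (B x) \<le> norm x"
begin

text \<open>Each iterate is a polynomial in \<open>B\<close>.\<close>

lemma sqrt_iter_commute:
  assumes "bounded_clinear T" and "\<And>x. T (B x) = B (T x)"
  shows "T (sqrt_iter B n x) = sqrt_iter B n (T x)"
proof (induction n arbitrary: x)
  case 0
  then show ?case by (simp add: clin_simps[OF assms(1)])
next
  case (Suc n)
  then show ?case by (simp add: clin_simps[OF assms(1)] assms(2))
qed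

lemma bounded_clinear_sqrt_iter: "bounded_clinear (sqrt_iter B n)"
proof (induction n)
  case (Suc n)
  show ?case unfolding sqrt_iter.simps
    by (intro bounded_clinear_scaleR bounded_clinear_add sa_bounded[OF sa]
        bounded_clinear_compose[OF Suc Suc])
qed (simp add: bounded_clinear_zero)

lemma selfadjoint_sqrt_iter: "selfadjoint_op (sqrt_iter B n)"
proof (induction n)
  case 0
  then show ?case by (auto intro: selfadjoint_opI bounded_clinear_zero)
next
  case (Suc n)
  show ?case unfolding sqrt_iter.simps
    by (intro selfadjoint_op_scaleR selfadjoint_op_add sa selfadjoint_op_compose[OF Suc Suc] refl)
qed

lemma norm_sqrt_iter: "norm (sqrt_iter B n x) \<le> sqrt_iter_bound n * norm x"
proof (induction n arbitrary: x)
  case (Suc n)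
  have "norm (sqrt_iter B (Suc n) x) \<le> (norm (B x) + norm (sqrt_iter B n (sqrt_iter B n x))) / 2"
    using norm_triangle_ineq by simp
  also have "norm (sqrt_iter B n (sqrt_iter B n x)) \<le> sqrt_iter_bound n * (sqrt_iter_bound n * norm x)"
    using Suc[of "sqrt_iter B n x"] mult_left_mono[OF Suc[of x], of "sqrt_iter_bound n"]
      sqrt_iter_bound_le_1[of n] by linarith
  finally show ?case using contr[of x] by (simp add: power2_eq_square field_simps)
qed simp

text \<open>With consecutive iterates \<open>Y\<close> and \<open>Z\<close>,
  \<open>Y Y - Z Z = Y (Y - Z) + (Y - Z) Z\<close>, and the bounds of the two terms add up to the
  scalar difference \<open>y^2 - z^2\<close>. So the increments are dominated by a telescoping
  series.\<close>

lemma norm_sqrt_iter_step: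
  "norm (sqrt_iter B (Suc n) x - sqrt_iter B n x)
     \<le> (sqrt_iter_bound (Suc n) - sqrt_iter_bound n) * norm x"
proof (induction n arbitrary: x)
  case 0
  then show ?case using contr[of x] by simp
next
  case (Suc n)
  define Y Z where "Y = sqrt_iter B (Suc n)" and "Z = sqrt_iter B n"
  define y z where "y = sqrt_iter_bound (Suc n)" and "z = sqrt_iter_bound n"
  note Yb = bounded_clinear_sqrt_iter[of "Suc n", folded Y_def]
  have yz: "0 \<le> z" "z \<le> y" "0 \<le> y" using sqrt_iter_bound_le_1 sqrt_iter_bound_mono by (auto simp: y_def z_def)
  have Y: "norm (Y x) \<le> y * norm x" for x using norm_sqrt_iter by (simp add: Y_def y_def del: sqrt_iter.simps sqrt_iter_bound.simps)
  have Z: "norm (Z x) \<le> z * norm x" for x using norm_sqrt_iter by (simp add: Z_def z_def)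
  have IH: "norm (Y x - Z x) \<le> (y - z) * norm x" for x
    using Suc by (simp add: Y_def Z_def y_def z_def del: sqrt_iter.simps sqrt_iter_bound.simps)
  have "sqrt_iter B (Suc (Suc n)) x - sqrt_iter B (Suc n) x = (1/2) *\<^sub>R (Y (Y x) - Z (Z x))"
    by (simp add: Y_def Z_def flip: scaleR_diff_right)
  also have "\<dots> = (1/2) *\<^sub>R (Y (Y x - Z x) + (Y (Z x) - Z (Z x)))"
    by (simp add: clin_diff[OF Yb])
  also have "norm \<dots> \<le> (norm (Y (Y x - Z x)) + norm (Y (Z x) - Z (Z x))) / 2"
    using norm_triangle_ineq by simp
  also have "\<dots> \<le> (y * ((y - z) * norm x) + (y - z) * (z * norm x)) / 2"
  proof -
    have "norm (Y (Y x - Z x)) \<le> y * ((y - z) * norm x)"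
      using Y[of "Y x - Z x"] mult_left_mono[OF IH[of x] yz(3)] by linarith
    moreover have "norm (Y (Z x) - Z (Z x)) \<le> (y - z) * (z * norm x)"
      using IH[of "Z x"] mult_left_mono[OF Z[of x], of "y - z"] yz by linarith
    ultimately show ?thesis by simp
  qed
  also have "\<dots> = ((1 + y\<^sup>2) / 2 - (1 + z\<^sup>2) / 2) * norm x"
    by (simp add: power2_eq_square field_simps)
  also have "\<dots> = (sqrt_iter_bound (Suc (Suc n)) - sqrt_iter_bound (Suc n)) * norm x"
    by (simp add: y_def z_def)
  finally show ?case .
qed

lemma sqrt_iter_dist:
  assumes "m \<le> n"
  shows "norm (sqrt_iter B n x - sqrt_iter B m x) \<le> (sqrt_iter_bound n - sqrt_iter_bound m) * norm x"
  using assms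
proof (induction n rule: dec_induct)
  case (step n)
  have "norm (sqrt_iter B (Suc n) x - sqrt_iter B m x)
     \<le> norm (sqrt_iter B (Suc n) x - sqrt_iter B n x) + norm (sqrt_iter B n x - sqrt_iter B m x)"
    using norm_triangle_ineq[of "sqrt_iter B (Suc n) x - sqrt_iter B n x"
        "sqrt_iter B n x - sqrt_iter B m x"] by (simp del: sqrt_iter.simps)
  then show ?case using step norm_sqrt_iter_step[of n x] by (simp add: algebra_simps)
qed simp

text \<open>The scalar bounds are monotone and bounded, hence Cauchy, and they dominate the
  iterates. The commutation clause survives the limit and is recorded because uniqueness of the
  square root and the commutation of spectral projections rest on it.\<close>

lemma sqrt_limit_exists:
  "\<exists>Y. selfadjoint_op Y \<and> (\<forall>x. norm (Y x) \<le> norm x) \<and> (\<forall>x. 2 *\<^sub>R Y x = B x + Y (Y x)) \<and>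
     (\<forall>T. bounded_clinear T \<and> (\<forall>x. T (B x) = B (T x)) \<longrightarrow> (\<forall>x. T (Y x) = Y (T x)))"
proof -
  have "Bseq sqrt_iter_bound"
    by (rule BseqI'[where K = 1]) (use sqrt_iter_bound_le_1 in auto)
  then have "convergent sqrt_iter_bound"
    by (intro Bseq_monoseq_convergent) (simp_all only: monoseq_Suc sqrt_iter_bound_mono simp_thms)
  then have C: "Cauchy sqrt_iter_bound" by (rule convergent_Cauchy)
  have "Cauchy (\<lambda>n. sqrt_iter B n x)" for x
  proof (rule CauchyI')
    fix e :: real assume e: "0 < e"
    define d where "d = e / (norm x + 1)"
    have d: "0 < d" using e by (simp add: d_def add_nonneg_pos)
    obtain M where M: "\<And>m n. m \<ge> M \<Longrightarrow> n \<ge> M \<Longrightarrow> norm (sqrt_iter_bound m - sqrt_iter_bound n) < d"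
      using CauchyD[OF C d] by blast
    show "\<exists>M. \<forall>m\<ge>M. \<forall>n>m. dist (sqrt_iter B m x) (sqrt_iter B n x) < e"
    proof (intro exI allI impI)
      fix m n assume mn: "M \<le> m" "m < n"
      have "dist (sqrt_iter B m x) (sqrt_iter B n x) \<le> (sqrt_iter_bound n - sqrt_iter_bound m) * norm x"
        using sqrt_iter_dist[of m n x] mn by (simp add: dist_norm norm_minus_commute)
      also have "\<dots> \<le> d * norm x"
        using M[of n m] mn by (intro mult_right_mono) auto
      also have "\<dots> < d * (norm x + 1)" using d by simp
      also have "\<dots> = e" by (simp add: d_def add_nonneg_eq_0_iff)
      finally show "dist (sqrt_iter B m x) (sqrt_iter B n x) < e" .
    qed
  qed
  then obtain Y where Y: "\<And>x. (\<lambda>n. sqrt_iter B n x) \<longlonglongrightarrow> Y x"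
    unfolding Cauchy_convergent_iff convergent_def by metis
  note lin = clin_simps[OF bounded_clinear_sqrt_iter]
  have le: "norm (sqrt_iter B n x) \<le> norm x" for n x
    using norm_sqrt_iter[of n x] sqrt_iter_bound_le_1[of n] mult_right_mono[of "sqrt_iter_bound n" 1 "norm x"]
    by simp
  have Yle: "norm (Y x) \<le> norm x" for x
    by (rule LIMSEQ_le_const2[OF tendsto_norm[OF Y]]) (auto intro: le)
  have Yb: "bounded_clinear Y"
  proof (rule bounded_clinearI)
    show "Y (x + y) = Y x + Y y" for x y
      by (rule LIMSEQ_unique[OF Y]) (simp add: lin tendsto_add Y)
    show "Y (c *\<^sub>C x) = c *\<^sub>C Y x" for c x
    proof (rule LIMSEQ_unique[OF Y])
      from clin_tendsto[OF bounded_clinear_scaleC Y, of c]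
      show "(\<lambda>n. sqrt_iter B n (c *\<^sub>C x)) \<longlonglongrightarrow> c *\<^sub>C Y x" by (simp add: lin)
    qed
    show "norm (Y x) \<le> 1 * norm x" for x using Yle by simp
  qed
  have "selfadjoint_op Y"
  proof (rule selfadjoint_opI[OF Yb])
    show "inner (Y x) y = inner x (Y y)" for x y
      by (rule LIMSEQ_unique[OF tendsto_inner[OF Y tendsto_const]])
        (simp add: sa_inner[OF selfadjoint_sqrt_iter] tendsto_inner Y)
  qed
  \<comment> \<open>All iterates are contractions, so applying the n-th one to the null sequence
    \<open>sqrt_iter B n x - Y x\<close> still gives a null sequence.\<close>
  moreover have YY: "(\<lambda>n. sqrt_iter B n (sqrt_iter B n x)) \<longlonglongrightarrow> Y (Y x)" for x
  proof (rule Lim_transform[OF Y[of "Y x"]])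
    have "(\<lambda>n. sqrt_iter B n x - Y x) \<longlonglongrightarrow> Y x - Y x" by (intro tendsto_intros Y)
    then have "(\<lambda>n. sqrt_iter B n x - Y x) \<longlonglongrightarrow> 0" by simp
    then show "(\<lambda>n. sqrt_iter B n (sqrt_iter B n x) - sqrt_iter B n (Y x)) \<longlonglongrightarrow> 0"
      by (rule Lim_null_comparison[rotated, OF tendsto_norm_zero])
        (auto simp: le simp flip: clin_diff[OF bounded_clinear_sqrt_iter])
  qed
  have "2 *\<^sub>R Y x = B x + Y (Y x)" for x
  proof -
    have "(\<lambda>n. sqrt_iter B (Suc n) x) \<longlonglongrightarrow> (1/2) *\<^sub>R (B x + Y (Y x))"
      unfolding sqrt_iter.simps by (intro tendsto_intros YY)
    then have "Y x = (1/2) *\<^sub>R (B x + Y (Y x))"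
      using LIMSEQ_unique[OF LIMSEQ_Suc[OF Y]] by blast
    then show ?thesis by (metis scaleR_half_double scaleR_2 scaleR_right_distrib)
  qed
  moreover have "T (Y x) = Y (T x)" if T: "bounded_clinear T" and "\<And>x. T (B x) = B (T x)" for T x
    by (rule LIMSEQ_unique[OF clin_tendsto[OF T Y]])
      (simp add: sqrt_iter_commute[OF that] Y)
  ultimately show ?thesis using Yle by blast
qed

end

text \<open>Scaling makes \<open>B = 1 - A / k\<close> a contraction; the limit \<open>Y\<close> of
  the iteration satisfies \<open>(1 - Y)^2 = A / k\<close>, so \<open>sqrt k\<close> times
  \<open>1 - Y\<close> is a root. It is nonnegative because \<open>Y\<close> is a
  contraction.\<close>

lemma nonneg_sqrt_exists:
  assumes A: "nonneg_op A"
  shows "\<exists>R. nonneg_op R \<and> R \<circ> R = A \<and>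
     (\<forall>T. bounded_clinear T \<longrightarrow> (\<forall>x. T (A x) = A (T x)) \<longrightarrow> (\<forall>x. T (R x) = R (T x)))"
proof -
  have sa: "selfadjoint_op A" and nn: "\<And>x. 0 \<le> inner (A x) x"
    using A by (auto simp: nonneg_op_iff)
  obtain K where K: "0 \<le> K" "\<And>x. norm (A x) \<le> K * norm x" using clin_bound[OF sa_bounded[OF sa]] by blast
  \<comment> \<open>The added 1 keeps \<open>k\<close> positive even when \<open>K\<close> is
    0.\<close>
  define k where "k = K + 1"
  have k: "0 < k" using K by (simp add: k_def)
  define B where "B x = x - (1 / k) *\<^sub>R A x" for x
  have B: "selfadjoint_op B" unfolding B_def by (intro selfadjoint_op_intros sa)
  have "norm (B x) \<le> norm x" for x
  proof -
    \<comment> \<open>This inequality is exactly what contractivity of \<open>B\<close> requires. It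
      is Cauchy-Schwarz for the form of \<open>A\<close> with \<open>y = A x\<close>, after
      cancelling the squared norm of \<open>A x\<close>.\<close>
    have "(norm (A x))\<^sup>2 \<le> k * inner (A x) x"
    proof (cases "A x = 0")
      case False
      have "((norm (A x))\<^sup>2)\<^sup>2 \<le> inner (A x) x * inner (A (A x)) (A x)"
        using nonneg_op_cauchy_schwarz[OF A, of x "A x"] by (simp add: power2_norm_eq_inner)
      also have "inner (A x) x * inner (A (A x)) (A x) \<le> inner (A x) x * (k * norm (A x) * norm (A x))"
      proof (rule mult_left_mono[OF _ nn])
        have "norm (A (A x)) \<le> k * norm (A x)"
          using K(2)[of "A x"] norm_ge_zero[of "A x"]
          unfolding k_def distrib_right by linarith
        then show "inner (A (A x)) (A x) \<le> k * norm (A x) * norm (A x)"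
          using norm_cauchy_schwarz[of "A (A x)" "A x"] mult_right_mono[of _ _ "norm (A x)"]
          by (meson norm_ge_zero order_trans)
      qed
      finally have "(norm (A x))\<^sup>2 * (norm (A x))\<^sup>2 \<le> k * inner (A x) x * (norm (A x))\<^sup>2"
        by (simp add: power2_eq_square mult_ac)
      then show ?thesis by (rule mult_right_le_imp_le) (use False in simp)
    qed (use nn k in simp)
    moreover have "(norm (B x))\<^sup>2 = (norm x)\<^sup>2 - (2 * k * inner (A x) x - (norm (A x))\<^sup>2) / k\<^sup>2"
    proof -
      have "(norm (x - r *\<^sub>R A x))\<^sup>2 = (norm x)\<^sup>2 - 2 * r * inner (A x) x + r\<^sup>2 * (norm (A x))\<^sup>2" for r
        unfolding power2_norm_eq_inner
        by (simp add: inner_diff inner_commute power2_eq_square algebra_simps)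
      from this[of "1 / k"] show ?thesis
        using k by (simp add: B_def power2_eq_square field_simps)
    qed
    moreover have "0 \<le> k * inner (A x) x" using k nn by simp
    ultimately have "(norm (B x))\<^sup>2 \<le> (norm x)\<^sup>2" by simp
    then show ?thesis by (rule power2_le_imp_le) simp
  qed
  from sqrt_limit_exists[OF B this]
  obtain Y where Y: "selfadjoint_op Y" and Yle: "\<forall>x. norm (Y x) \<le> norm x"
    and Yeq: "\<forall>x. 2 *\<^sub>R Y x = B x + Y (Y x)"
    and Yc: "\<forall>T. bounded_clinear T \<and> (\<forall>x. T (B x) = B (T x)) \<longrightarrow> (\<forall>x. T (Y x) = Y (T x))"
    by (elim exE conjE)
  define R where "R x = sqrt k *\<^sub>R (x - Y x)" for x
  note Yb = sa_bounded[OF Y]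
  have "selfadjoint_op R" unfolding R_def
    by (rule selfadjoint_op_scaleR[OF selfadjoint_op_diff[OF selfadjoint_op_id Y]])
  moreover have "0 \<le> inner (R x) x" for x
  proof -
    have "inner (Y x) x \<le> norm (Y x) * norm x" by (rule norm_cauchy_schwarz)
    also have "\<dots> \<le> norm x * norm x" by (intro mult_right_mono) (simp_all add: Yle)
    finally show ?thesis
      using k by (simp add: R_def inner_diff_left dot_square_norm power2_eq_square)
  qed
  moreover have "R \<circ> R = A"
  proof
    fix x
    have "(R \<circ> R) x = k *\<^sub>R (x - 2 *\<^sub>R Y x + Y (Y x))"
      using k by (simp add: R_def clin_simps[OF Yb] scaleR_2 algebra_simps)
    also have "\<dots> = k *\<^sub>R (x - B x)" by (simp add: Yeq)
    also have "\<dots> = A x" using k by (simp add: B_def)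
    finally show "(R \<circ> R) x = A x" .
  qed
  moreover have "T (R x) = R (T x)"
    if T: "bounded_clinear T" and TA: "\<And>x. T (A x) = A (T x)" for T x
  proof -
    have "T (Y x) = Y (T x)"
      using Yc T TA by (simp add: B_def clin_simps[OF T])
    then show ?thesis by (simp add: R_def clin_simps[OF T])
  qed
  ultimately show ?thesis unfolding nonneg_op_iff by blast
qed

text \<open>Commutation factors the difference of the squares, so \<open>R + Q\<close> kills
  \<open>y = R x - Q x\<close>. Two nonnegative forms with sum zero both vanish at \<open>y\<close>,
  hence \<open>R y = Q y = 0\<close>, and then \<open>y\<close> is orthogonal to itself.\<close>

lemma nonneg_sqrt_unique:
  assumes R: "nonneg_op R" and Q: "nonneg_op Q" and eq: "R \<circ> R = Q \<circ> Q"
    and comm: "\<And>x. Q (R x) = R (Q x)"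
  shows "R = Q"
proof
  fix x
  note Rb = sa_bounded[of R] and Qb = sa_bounded[of Q]
  have saR: "selfadjoint_op R" and saQ: "selfadjoint_op Q"
    using R Q by (auto simp: nonneg_op_iff)
  define y where "y = R x - Q x"
  have 0: "R y + Q y = 0"
    using fun_cong[OF eq, of x] comm[of x]
    by (simp add: y_def clin_simps[OF Rb[OF saR]] clin_simps[OF Qb[OF saQ]])
  have "inner (R y) y + inner (Q y) y = 0"
    using arg_cong[OF 0, of "\<lambda>z. inner z y"] by (simp add: inner_add_left)
  moreover have "0 \<le> inner (R y) y" "0 \<le> inner (Q y) y" using R Q by (auto simp: nonneg_op_iff)
  ultimately have "R y = 0" "Q y = 0"
    using nonneg_op_eq_zero[OF R, of y] nonneg_op_eq_zero[OF Q, of y] by auto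
  then have "inner (R x - Q x) y = 0"
    using sa_inner[OF saR, of x y] sa_inner[OF saQ, of x y] by (simp add: inner_diff_left)
  then have "inner y y = 0" by (simp only: y_def)
  then show "R x = Q x" by (simp add: y_def)
qed

lemma
  assumes A: "nonneg_op A"
  shows nonneg_op_sqrt: "nonneg_op (op_sqrt A)"
    and op_sqrt_comp: "op_sqrt A (op_sqrt A x) = A x"
    and op_sqrt_commute: "\<And>T x. bounded_clinear T \<Longrightarrow> (\<And>x. T (A x) = A (T x)) \<Longrightarrow>
       T (op_sqrt A x) = op_sqrt A (T x)"
    and op_sqrt_eqI: "\<And>Q. nonneg_op Q \<Longrightarrow> (\<And>x. Q (Q x) = A x) \<Longrightarrow> op_sqrt A = Q"
proof -
  obtain R where R: "nonneg_op R" "R \<circ> R = A"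
    and comm: "\<And>T x. bounded_clinear T \<Longrightarrow> (\<And>x. T (A x) = A (T x)) \<Longrightarrow> T (R x) = R (T x)"
    using nonneg_sqrt_exists[OF A] by blast
  \<comment> \<open>A competing root \<open>Q\<close> commutes with its own square \<open>A\<close>,
    hence with \<open>R\<close> by the commutation clause; this supplies the premise of
    \<open>nonneg_sqrt_unique\<close>.\<close>
  have uniq: "Q = R" if Q: "nonneg_op Q" "Q \<circ> Q = A" for Q
  proof (rule sym, rule nonneg_sqrt_unique[OF R(1) Q(1)])
    show "R \<circ> R = Q \<circ> Q" using R Q by simp
    have QQ: "Q (Q x) = A x" for x using fun_cong[OF Q(2), of x] by simp
    show "Q (R x) = R (Q x)" for x
    proof (rule comm)
      show "bounded_clinear Q" using Q(1) by (simp add: nonneg_op_iff sa_bounded)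
      show "Q (A x) = A (Q x)" for x by (simp flip: QQ)
    qed
  qed
  have eq: "op_sqrt A = R"
    unfolding op_sqrt_def
  proof (rule the_equality)
    show "nonneg_op R \<and> R \<circ> R = A" using R by simp
    show "Q = R" if "nonneg_op Q \<and> Q \<circ> Q = A" for Q using uniq[of Q] that by simp
  qed
  show "nonneg_op (op_sqrt A)" using R eq by simp
  show "op_sqrt A (op_sqrt A x) = A x" using fun_cong[OF R(2), of x] eq by simp
  show "T (op_sqrt A x) = op_sqrt A (T x)"
    if "bounded_clinear T" "\<And>x. T (A x) = A (T x)" for T x
    using comm[OF that] eq by simp
  show "op_sqrt A = Q" if "nonneg_op Q" "\<And>x. Q (Q x) = A x" for Q
    using uniq[OF that(1)] that(2) eq by (simp add: fun_eq_iff)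
qed

section \<open>The spectral theorem\<close>

text \<open>
  The projection onto the kernel of the positive part \<open>(\<bar>K\<bar> + K) / 2\<close>; on its orthogonal
  complement \<open>K\<close> agrees with \<open>\<bar>K\<bar>\<close>.
\<close>

lemma nonpositive_projection_exists:
  assumes K: "selfadjoint_op K"
  shows "\<exists>E. selfadjoint_op E \<and> (\<forall>x. E (E x) = E x) \<and>
     (\<forall>x. E x = x \<longrightarrow> inner (K x) x \<le> 0) \<and>
     (\<forall>x. E x = 0 \<longrightarrow> x \<noteq> 0 \<longrightarrow> 0 < inner (K x) x) \<and>
     (\<forall>T. selfadjoint_op T \<longrightarrow> (\<forall>x. T (K x) = K (T x)) \<longrightarrow> (\<forall>x. T (E x) = E (T x)))"
proof -
  note Kb = sa_bounded[OF K]
  have K2: "nonneg_op (\<lambda>x. K (K x))"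
    unfolding nonneg_op_iff
    by (auto intro: selfadjoint_op_compose[OF K K] simp: sa_inner[OF K, of "K _"])
  define A where "A = op_sqrt (\<lambda>x. K (K x))"
  have A: "nonneg_op A" and AA: "\<And>x. A (A x) = K (K x)"
    and Ac: "\<And>T x. bounded_clinear T \<Longrightarrow> (\<And>x. T (K (K x)) = K (K (T x))) \<Longrightarrow> T (A x) = A (T x)"
    unfolding A_def using nonneg_op_sqrt[OF K2] op_sqrt_comp[OF K2] op_sqrt_commute[OF K2] by auto
  have Asa: "selfadjoint_op A" using A by (simp add: nonneg_op_iff)
  note Ab = sa_bounded[OF Asa]
  have AK: "K (A x) = A (K x)" for x by (rule Ac[OF Kb refl])
  define Q where "Q x = A x + K x" for x
  have Q: "selfadjoint_op Q" unfolding Q_def by (intro selfadjoint_op_intros Asa K)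
  note Qb = sa_bounded[OF Q]
  define V where "V = {x. Q x = 0}"
  have Vs: "complex_vector.subspace V"
    unfolding complex_vector.subspace_def V_def by (auto simp: clin_simps[OF Qb])
  have Vc: "closed V"
    unfolding V_def
    using bounded_linear.continuous_on[OF bounded_clinear_imp_bounded_linear[OF Qb], of UNIV id]
    by (intro closed_Collect_eq) (auto intro: continuous_on_const simp: continuous_on_id)
  obtain E where E: "selfadjoint_op E" "E \<circ> E = E"
    and fixE: "\<And>x. E x = x \<longleftrightarrow> x \<in> V" and kerE: "\<And>x. E x = 0 \<longleftrightarrow> (\<forall>v\<in>V. inner x v = 0)"
    by (rule orthogonal_projection_exists[OF Vs Vc]) (rule that)
  note Eb = sa_bounded[OF E(1)]
  have EE: "E (E x) = E x" for x using fun_cong[OF E(2), of x] by simp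
  have Kzero: "A x = 0" if "K x = 0" for x
  proof -
    have "inner (A x) (A x) = inner (K (K x)) x" using sa_inner[OF Asa, of "A x" x] by (simp add: AA)
    then show ?thesis using that clin_zero[OF Kb] by simp
  qed
  have neg: "inner (K x) x \<le> 0" if "E x = x" for x
  proof -
    have "A x + K x = 0" using that fixE by (simp add: V_def Q_def)
    then have "inner (A x) x + inner (K x) x = 0" by (metis inner_add_left inner_zero_left)
    moreover have "0 \<le> inner (A x) x" using A by (simp add: nonneg_op_iff)
    ultimately show ?thesis by simp
  qed
  have pos: "0 < inner (K x) x" if "E x = 0" "x \<noteq> 0" for x
  proof -
    \<comment> \<open>\<open>A - K\<close> maps into the kernel of \<open>A + K\<close>, since
      \<open>A\<close> and \<open>K\<close> commute and have equal squares. As \<open>x\<close> is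
      orthogonal to that kernel, \<open>w = (A - K) x\<close> is zero.\<close>
    define w where "w = A x - K x"
    have inV: "A z - K z \<in> V" for z
      by (simp add: V_def Q_def AA AK clin_simps[OF Ab] clin_simps[OF Kb])
    have "inner w w = inner x (A w - K w)"
      using sa_inner[OF Asa, of x w] sa_inner[OF K, of x w]
      by (simp add: w_def inner_diff inner_commute)
    also have "\<dots> = 0" using inV kerE that by blast
    finally have "A x = K x" by (simp add: w_def)
    moreover have "0 \<le> inner (A x) x" using A by (simp add: nonneg_op_iff)
    moreover have "inner (K x) x \<noteq> 0"
    proof
      assume "inner (K x) x = 0"
      then have "A x = 0" using nonneg_op_eq_zero[OF A, of x] \<open>A x = K x\<close> by simp
      then have "x \<in> V" using \<open>A x = K x\<close> by (simp add: V_def Q_def)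
      then show False using fixE[of x] that by simp
    qed
    ultimately show ?thesis by simp
  qed
  \<comment> \<open>\<open>T\<close> also commutes with \<open>A\<close>, so it preserves the kernel
    \<open>V\<close> of \<open>Q\<close>; being selfadjoint it preserves the orthogonal complement
    as well, and therefore commutes with the projection onto \<open>V\<close>.\<close>
  have comm: "T (E x) = E (T x)" if T: "selfadjoint_op T" and TK: "\<And>x. T (K x) = K (T x)" for T x
  proof -
    note Tb = sa_bounded[OF T]
    have TQ: "T (Q y) = Q (T y)" for y
      unfolding Q_def using Ac[OF Tb, of y] by (simp add: TK clin_simps[OF Tb])
    have TV: "T v \<in> V" if "v \<in> V" for v
      using that TQ[of v] by (simp add: V_def clin_simps[OF Tb])
    have 1: "E (T (E x)) = T (E x)" using TV[of "E x"] fixE EE by blast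
    have "E (T (x - E x)) = 0"
    proof -
      have "E (x - E x) = 0" by (simp add: clin_simps[OF Eb] EE)
      then have "\<forall>v\<in>V. inner (x - E x) (T v) = 0" using kerE TV by blast
      then show ?thesis unfolding kerE by (simp add: sa_inner[OF T])
    qed
    then show ?thesis using 1 by (simp add: clin_simps[OF Tb] clin_simps[OF Eb])
  qed
  show ?thesis by (intro exI[of _ E] conjI allI impI) (simp_all add: E(1) EE neg pos comm)
qed

lemma cinner_selfadjoint:
  assumes "selfadjoint_op H"
  shows "cinner (H x) x = complex_of_real (inner (H x) x)"
proof -
  have "inner (H x) (\<i> *\<^sub>C x) = inner x (\<i> *\<^sub>C H x)"
    by (simp add: sa_inner[OF assms] clin_scaleC[OF sa_bounded[OF assms]])
  also have "\<dots> = - inner (H x) (\<i> *\<^sub>C x)"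
    using inner_scaleC_i[of x "H x"] by (simp add: inner_commute)
  finally show ?thesis by (simp add: cinner_eq_inner complex_eq_iff)
qed

section \<open>Spectral families and their Stieltjes measures\<close>

lemma
  assumes "spectral_family E"
  shows sf_selfadjoint: "selfadjoint_op (E t)"
    and sf_idem: "E t (E t x) = E t x"
    and sf_absorb_left: "s \<le> t \<Longrightarrow> E s (E t x) = E s x"
    and sf_absorb_right: "s \<le> t \<Longrightarrow> E t (E s x) = E s x"
    and sf_at_right: "((\<lambda>s. E s x) \<longlongrightarrow> E t x) (at_right t)"
    and sf_at_bot: "((\<lambda>t. E t x) \<longlongrightarrow> 0) at_bot"
    and sf_at_top: "((\<lambda>t. E t x) \<longlongrightarrow> x) at_top"
proof -
  note a = assms[unfolded spectral_family_def]
  show "selfadjoint_op (E t)" "((\<lambda>s. E s x) \<longlongrightarrow> E t x) (at_right t)"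
    "((\<lambda>t. E t x) \<longlongrightarrow> 0) at_bot" "((\<lambda>t. E t x) \<longlongrightarrow> x) at_top"
    using a by simp_all
  have "(E t \<circ> E t) x = E t x" using a by simp
  then show "E t (E t x) = E t x" by simp
  assume "s \<le> t"
  then have "E s \<circ> E t = E s" "E t \<circ> E s = E s" using a by simp_all
  then have "(E s \<circ> E t) x = E s x" "(E t \<circ> E s) x = E s x" by simp_all
  then show "E s (E t x) = E s x" "E t (E s x) = E s x" by simp_all
qed

lemma inner_projection:
  assumes "selfadjoint_op P" and "\<And>x. P (P x) = P x"
  shows "inner (P x) x = (norm (P x))\<^sup>2"
  using sa_inner[OF assms(1), of "P x" x] by (simp add: assms(2) power2_norm_eq_inner)

lemma norm_projection_diff:
  assumes "selfadjoint_op P" and "\<And>x. P (P x) = P x"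
    and "selfadjoint_op Q" and "\<And>x. Q (Q x) = Q x" and "\<And>x. Q (P x) = P x"
  shows "(norm (Q x - P x))\<^sup>2 = inner (Q x) x - inner (P x) x"
proof -
  have "inner (Q x) (P x) = inner (P x) x"
    using sa_inner[OF assms(3), of x "P x"] by (simp add: assms(5) inner_commute)
  then have "(norm (Q x - P x))\<^sup>2 = (norm (Q x))\<^sup>2 - 2 * inner (P x) x + (norm (P x))\<^sup>2"
    unfolding power2_norm_eq_inner by (simp add: inner_diff inner_commute)
  then show ?thesis
    by (simp add: inner_projection[OF assms(1,2)] inner_projection[OF assms(3,4)])
qed

text \<open>For a monotone sequence of projections, \<open>norm_projection_diff\<close> puts the
  vectors \<open>z n\<close> and the scalar forms \<open>f n\<close> into this relation, so bounded
  monotone scalars yield strong limits. Used for right limits at every point and for the left limit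
  at 0.\<close>

lemma convergent_if_norm_diff_squared:
  fixes z :: "nat \<Rightarrow> 'a :: {real_inner, complete_space}"
  assumes "convergent f" and "\<And>m n. m \<le> n \<Longrightarrow> (norm (z m - z n))\<^sup>2 = \<bar>f m - f n\<bar>"
  shows "convergent z"
proof -
  have eq: "(norm (z m - z n))\<^sup>2 = \<bar>f m - f n\<bar>" for m n :: nat
    using assms(2)[of m n] assms(2)[of n m] by (cases "m \<le> n") (auto simp: norm_minus_commute)
  have "Cauchy z"
  proof (rule metric_CauchyI)
    fix e :: real assume e: "0 < e"
    obtain M where M: "\<And>m n. m \<ge> M \<Longrightarrow> n \<ge> M \<Longrightarrow> norm (f m - f n) < e\<^sup>2"
      using CauchyD[OF convergent_Cauchy[OF assms(1)], of "e\<^sup>2"] e by auto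
    have "norm (z m - z n) < e" if "m \<ge> M" "n \<ge> M" for m n
    proof (rule power2_less_imp_less)
      show "(norm (z m - z n))\<^sup>2 < e\<^sup>2" using M[OF that] by (simp add: eq)
    qed (use e in simp)
    then show "\<exists>M. \<forall>m\<ge>M. \<forall>n\<ge>M. dist (z m) (z n) < e" by (auto simp: dist_norm)
  qed
  then show ?thesis by (simp add: Cauchy_convergent_iff)
qed

context
  fixes E :: "real \<Rightarrow> 'a :: chilbert_space \<Rightarrow> 'a"
  assumes E: "spectral_family E"
begin

lemma sf_norm_diff:
  assumes "s \<le> t"
  shows "(norm (E t x - E s x))\<^sup>2 = inner (E t x) x - inner (E s x) x"
  by (rule norm_projection_diff)
    (simp_all add: sf_selfadjoint[OF E] sf_idem[OF E] sf_absorb_right[OF E assms])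

lemma sf_mono:
  assumes "s \<le> t"
  shows "inner (E s x) x \<le> inner (E t x) x"
  using sf_norm_diff[OF assms, of x] zero_le_power2[of "norm (E t x - E s x)"] by linarith

lemma sf_right_continuous: "continuous (at_right t) (\<lambda>s. inner (E s x) x)"
  unfolding continuous_within by (intro tendsto_inner tendsto_const sf_at_right[OF E])

lemma sf_inner_at_bot: "((\<lambda>s. inner (E s x) x) \<longlongrightarrow> 0) at_bot"
  using tendsto_inner[OF sf_at_bot[OF E] tendsto_const, of x x] by simp

lemma sf_inner_at_top: "((\<lambda>s. inner (E s x) x) \<longlongrightarrow> (norm x)\<^sup>2) at_top"
  using tendsto_inner[OF sf_at_top[OF E] tendsto_const, of x x] by (simp add: power2_norm_eq_inner)

lemma
  shows emeasure_spectral_UNIV: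
      "emeasure (interval_measure (\<lambda>t. inner (E t x) x)) UNIV = ennreal ((norm x)\<^sup>2)"
    and emeasure_spectral_Ioc: "s \<le> t \<Longrightarrow>
      emeasure (interval_measure (\<lambda>t. inner (E t x) x)) {s<..t}
        = ennreal (inner (E t x) x - inner (E s x) x)"
    and emeasure_spectral_Iic:
      "emeasure (interval_measure (\<lambda>t. inner (E t x) x)) {..t} = ennreal (inner (E t x) x)"
    and finite_spectral_measure: "finite_measure (interval_measure (\<lambda>t. inner (E t x) x))"
proof -
  let ?M = "interval_measure (\<lambda>t. inner (E t x) x)"
  show U: "emeasure ?M UNIV = ennreal ((norm x)\<^sup>2)"
    by (rule interval_measure_UNIV)
      (simp_all add: sf_mono sf_right_continuous sf_inner_at_bot sf_inner_at_top)
  show "emeasure ?M {s<..t} = ennreal (inner (E t x) x - inner (E s x) x)" if "s \<le> t"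
    by (rule emeasure_interval_measure_Ioc[OF that sf_mono sf_right_continuous])
  show "emeasure ?M {..t} = ennreal (inner (E t x) x)"
    by (rule emeasure_interval_measure_Iic[OF sf_mono sf_right_continuous sf_inner_at_bot])
  show "finite_measure ?M" by (rule finite_measureI) (simp add: U)
qed

end

text \<open>\<open>G\<close> stands for an indefinite integral of \<open>t dF\<close>. Over a cell
  from \<open>s\<close> to \<open>t\<close> both the integral and the increment of \<open>G\<close>
  lie between \<open>s\<close> and \<open>t\<close> times the increment of \<open>F\<close>. Summed
  over \<open>Suc n\<close> equal cells, the error is at most the mesh times the total increment of
  \<open>F\<close>, which tends to zero.\<close>

lemma integral_id_interval_measure:
  fixes F G :: "real \<Rightarrow> real"
  assumes mono: "\<And>s t. s \<le> t \<Longrightarrow> F s \<le> F t" and rc: "\<And>t. continuous (at_right t) F"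
    and ab: "a < b"
    and lower: "\<And>s t. s \<le> t \<Longrightarrow> s * (F t - F s) \<le> G t - G s"
    and upper: "\<And>s t. s \<le> t \<Longrightarrow> G t - G s \<le> t * (F t - F s)"
  shows "integral\<^sup>L (interval_measure F) (\<lambda>u. indicator {a<..b} u * u) = G b - G a"
proof -
  define M where "M = interval_measure F"
  have emM: "emeasure M {s<..t} = ennreal (F t - F s)" if "s \<le> t" for s t
    unfolding M_def by (rule emeasure_interval_measure_Ioc[OF that mono rc])
  have sets: "{s<..t} \<in> sets M" for s t by (simp add: M_def)
  have meas: "(\<lambda>u. indicator {s<..t} u * u) \<in> borel_measurable M" for s t :: real
    by (simp add: M_def)
  have intc: "integrable M (\<lambda>u. indicator {s<..t} u * c)" if "s \<le> t" for s t c :: real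
    using that by (intro integrable_mult_left integrable_real_indicator) (simp_all add: sets emM)
  have intu: "integrable M (\<lambda>u. indicator {s<..t} u * u)" if "s \<le> t" for s t :: real
    by (rule Bochner_Integration.integrable_bound[OF intc[OF that, of "max \<bar>s\<bar> \<bar>t\<bar>"] meas])
      (auto simp: indicator_def)
  define W where "W s t = integral\<^sup>L M (\<lambda>u. indicator {s<..t} u * u)" for s t
  have c: "integral\<^sup>L M (\<lambda>u. indicator {s<..t} u * c) = c * (F t - F s)" if "s \<le> t" for s t c
    using emM[OF that] mono[OF that] by (simp add: measure_def M_def)
  have Wl: "s * (F t - F s) \<le> W s t" if "s \<le> t" for s t
    unfolding c[OF that, symmetric] W_def
    by (rule integral_mono[OF intc[OF that] intu[OF that]]) (auto simp: indicator_def)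
  have Wu: "W s t \<le> t * (F t - F s)" if "s \<le> t" for s t
    unfolding c[OF that, symmetric] W_def
    by (rule integral_mono[OF intu[OF that] intc[OF that]]) (auto simp: indicator_def)
  have Wadd: "W r t = W r s + W s t" if "r \<le> s" "s \<le> t" for r s t
  proof -
    have "W r t = integral\<^sup>L M (\<lambda>u. indicator {r<..s} u * u + indicator {s<..t} u * u)"
      unfolding W_def using that by (intro Bochner_Integration.integral_cong) (auto simp: indicator_def)
    then show ?thesis
      unfolding W_def by (simp add: Bochner_Integration.integral_add intu that)
  qed
  have step: "\<bar>W s t - (G t - G s)\<bar> \<le> (t - s) * (F t - F s)" if "s \<le> t" for s t
    using Wl[OF that] Wu[OF that] lower[OF that] upper[OF that] by (simp add: left_diff_distrib)
  have part: "\<bar>W a (a + real n * h) - (G (a + real n * h) - G a)\<bar> \<le> h * (F (a + real n * h) - F a)"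
    if "0 \<le> h" for h n
  proof (induction n)
    case 0
    then show ?case using Wl[of a a] Wu[of a a] by simp
  next
    case (Suc n)
    define p q where "p = a + real n * h" and "q = a + real (Suc n) * h"
    have p: "a \<le> p" "p \<le> q" "q - p = h" using that by (simp_all add: p_def q_def algebra_simps)
    have "\<bar>W a q - (G q - G a)\<bar> \<le> \<bar>W a p - (G p - G a)\<bar> + \<bar>W p q - (G q - G p)\<bar>"
      using Wadd[OF p(1,2)] by linarith
    also have "\<dots> \<le> h * (F p - F a) + h * (F q - F p)"
      using Suc.IH step[OF p(2)] unfolding p(3) p_def[symmetric] by linarith
    finally show ?case unfolding q_def[symmetric] by (simp add: algebra_simps)
  qed
  have "\<bar>W a b - (G b - G a)\<bar> \<le> 0"
  proof (rule LIMSEQ_le_const)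
    have "(\<lambda>n. (b - a) * (F b - F a) * inverse (real (Suc n))) \<longlonglongrightarrow> (b - a) * (F b - F a) * 0"
      by (intro tendsto_mult tendsto_const LIMSEQ_inverse_real_of_nat)
    then show "(\<lambda>n. (b - a) * (F b - F a) * inverse (real (Suc n))) \<longlonglongrightarrow> 0" by simp
    have "\<bar>W a b - (G b - G a)\<bar> \<le> (b - a) * (F b - F a) * inverse (real (Suc n))" for n
      using part[of "(b - a) / real (Suc n)" "Suc n"] ab by (simp add: divide_inverse mult_ac)
    then show "\<exists>N. \<forall>n\<ge>N. \<bar>W a b - (G b - G a)\<bar> \<le> (b - a) * (F b - F a) * inverse (real (Suc n))"
      by blast
  qed
  then show ?thesis by (simp add: W_def M_def)
qed

text \<open>\<open>E t\<close> is the projection of \<open>nonpositive_projection_exists\<close> for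
  \<open>H - t\<close>. Order, bounded support and right continuity all come from one clash: the
  form of \<open>H - t\<close> is nonpositive on the range and strictly positive on nonzero vectors
  of the kernel.\<close>

theorem spectral_theorem:
  assumes H: "selfadjoint_op H"
  shows "\<exists>E. spectral_family E \<and> has_spectral_integral (\<lambda>t. t) E H"
proof -
  note Hb = sa_bounded[OF H]
  define K where "K t x = H x - t *\<^sub>R x" for t x
  have K: "selfadjoint_op (K t)" for t
    unfolding K_def by (rule selfadjoint_op_diff[OF H selfadjoint_op_scaleR[OF selfadjoint_op_id]])
  have "\<forall>t. \<exists>E. selfadjoint_op E \<and> (\<forall>x. E (E x) = E x) \<and>
     (\<forall>x. E x = x \<longrightarrow> inner (K t x) x \<le> 0) \<and>
     (\<forall>x. E x = 0 \<longrightarrow> x \<noteq> 0 \<longrightarrow> 0 < inner (K t x) x) \<and>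
     (\<forall>T. selfadjoint_op T \<longrightarrow> (\<forall>x. T (K t x) = K t (T x)) \<longrightarrow> (\<forall>x. T (E x) = E (T x)))"
    using nonpositive_projection_exists[OF K] by blast
  from choice[OF this] obtain E where E0: "\<forall>t. selfadjoint_op (E t) \<and> (\<forall>x. E t (E t x) = E t x) \<and>
     (\<forall>x. E t x = x \<longrightarrow> inner (K t x) x \<le> 0) \<and>
     (\<forall>x. E t x = 0 \<longrightarrow> x \<noteq> 0 \<longrightarrow> 0 < inner (K t x) x) \<and>
     (\<forall>T. selfadjoint_op T \<longrightarrow> (\<forall>x. T (K t x) = K t (T x)) \<longrightarrow> (\<forall>x. T (E t x) = E t (T x)))"
    by (elim exE)
  have Esa: "selfadjoint_op (E t)" and EE: "E t (E t x) = E t x" for t x using E0 by simp_all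
  note Eb = sa_bounded[OF Esa]
  have neg: "inner (H x) x \<le> t * (norm x)\<^sup>2" if "E t x = x" for t x
    using E0 that by (simp add: K_def inner_diff_left power2_norm_eq_inner)
  have pos: "t * (norm x)\<^sup>2 < inner (H x) x" if "E t x = 0" "x \<noteq> 0" for t x
    using E0 that by (simp add: K_def inner_diff_left power2_norm_eq_inner)
  have comm: "T (E t x) = E t (T x)" if T: "selfadjoint_op T" and "\<And>x. T (H x) = H (T x)" for T t x
  proof -
    have "\<forall>x. T (K t x) = K t (T x)" by (simp add: K_def clin_simps[OF sa_bounded[OF T]] that(2))
    then show ?thesis using E0 T by blast
  qed
  have HE: "H (E t x) = E t (H x)" for t x by (rule comm[OF H refl])
  \<comment> \<open>The commutation clause is applied twice: \<open>H\<close> commutes with every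
    \<open>E t\<close>, hence so does every \<open>E s\<close>.\<close>
  have EEc: "E s (E t x) = E t (E s x)" for s t x by (rule comm[OF Esa]) (simp add: HE)
  have absorb: "E t (E s x) = E s x" if "s \<le> t" for s t x
  proof -
    \<comment> \<open>\<open>y\<close> lies in the range of \<open>E s\<close> and the kernel of
      \<open>E t\<close>; were it nonzero, its form would exceed \<open>t\<close> and not exceed
      \<open>s\<close> times its squared norm.\<close>
    define y where "y = E s x - E t (E s x)"
    have y: "E t y = 0" "E s y = y"
      by (simp_all add: y_def clin_simps[OF Eb] EE EEc[of s t])
    have "s * (norm y)\<^sup>2 \<le> t * (norm y)\<^sup>2" using that by (intro mult_right_mono) simp_all
    then have "y = 0" using pos[OF y(1)] neg[OF y(2)] by fastforce
    then show ?thesis by (simp add: y_def)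
  qed
  obtain c0 where c0: "0 \<le> c0" "\<And>x. norm (H x) \<le> c0 * norm x" using clin_bound[OF Hb] by blast
  have c: "\<bar>inner (H x) x\<bar> \<le> c0 * (norm x)\<^sup>2" for x
    using Cauchy_Schwarz_ineq2[of "H x" x] mult_right_mono[OF c0(2)[of x] norm_ge_zero[of x]]
    by (simp add: power2_eq_square mult.assoc)
  have low: "E t x = 0" if "t < - c0" for t x
  proof (rule ccontr)
    assume "E t x \<noteq> 0"
    then have "t * (norm (E t x))\<^sup>2 < - c0 * (norm (E t x))\<^sup>2"
      using that by (intro mult_strict_right_mono) simp_all
    then show False using neg[OF EE, of t x] c[of "E t x"] by linarith
  qed
  have high: "E t x = x" if "c0 < t" for t x
  proof (rule ccontr)
    define y where "y = x - E t x"
    assume "E t x \<noteq> x"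
    then have y: "y \<noteq> 0" by (simp add: y_def)
    then have "c0 * (norm y)\<^sup>2 < t * (norm y)\<^sup>2"
      using that by (intro mult_strict_right_mono) simp_all
    moreover have "E t y = 0" by (simp add: y_def clin_simps[OF Eb] EE)
    ultimately show False using pos[of t y, OF _ y] c[of y] by linarith
  qed
  have diff2: "(norm (E t x - E s x))\<^sup>2 = inner (E t x) x - inner (E s x) x" if "s \<le> t" for s t x
    by (rule norm_projection_diff) (simp_all add: Esa EE absorb[OF that])
  have Fmono: "inner (E s x) x \<le> inner (E t x) x" if "s \<le> t" for s t x
    using diff2[OF that, of x] zero_le_power2[of "norm (E t x - E s x)"] by linarith
  have Fnn: "0 \<le> inner (E t x) x" for t x using inner_projection[OF Esa EE, of t x] by simp
  have right: "((\<lambda>s. E s x) \<longlongrightarrow> E t x) (at_right t)" for t x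
  proof -
    define z where "z n = E (t + inverse (real (Suc n))) x" for n
    have ord: "t + inverse (real (Suc n)) \<le> t + inverse (real (Suc m))" if "m \<le> n" for m n
      using that by (simp add: le_imp_inverse_le)
    have zlim: "(\<lambda>n. t + inverse (real (Suc n))) \<longlonglongrightarrow> t"
      using tendsto_add[OF tendsto_const LIMSEQ_inverse_real_of_nat, of t] by simp
    define f where "f n = inner (z n) x" for n
    have fdec: "f n \<le> f m" if "m \<le> n" for m n
      using Fmono[OF ord[OF that]] by (simp add: f_def z_def)
    have "convergent f"
    proof (rule Bseq_monoseq_convergent)
      show "monoseq f" using fdec by (auto simp: monoseq_def)
      have "norm (f n) \<le> f 0" for n using fdec[of 0 n] Fnn by (simp add: f_def z_def)
      then show "Bseq f" by (rule BseqI'[where K = "f 0"])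
    qed
    moreover have "(norm (z m - z n))\<^sup>2 = \<bar>f m - f n\<bar>" if "m \<le> n" for m n
      using diff2[OF ord[OF that], of x] fdec[OF that] by (simp add: z_def f_def)
    ultimately have "convergent z" by (rule convergent_if_norm_diff_squared)
    then obtain q where q: "z \<longlonglongrightarrow> q" by (auto simp: convergent_def)
    \<comment> \<open>The defect of right continuity. It is killed by \<open>E t\<close> but fixed
      by \<open>E s\<close> for every \<open>s > t\<close>, so its form is at most \<open>t\<close>
      times its squared norm, which the strict inequality on the kernel of \<open>E t\<close> allows
      only for \<open>y = 0\<close>.\<close>
    define y where "y = q - E t x"
    have "E t q = E t x"
    proof (rule LIMSEQ_unique[OF clin_tendsto[OF Eb q]])
      have "E t (z n) = E t x" for n
        using EEc[of t _ x] absorb[of t _ x] by (simp add: z_def)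
      then show "(\<lambda>n. E t (z n)) \<longlonglongrightarrow> E t x" by simp
    qed
    then have Ety: "E t y = 0" by (simp add: y_def clin_simps[OF Eb] EE)
    have "E s y = y" if "t < s" for s
    proof -
      have "E s q = q"
      proof (rule LIMSEQ_unique[OF clin_tendsto[OF Eb q]])
        have "\<forall>\<^sub>F n in sequentially. t + inverse (real (Suc n)) < s"
          using order_tendstoD(2)[OF zlim that] .
        then have "\<forall>\<^sub>F n in sequentially. z n = E s (z n)"
          by eventually_elim (simp add: z_def absorb)
        then show "(\<lambda>n. E s (z n)) \<longlonglongrightarrow> q"
          using q by (simp add: tendsto_cong)
      qed
      then show ?thesis using that by (simp add: y_def clin_simps[OF Eb] absorb)
    qed
    then have "inner (H y) y \<le> s * (norm y)\<^sup>2" if "t < s" for s using neg that by blast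
    then have "inner (H y) y \<le> (t + inverse (real (Suc n))) * (norm y)\<^sup>2" for n by simp
    moreover have "(\<lambda>n. (t + inverse (real (Suc n))) * (norm y)\<^sup>2) \<longlonglongrightarrow> t * (norm y)\<^sup>2"
      by (intro tendsto_mult zlim tendsto_const)
    ultimately have "inner (H y) y \<le> t * (norm y)\<^sup>2"
      by (intro LIMSEQ_le_const[of "\<lambda>n. (t + inverse (real (Suc n))) * (norm y)\<^sup>2"]) blast+
    then have "y = 0" using pos[OF Ety] by fastforce
    then have q': "z \<longlonglongrightarrow> E t x" using q by (simp add: y_def)
    show ?thesis
    proof (rule tendstoI)
      fix e :: real assume "0 < e"
      then have "\<forall>\<^sub>F n in sequentially. dist (z n) (E t x) < e" using q' tendstoD by blast
      then obtain n where n: "dist (z n) (E t x) < e" by (auto simp: eventually_sequentially)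
      define r where "r = t + inverse (real (Suc n))"
      have "dist (E s x) (E t x) < e" if "t < s" "s < r" for s
      proof -
        have "(norm (E s x - E t x))\<^sup>2 \<le> (norm (E r x - E t x))\<^sup>2"
          using that Fmono[of s r x] diff2[of t s x] diff2[of t r x] by simp
        then have "norm (E s x - E t x) \<le> norm (E r x - E t x)" by (rule power2_le_imp_le) simp
        then show ?thesis using n by (simp add: dist_norm z_def r_def)
      qed
      moreover have "t < r" by (simp add: r_def)
      ultimately show "\<forall>\<^sub>F s in at_right t. dist (E s x) (E t x) < e"
        by (auto simp: eventually_at_right[of t r])
    qed
  qed
  have sf: "spectral_family E"
    unfolding spectral_family_def
  proof (intro conjI allI impI)
    show "selfadjoint_op (E t)" "E t \<circ> E t = E t" for t using Esa EE by (auto simp: fun_eq_iff)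
    show "E s \<circ> E t = E s" "E t \<circ> E s = E s" if "s \<le> t" for s t
      using absorb[OF that] EEc by (auto simp: fun_eq_iff)
    show "((\<lambda>s. E s x) \<longlongrightarrow> E t x) (at_right t)" for t x by (rule right)
    show "((\<lambda>t. E t x) \<longlongrightarrow> 0) at_bot" for x
      by (rule tendsto_eventually) (use low in \<open>auto simp: eventually_at_bot_dense\<close>)
    show "((\<lambda>t. E t x) \<longlongrightarrow> x) at_top" for x
      by (rule tendsto_eventually) (use high in \<open>auto simp: eventually_at_top_dense\<close>)
  qed
  have "has_spectral_integral (\<lambda>t. t) E H"
    unfolding has_spectral_integral_def Let_def inner_eq_Re_cinner[symmetric]
  proof (intro conjI allI Hb)
    fix x
    define F where "F t = inner (E t x) x" for t
    define G where "G t = inner (H (E t x)) (E t x)" for t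
    define M where "M = interval_measure F"
    \<comment> \<open>The margin 1 puts both endpoints strictly outside the bound \<open>c0\<close>,
      where \<open>E\<close> is already 0 or the identity.\<close>
    define a b where "a = - c0 - 1" and "b = c0 + 1"
    \<comment> \<open>Since \<open>H\<close> commutes with \<open>E s\<close>, the mixed terms
      between \<open>E s x\<close> and \<open>y\<close> vanish and the increment of \<open>G\<close>
      is the form of \<open>H\<close> at \<open>y\<close>. There \<open>y\<close> is in the range of
      \<open>E t\<close> and the kernel of \<open>E s\<close>, which gives the two bounds.\<close>
    have bounds: "s * (F t - F s) \<le> G t - G s \<and> G t - G s \<le> t * (F t - F s)" if "s \<le> t" for s t
    proof -
      define y where "y = E t x - E s x"
      have y2: "(norm y)\<^sup>2 = F t - F s" using diff2[OF that, of x] by (simp add: y_def F_def)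
      have Ey: "E t y = y" "E s y = 0"
        using absorb[OF that] EEc[of s t x] by (simp_all add: y_def clin_simps[OF Eb] EE)
      have "inner (H (E s x)) y = inner (E s (H (E s x))) y" by (simp add: HE EE)
      also have "\<dots> = 0" using sa_inner[OF Esa, of s "H (E s x)" y] by (simp add: Ey)
      finally have 1: "inner (H (E s x)) y = 0" .
      then have 2: "inner (H y) (E s x) = 0"
        using sa_inner[OF H, of y "E s x"] by (simp add: inner_commute)
      have "E t x = E s x + y" by (simp add: y_def)
      then have "G t = inner (H (E s x + y)) (E s x + y)" by (simp add: G_def)
      then have "G t - G s = inner (H y) y"
        by (simp add: clin_simps[OF Hb] inner_add 1 2 G_def)
      moreover have "inner (H y) y \<le> t * (norm y)\<^sup>2" using neg Ey(1) by blast
      moreover have "s * (norm y)\<^sup>2 \<le> inner (H y) y"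
        using pos[OF Ey(2)] by (cases "y = 0") (auto simp: less_imp_le)
      ultimately show ?thesis by (simp add: y2)
    qed
    interpret finite_measure M
      using finite_spectral_measure[OF sf, of x] by (simp add: M_def F_def[abs_def])
    have ab: "a < b" "a \<le> b" using c0(1) by (simp_all add: a_def b_def)
    have Fab: "F a = 0" "F b = (norm x)\<^sup>2" "G a = 0" "G b = inner (H x) x"
      using low[of a x] high[of b x]
      by (simp_all add: a_def b_def F_def G_def power2_norm_eq_inner)
    have "emeasure M {a<..b} = emeasure M (space M)"
      using emeasure_spectral_Ioc[OF sf ab(2), of x] emeasure_spectral_UNIV[OF sf, of x] Fab
      by (simp add: M_def F_def[abs_def])
    moreover have "{a<..b} \<in> sets M" by (simp add: M_def)
    ultimately have "emeasure M (space M - {a<..b}) = 0"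
      by (simp add: emeasure_compl emeasure_finite)
    then have ae: "AE u in M. u \<in> {a<..b}"
      using \<open>{a<..b} \<in> sets M\<close> by (intro AE_I[of _ _ "space M - {a<..b}"]) auto
    have "integrable M (\<lambda>u. u)"
      by (rule integrable_const_bound[of _ "max \<bar>a\<bar> \<bar>b\<bar>"], use ae in eventually_elim)
        (auto simp: M_def)
    then show "integrable (interval_measure (\<lambda>t. inner (E t x) x)) (\<lambda>t. t)"
      by (simp add: M_def F_def[abs_def])
    have "integral\<^sup>L M (\<lambda>u. u) = integral\<^sup>L M (\<lambda>u. indicator {a<..b} u * u)"
    proof (rule integral_cong_AE)
      show "AE u in M. u = indicator {a<..b} u * u" using ae by eventually_elim simp
    qed (simp_all add: M_def)
    also have "\<dots> = G b - G a"
      unfolding M_def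
    proof (rule integral_id_interval_measure)
      show "F s \<le> F t" if "s \<le> t" for s t using Fmono[OF that] by (simp add: F_def)
      show "continuous (at_right t) F" for t
        using sf_right_continuous[OF sf] by (simp add: F_def[abs_def])
    qed (use ab bounds in auto)
    finally show "cinner (H x) x
        = complex_of_real (integral\<^sup>L (interval_measure (\<lambda>t. inner (E t x) x)) (\<lambda>t. t))"
      by (simp add: Fab M_def F_def[abs_def] cinner_selfadjoint[OF H])
  qed
  with sf show ?thesis by blast
qed

section \<open>The negative spectral projection\<close>

lemma spectral_left_limit_exists:
  assumes E: "spectral_family E"
  shows "\<exists>P. selfadjoint_op P \<and> (\<forall>x. P (P x) = P x) \<and>
    (\<forall>t x. t < 0 \<longrightarrow> E t (P x) = E t x) \<and> (\<forall>t x. 0 \<le> t \<longrightarrow> E t (P x) = P x) \<and>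
    (\<forall>x. emeasure (interval_measure (\<lambda>t. inner (E t x) x)) {..<0} = ennreal (inner (P x) x))"
proof -
  note Esa = sf_selfadjoint[OF E]
  note Eb = sa_bounded[OF Esa]
  \<comment> \<open>\<open>P\<close> is the strong left limit of \<open>E\<close> at 0, taken along
    \<open>s\<close>. The value \<open>E 0\<close> would also count the mass at the point 0, which
    does not belong to \<open>{..<0}\<close>.\<close>
  define s where "s n = - inverse (real (Suc n))" for n
  have s0: "s n < 0" for n by (simp add: s_def)
  have smono: "s m \<le> s n" if "m \<le> n" for m n
    using that by (simp add: s_def le_imp_inverse_le)
  have slim: "s \<longlonglongrightarrow> 0"
    unfolding s_def[abs_def] using tendsto_minus[OF LIMSEQ_inverse_real_of_nat] by simp
  have Ele: "norm (E t x) \<le> norm x" for t x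
  proof -
    have "(norm (E t x))\<^sup>2 = inner (E t x) x" using inner_projection[OF Esa sf_idem[OF E]] by simp
    also have "\<dots> \<le> norm (E t x) * norm x" by (rule norm_cauchy_schwarz)
    finally show ?thesis by (cases "E t x = 0") (auto simp: power2_eq_square)
  qed
  have "convergent (\<lambda>n. E (s n) x)" for x
  proof (rule convergent_if_norm_diff_squared)
    define f where "f n = inner (E (s n) x) x" for n
    have finc: "f m \<le> f n" if "m \<le> n" for m n
      using sf_mono[OF E smono[OF that]] by (simp add: f_def)
    show "convergent f"
    proof (rule Bseq_monoseq_convergent)
      show "monoseq f" using finc by (auto simp: monoseq_def)
      have "norm (f n) \<le> norm x * norm x" for n
        using Cauchy_Schwarz_ineq2[of "E (s n) x" x] mult_right_mono[OF Ele[of "s n" x] norm_ge_zero[of x]]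
        by (simp add: f_def)
      then show "Bseq f" by (rule BseqI'[where K = "norm x * norm x"])
    qed
    show "(norm (E (s m) x - E (s n) x))\<^sup>2 = \<bar>f m - f n\<bar>" if "m \<le> n" for m n
      using sf_norm_diff[OF E smono[OF that], of x] finc[OF that]
      by (simp add: f_def norm_minus_commute)
  qed
  then obtain P where P: "\<And>x. (\<lambda>n. E (s n) x) \<longlonglongrightarrow> P x" unfolding convergent_def by metis
  have Pb: "bounded_clinear P"
  proof (rule bounded_clinearI)
    show "P (x + y) = P x + P y" for x y
      by (rule LIMSEQ_unique[OF P]) (simp add: clin_simps[OF Eb] tendsto_add P)
    show "P (c *\<^sub>C x) = c *\<^sub>C P x" for c x
    proof (rule LIMSEQ_unique[OF P])
      from clin_tendsto[OF bounded_clinear_scaleC P, of c]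
      show "(\<lambda>n. E (s n) (c *\<^sub>C x)) \<longlonglongrightarrow> c *\<^sub>C P x" by (simp add: clin_simps[OF Eb])
    qed
    have "norm (P x) \<le> norm x" for x
      by (rule LIMSEQ_le_const2[OF tendsto_norm[OF P]]) (auto intro: Ele)
    then show "norm (P x) \<le> 1 * norm x" for x by simp
  qed
  have Psa: "selfadjoint_op P"
  proof (rule selfadjoint_opI[OF Pb])
    show "inner (P x) y = inner x (P y)" for x y
      by (rule LIMSEQ_unique[OF tendsto_inner[OF P tendsto_const]])
        (simp add: sa_inner[OF Esa] tendsto_inner P)
  qed
  have neg: "E t (P x) = E t x" if "t < 0" for t x
  proof (rule LIMSEQ_unique[OF clin_tendsto[OF Eb P]])
    have "\<forall>\<^sub>F n in sequentially. t < s n" using order_tendstoD(1)[OF slim that] .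
    then have "\<forall>\<^sub>F n in sequentially. E t (E (s n) x) = E t x"
      by eventually_elim (simp add: sf_absorb_left[OF E])
    then show "(\<lambda>n. E t (E (s n) x)) \<longlonglongrightarrow> E t x" by (rule tendsto_eventually)
  qed
  have pos: "E t (P x) = P x" if "0 \<le> t" for t x
  proof (rule LIMSEQ_unique[OF clin_tendsto[OF Eb P]])
    have "E t (E (s n) x) = E (s n) x" for n
      using s0[of n] that by (intro sf_absorb_right[OF E]) simp
    then show "(\<lambda>n. E t (E (s n) x)) \<longlonglongrightarrow> P x" using P by simp
  qed
  have PP: "P (P x) = P x" for x
    by (rule LIMSEQ_unique[OF P]) (simp add: neg[OF s0] P)
  have "emeasure (interval_measure (\<lambda>t. inner (E t x) x)) {..<0} = ennreal (inner (P x) x)" for x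
  proof -
    let ?M = "interval_measure (\<lambda>t. inner (E t x) x)"
    have "(\<lambda>n. emeasure ?M {..s n}) \<longlonglongrightarrow> emeasure ?M (\<Union>n. {..s n})"
      by (rule Lim_emeasure_incseq) (auto simp: incseq_def intro: order_trans smono)
    also have "(\<Union>n. {..s n}) = {..<0}"
    proof (intro equalityI subsetI)
      fix u :: real assume "u \<in> {..<0}"
      then have "\<forall>\<^sub>F n in sequentially. u < s n" using order_tendstoD(1)[OF slim] by simp
      then obtain n where "u < s n" by (auto simp: eventually_sequentially)
      then show "u \<in> (\<Union>n. {..s n})" by (auto intro!: exI[of _ n])
    qed (use s0 in \<open>auto intro: le_less_trans\<close>)
    finally have "(\<lambda>n. emeasure ?M {..s n}) \<longlonglongrightarrow> emeasure ?M {..<0}" .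
    moreover have "(\<lambda>n. emeasure ?M {..s n}) \<longlonglongrightarrow> ennreal (inner (P x) x)"
      unfolding emeasure_spectral_Iic[OF E]
      by (intro tendsto_ennrealI tendsto_inner P tendsto_const)
    ultimately show ?thesis by (rule LIMSEQ_unique)
  qed
  then show ?thesis
    by (intro exI[of _ P] conjI allI impI) (simp_all add: Psa PP neg pos)
qed

text \<open>
  Restricting the spectral measure of \<open>z\<close> to \<open>{..<0}\<close> or \<open>{0..}\<close> gives the spectral measure of
  \<open>P z\<close> or \<open>z - P z\<close>. So \<open>P\<close> reduces \<open>H\<close>, whichever spectral family was chosen.
\<close>

lemma negative_spectral_projection:
  assumes H: "selfadjoint_op H" and E: "spectral_family E"
    and int: "has_spectral_integral (\<lambda>t. t) E H"
  shows "\<exists>P. selfadjoint_op P \<and> (\<forall>x. P (P x) = P x) \<and> (\<forall>x. P (H x) = H (P x)) \<and>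
    (\<forall>x. P x = x \<longrightarrow> x \<noteq> 0 \<longrightarrow> inner (H x) x < 0) \<and> (\<forall>x. P x = 0 \<longrightarrow> 0 \<le> inner (H x) x) \<and>
    (\<forall>x. emeasure (interval_measure (\<lambda>t. inner (E t x) x)) {..<0} = ennreal (inner (P x) x))"
proof -
  obtain P where P: "selfadjoint_op P" and PP: "\<forall>x. P (P x) = P x"
    and EPneg: "\<forall>t x. t < 0 \<longrightarrow> E t (P x) = E t x" and EPpos: "\<forall>t x. 0 \<le> t \<longrightarrow> E t (P x) = P x"
    and em: "\<forall>x. emeasure (interval_measure (\<lambda>t. inner (E t x) x)) {..<0} = ennreal (inner (P x) x)"
    using spectral_left_limit_exists[OF E] by (elim exE conjE)
  note Pb = sa_bounded[OF P] and Hb = sa_bounded[OF H] and Esa = sf_selfadjoint[OF E]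
  note Eb = sa_bounded[OF Esa]
  define M where "M x = interval_measure (\<lambda>t. inner (E t x) x)" for x
  have sM[simp, measurable_cong]: "sets (M x) = sets borel" and [simp]: "space (M x) = UNIV" for x by (simp_all add: M_def)
  have fin: "finite_measure (M x)" for x unfolding M_def by (rule finite_spectral_measure[OF E])
  have Miic: "emeasure (M x) {..t} = ennreal (inner (E t x) x)" for x t
    unfolding M_def by (rule emeasure_spectral_Iic[OF E])
  have Muniv: "emeasure (M x) UNIV = ennreal ((norm x)\<^sup>2)" for x
    unfolding M_def by (rule emeasure_spectral_UNIV[OF E])
  have Mneg: "emeasure (M x) {..<0} = ennreal (inner (P x) x)" for x using em by (simp add: M_def)
  have Enn: "0 \<le> inner (E t x) x" for t x using inner_projection[OF Esa sf_idem[OF E], of t x] by simp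
  have Pnn: "inner (P x) x = (norm (P x))\<^sup>2" for x using inner_projection[OF P] PP by simp
  have Mioi: "emeasure (M x) {t<..} = ennreal ((norm x)\<^sup>2 - inner (E t x) x)" for x t
  proof -
    have "{t<..} = UNIV - {..t}" by auto
    then have "emeasure (M x) {t<..} = emeasure (M x) UNIV - emeasure (M x) {..t}"
      using finite_measure.emeasure_finite[OF fin, of x "{..t}"]
      by (simp add: emeasure_Diff del: Diff_UNIV)
    then show ?thesis by (simp add: Miic Muniv ennreal_minus Enn)
  qed
  have dens: "emeasure (density (M x) (\<lambda>u. ennreal (indicator A u))) B = emeasure (M x) (A \<inter> B)"
    if "A \<in> sets borel" "B \<in> sets borel" for x A B
    using that by (simp add: emeasure_density indicator_inter_arith[symmetric] ennreal_indicator)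
  have densfin: "emeasure (density (M x) (\<lambda>u. ennreal (indicator A u))) {t<..} < \<infinity>"
    if "A \<in> sets borel" for x A t
    using that finite_measure.emeasure_finite[OF fin, of x "A \<inter> {t<..}"]
    by (simp add: dens less_top)
  have EPin: "inner (E t (P z)) (P z) = (if t < 0 then inner (E t z) z else inner (P z) z)" for t z
  proof (cases "t < 0")
    case True
    have "inner (E t (P z)) (P z) = inner z (E t (P z))"
      using True EPneg sa_inner[OF Esa, of t z "P z"] by simp
    then show ?thesis using True EPneg by (simp add: inner_commute)
  next
    case False
    then show ?thesis using EPpos by (simp add: Pnn power2_norm_eq_inner)
  qed
  have EQin: "inner (E t (z - P z)) (z - P z) = (if t < 0 then 0 else inner (E t z) z - inner (P z) z)"
    for t z
  proof (cases "t < 0")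
    case True
    then show ?thesis using EPneg by (simp add: clin_simps[OF Eb])
  next
    case False
    then have "E t (P z) = P z" using EPpos by simp
    moreover have "inner (E t z) (P z) = inner z (P z)"
      using sa_inner[OF Esa, of t z "P z"] calculation by simp
    ultimately show ?thesis using False Pnn[of z]
      by (simp add: clin_simps[OF Eb] inner_diff inner_commute power2_norm_eq_inner)
  qed
  have normQ: "(norm (z - P z))\<^sup>2 = (norm z)\<^sup>2 - inner (P z) z" for z
    using Pnn[of z] unfolding power2_norm_eq_inner by (simp add: inner_diff inner_commute)
  have MP: "M (P z) = density (M z) (\<lambda>u. ennreal (indicator {..<0} u))" for z
  proof (rule measure_eqI_lessThan)
    show "emeasure (M (P z)) {t<..} < \<infinity>" for t by (simp add: Mioi)
    show "emeasure (M (P z)) {t<..} = emeasure (density (M z) (\<lambda>u. ennreal (indicator {..<0} u))) {t<..}" for t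
    proof (cases "t < 0")
      case True
      have "{..<0} \<inter> {t<..} = {..<0} - {..t}" by auto
      then have "emeasure (M z) ({..<0} \<inter> {t<..}) = emeasure (M z) {..<0} - emeasure (M z) {..t}"
        using finite_measure.emeasure_finite[OF fin, of z "{..t}"] True
        by (simp add: emeasure_Diff subset_eq)
      then show ?thesis using True
        by (simp add: dens Mioi EPin Mneg Miic ennreal_minus Enn Pnn)
    next
      case False
      then have "{..<0} \<inter> {t<..} = {}" by auto
      then show ?thesis using False by (simp add: dens Mioi EPin Pnn)
    qed
  qed simp_all
  have MQ: "M (z - P z) = density (M z) (\<lambda>u. ennreal (indicator {0..} u))" for z
  proof (rule measure_eqI_lessThan)
    show "emeasure (M (z - P z)) {t<..} < \<infinity>" for t by (simp add: Mioi)
    show "emeasure (M (z - P z)) {t<..} = emeasure (density (M z) (\<lambda>u. ennreal (indicator {0..} u))) {t<..}" for t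
    proof (cases "t < 0")
      case True
      then have "{0..} \<inter> {t<..} = UNIV - {..<0}" by auto
      then have "emeasure (M z) ({0..} \<inter> {t<..}) = emeasure (M z) UNIV - emeasure (M z) {..<0}"
        using finite_measure.emeasure_finite[OF fin, of z "{..<0}"]
        by (simp add: emeasure_Diff del: Diff_UNIV)
      then show ?thesis using True
        by (simp add: dens Mioi EQin Mneg Muniv ennreal_minus Pnn normQ)
    next
      case False
      then have "{0..} \<inter> {t<..} = {t<..}" by auto
      then show ?thesis using False by (simp add: dens Mioi EQin normQ)
    qed
  qed simp_all
  have intM: "integrable (M x) (\<lambda>u. u)" and qM: "inner (H x) x = integral\<^sup>L (M x) (\<lambda>u. u)" for x
  proof -
    have "integrable (M x) (\<lambda>u. u) \<and> cinner (H x) x = complex_of_real (integral\<^sup>L (M x) (\<lambda>u. u))"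
      using int unfolding has_spectral_integral_def Let_def inner_eq_Re_cinner[symmetric] M_def by blast
    then show "integrable (M x) (\<lambda>u. u)" "inner (H x) x = integral\<^sup>L (M x) (\<lambda>u. u)"
      by (simp_all add: inner_eq_Re_cinner)
  qed
  have int_ind: "integrable (M z) (\<lambda>u. indicator A u * u)" if "A \<in> sets borel" for A z
    using integrable_mult_indicator[OF _ intM, of A z] that by simp
  have qP: "inner (H (P z)) (P z) = integral\<^sup>L (M z) (\<lambda>u. indicator {..<0} u * u)" for z
    unfolding qM MP by (subst integral_density) simp_all
  have qQ: "inner (H (z - P z)) (z - P z) = integral\<^sup>L (M z) (\<lambda>u. indicator {0..} u * u)" for z
    unfolding qM MQ by (subst integral_density) simp_all
  have split: "inner (H z) z = inner (H (P z)) (P z) + inner (H (z - P z)) (z - P z)" for z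
  proof -
    have "inner (H z) z = integral\<^sup>L (M z) (\<lambda>u. indicator {..<0} u * u + indicator {0..} u * u)"
      unfolding qM by (intro Bochner_Integration.integral_cong) (auto simp: indicator_def)
    then show ?thesis
      unfolding qP qQ by (simp add: Bochner_Integration.integral_add int_ind)
  qed
  \<comment> \<open>Polarizing \<open>split\<close>: the mixed term between the range and the kernel
    of \<open>P\<close> vanishes. Hence \<open>H\<close> leaves both subspaces invariant, which is
    \<open>fix1\<close> and \<open>ker1\<close>, and so commutes with \<open>P\<close>.\<close>
  have cross: "inner (H u) v = 0" if "P u = u" "P v = 0" for u v
  proof -
    have "inner (H (u + v)) (u + v) = inner (H u) u + inner (H v) v"
      using split[of "u + v"] that by (simp add: clin_add[OF Pb])
    moreover have "inner (H v) u = inner (H u) v" using sa_inner[OF H, of v u] by (simp add: inner_commute)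
    ultimately show ?thesis by (simp add: clin_add[OF Hb] inner_add)
  qed
  have Pcross: "P (z - P z) = 0" for z using PP by (simp add: clin_simps[OF Pb])
  have fix1: "P (H u) = H u" if "P u = u" for u
  proof -
    have "inner (H u - P (H u)) (H u - P (H u)) = inner (H u) (H u - P (H u)) - inner (P (H u)) (H u - P (H u))"
      by (simp add: inner_diff_left)
    also have "inner (H u) (H u - P (H u)) = 0" by (rule cross[OF that Pcross])
    also have "inner (P (H u)) (H u - P (H u)) = 0"
      using sa_inner[OF P, of "H u" "H u - P (H u)"] by (simp add: Pcross)
    finally show ?thesis by simp
  qed
  have ker1: "P (H v) = 0" if "P v = 0" for v
  proof -
    have "inner (P (H v)) (P (H v)) = inner (H v) (P (H v))"
      using sa_inner[OF P, of "H v" "P (H v)"] PP by simp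
    also have "\<dots> = inner (H (P (H v))) v" using sa_inner[OF H, of "P (H v)" v] by (simp add: inner_commute)
    also have "\<dots> = 0" using cross[OF _ that] PP by simp
    finally show ?thesis by simp
  qed
  have comm: "P (H x) = H (P x)" for x
  proof -
    have "P (H (P x)) = H (P x)" using fix1 PP by simp
    moreover have "P (H (x - P x)) = 0" by (rule ker1[OF Pcross])
    ultimately show ?thesis by (simp add: clin_simps[OF Hb] clin_simps[OF Pb])
  qed
  have neg: "inner (H x) x < 0" if "P x = x" "x \<noteq> 0" for x
  proof -
    let ?f = "\<lambda>u. - (indicator {..<0} u * u) :: real"
    have I: "integrable (M x) ?f" using int_ind by simp
    have nn: "AE u in M x. 0 \<le> ?f u" by (auto simp: indicator_def)
    have eq: "- inner (H x) x = integral\<^sup>L (M x) ?f" using qP[of x] that by simp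
    \<comment> \<open>Strictness: a vanishing integral would leave no mass on \<open>{..<0}\<close>,
      but that mass is the squared norm of \<open>P x = x\<close>.\<close>
    have "integral\<^sup>L (M x) ?f \<noteq> 0"
    proof
      assume "integral\<^sup>L (M x) ?f = 0"
      then have "AE u in M x. ?f u = 0" using integral_nonneg_eq_0_iff_AE[OF I nn] by simp
      then have "AE u in M x. u \<notin> {..<0}" by eventually_elim (auto simp: indicator_def)
      then have "emeasure (M x) {..<0} = 0" by (subst (asm) AE_iff_measurable[of "{..<0}"]) auto
      then have "(norm (P x))\<^sup>2 = 0" by (simp add: Mneg Pnn del: zero_eq_power2)
      then show False using that by simp
    qed
    moreover have "0 \<le> integral\<^sup>L (M x) ?f" by (rule integral_nonneg_AE[OF nn])
    ultimately show ?thesis using eq by linarith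
  qed
  have pos: "0 \<le> inner (H x) x" if "P x = 0" for x
    using qQ[of x] that by (auto intro!: integral_nonneg_AE simp: indicator_def)
  show ?thesis
    by (intro exI[of _ P] conjI allI impI) (simp_all add: P PP comm neg pos em)
qed

lemma op_fun_eqI:
  assumes "has_spectral_integral f (spectral_family_of H) T"
  shows "op_fun f H = T"
  unfolding op_fun_def
proof (rule the_equality, rule assms)
  fix T' assume T': "has_spectral_integral f (spectral_family_of H) T'"
  show "T' = T"
    by (rule bounded_clinear_eq_if_quadratic_eq)
      (use assms T' in \<open>simp_all add: has_spectral_integral_def Let_def\<close>)
qed

text \<open>The sign function with value 1 at 0 equals \<open>1 - 2 * indicator {..<0}\<close>, so
  its spectral integral is \<open>x - 2 *\<^sub>R P x\<close> and the kernel of \<open>H\<close>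
  falls on the positive side. No later argument returns to spectral measures.\<close>

lemma negative_projection:
  assumes H: "selfadjoint_op H"
  obtains P where "selfadjoint_op P" and "\<And>x. P (P x) = P x" and "\<And>x. P (H x) = H (P x)"
    and "\<And>x. P x = x \<Longrightarrow> x \<noteq> 0 \<Longrightarrow> inner (H x) x < 0" and "\<And>x. P x = 0 \<Longrightarrow> 0 \<le> inner (H x) x"
    and "sign_op H = (\<lambda>x. x - 2 *\<^sub>R P x)" and "nu_minus H = ecdim (range P)"
proof -
  define E where "E = spectral_family_of H"
  have "spectral_family E \<and> has_spectral_integral (\<lambda>t. t) E H"
    unfolding E_def spectral_family_of_def by (rule someI_ex[OF spectral_theorem[OF H]])
  then have E: "spectral_family E" and int: "has_spectral_integral (\<lambda>t. t) E H" by simp_all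
  obtain P where P: "selfadjoint_op P" "\<forall>x. P (P x) = P x" "\<forall>x. P (H x) = H (P x)"
    "\<forall>x. P x = x \<longrightarrow> x \<noteq> 0 \<longrightarrow> inner (H x) x < 0" "\<forall>x. P x = 0 \<longrightarrow> 0 \<le> inner (H x) x"
    and em: "\<forall>x. emeasure (interval_measure (\<lambda>t. inner (E t x) x)) {..<0} = ennreal (inner (P x) x)"
    using negative_spectral_projection[OF H E int] by (elim exE conjE)
  define M where "M x = interval_measure (\<lambda>t. inner (E t x) x)" for x
  have sets[simp]: "sets (M x) = sets borel" "space (M x) = UNIV" for x by (simp_all add: M_def)
  have fin: "finite_measure (M x)" for x unfolding M_def by (rule finite_spectral_measure[OF E])
  have Pnn: "0 \<le> inner (P x) x" for x using inner_projection[OF P(1)] P(2) by simp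
  have neg: "measure (M x) {..<0} = inner (P x) x" for x
    using em Pnn by (simp add: measure_def M_def)
  have univ: "measure (M x) UNIV = inner x x" for x
    using emeasure_spectral_UNIV[OF E, of x] by (simp add: measure_def M_def power2_norm_eq_inner)
  have int_ind: "integrable (M x) (indicator {..<0} :: real \<Rightarrow> real)" for x
    using finite_measure.emeasure_finite[OF fin, of x "{..<0}"]
    by (intro integrable_real_indicator) (auto simp: less_top)
  have "has_spectral_integral (indicator {..<0}) E P"
    unfolding has_spectral_integral_def Let_def inner_eq_Re_cinner[symmetric]
      M_def[symmetric]
    by (simp add: int_ind sa_bounded[OF P(1)] cinner_selfadjoint[OF P(1)] neg)
  then have ind: "op_fun (indicator {..<0}) H = P" by (intro op_fun_eqI) (simp add: E_def)
  have S: "selfadjoint_op (\<lambda>x. x - 2 *\<^sub>R P x)"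
    by (rule selfadjoint_op_diff[OF selfadjoint_op_id selfadjoint_op_scaleR[OF P(1)]])
  have sgn: "(\<lambda>t. if t \<ge> 0 then 1 else -1) = (\<lambda>t :: real. 1 - 2 * indicator {..<0} t :: real)"
    by (auto simp: indicator_def)
  have int1: "integrable (M x) (\<lambda>_. 1 :: real)" for x
    using finite_measure.integrable_const[OF fin] .
  have "has_spectral_integral (\<lambda>t. 1 - 2 * indicator {..<0} t) E (\<lambda>x. x - 2 *\<^sub>R P x)"
    unfolding has_spectral_integral_def Let_def inner_eq_Re_cinner[symmetric]
      M_def[symmetric]
    using int_ind int1
    by (simp add: sa_bounded[OF S] cinner_selfadjoint[OF S] neg univ inner_diff_left
        Bochner_Integration.integral_diff)
  then have sgn: "sign_op H = (\<lambda>x. x - 2 *\<^sub>R P x)"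
    unfolding sign_op_def sgn by (intro op_fun_eqI) (simp add: E_def)
  have "nu_minus H = ecdim (range P)"
    by (simp add: nu_minus_def spectral_subspace_def ind)
  from that[of P] P sgn this show thesis by blast
qed

section \<open>Dimension\<close>

lemma csubspace_range:
  assumes "bounded_clinear f"
  shows "complex_vector.subspace (range f)"
proof -
  have "f x + f y \<in> range f" for x y using clin_add[OF assms, of x y] by (metis rangeI)
  moreover have "c *\<^sub>C f x \<in> range f" for c x using clin_scaleC[OF assms, of c x] by (metis rangeI)
  moreover have "0 \<in> range f" using clin_zero[OF assms] by (metis rangeI)
  ultimately show ?thesis by (auto simp: complex_vector.subspace_def)
qed

context
  fixes f :: "'a :: chilbert_space \<Rightarrow> 'b :: chilbert_space" and V W
  assumes f: "bounded_clinear f" and V: "complex_vector.subspace V"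
    and fV: "f ` V \<subseteq> W" and ker: "\<And>v. v \<in> V \<Longrightarrow> f v = 0 \<Longrightarrow> v = 0"
begin

interpretation vector_space_pair "scaleC :: complex \<Rightarrow> 'a \<Rightarrow> 'a" "scaleC :: complex \<Rightarrow> 'b \<Rightarrow> 'b"
  by unfold_locales

interpretation lin: Vector_Spaces.linear "scaleC :: complex \<Rightarrow> 'a \<Rightarrow> 'a" "scaleC :: complex \<Rightarrow> 'b \<Rightarrow> 'b" f
  by unfold_locales (simp_all add: clin_simps[OF f])

lemma inj_on_if_kernel_trivial: "inj_on f V"
proof (rule inj_onI)
  fix x y assume "x \<in> V" "y \<in> V" "f x = f y"
  then have "x - y \<in> V" "f (x - y) = 0"
    using complex_vector.subspace_diff[OF V] by (simp_all add: clin_diff[OF f])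
  then show "x = y" using ker[of "x - y"] by simp
qed

lemma independent_image_basis:
  assumes "B \<subseteq> V" and "complex_vector.independent B"
  shows "complex_vector.independent (f ` B)" and "card (f ` B) = card B"
    and "finite (f ` B) \<longleftrightarrow> finite B"
proof -
  have "complex_vector.span B \<subseteq> V" using assms(1) V by (rule complex_vector.span_minimal)
  then have "inj_on f (complex_vector.span B)"
    using inj_on_if_kernel_trivial inj_on_subset by blast
  then show "complex_vector.independent (f ` B)"
    using lin.independent_injective_image assms(2) by blast
  have "inj_on f B" using inj_on_if_kernel_trivial assms(1) inj_on_subset by blast
  then show "card (f ` B) = card B" "finite (f ` B) \<longleftrightarrow> finite B"
    by (simp_all add: card_image finite_image_iff)
qed

text \<open>If \<open>W\<close> has a finite spanning set, the image of a basis of \<open>V\<close>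
  is independent inside a finite span. This bounds the size of the basis and also shows it finite,
  which excludes the value \<infinity> for \<open>ecdim V\<close>.\<close>

lemma ecdim_le_if_injective: "ecdim V \<le> ecdim W"
proof (cases "\<exists>B. finite B \<and> W \<subseteq> complex_vector.span B")
  case False
  then have "ecdim W = \<infinity>" unfolding ecdim_def by (rule if_not_P)
  then show ?thesis by simp
next
  case True
  then obtain B0 where B0: "finite B0" "W \<subseteq> complex_vector.span B0" by blast
  obtain C where C: "C \<subseteq> W" "complex_vector.independent C" "W \<subseteq> complex_vector.span C"
    "card C = complex_vector.dim W"
    using complex_vector.basis_exists by blast
  have "finite C" using complex_vector.independent_span_bound[OF B0(1) C(2)] C(1) B0(2) by blast
  obtain B where B: "B \<subseteq> V" "complex_vector.independent B" "V \<subseteq> complex_vector.span B"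
    "card B = complex_vector.dim V"
    using complex_vector.basis_exists by blast
  note im = independent_image_basis[OF B(1,2)]
  have "f ` B \<subseteq> complex_vector.span C" using B(1) fV C(3) by blast
  then have "finite (f ` B) \<and> card (f ` B) \<le> card C"
    by (rule complex_vector.independent_span_bound[OF \<open>finite C\<close> im(1)])
  then have "finite B" "card B \<le> card C" using im by simp_all
  then show ?thesis using True B C by (auto simp: ecdim_def)
qed

text \<open>A vector of \<open>W\<close> outside the image could be added to the image of a basis of
  \<open>V\<close>, giving \<open>k + 1\<close> independent vectors in the span of
  \<open>k\<close>.\<close>

lemma image_eq_if_ecdim_eq:
  assumes k: "ecdim V = enat k" "ecdim W = enat k"
  shows "f ` V = W"
proof (rule ccontr)
  assume "f ` V \<noteq> W"
  then obtain w where w: "w \<in> W" "w \<notin> f ` V" using fV by blast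
  from k obtain B0 where B0: "finite B0" "W \<subseteq> complex_vector.span B0"
    by (auto simp: ecdim_def split: if_splits)
  obtain C where C: "C \<subseteq> W" "complex_vector.independent C" "W \<subseteq> complex_vector.span C"
    "card C = complex_vector.dim W"
    using complex_vector.basis_exists by blast
  have "finite C" using complex_vector.independent_span_bound[OF B0(1) C(2)] C(1) B0(2) by blast
  obtain B where B: "B \<subseteq> V" "complex_vector.independent B" "V \<subseteq> complex_vector.span B"
    "card B = complex_vector.dim V"
    using complex_vector.basis_exists by blast
  have dims: "card B = k" "card C = k"
    using k B(4) C(4) by (auto simp: ecdim_def split: if_splits)
  note im = independent_image_basis[OF B(1,2)]
  have "complex_vector.span (f ` B) = f ` complex_vector.span B" by (rule lin.span_image)
  also have "\<dots> \<subseteq> f ` V" using complex_vector.span_minimal[OF B(1) V] by blast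
  finally have "w \<notin> complex_vector.span (f ` B)" using w by blast
  then have ind: "complex_vector.independent (insert w (f ` B))"
    using im(1) by (rule complex_vector.independent_insertI)
  have "insert w (f ` B) \<subseteq> complex_vector.span C" using w B(1) fV C(3) by blast
  then have fc: "finite (insert w (f ` B)) \<and> card (insert w (f ` B)) \<le> card C"
    by (rule complex_vector.independent_span_bound[OF \<open>finite C\<close> ind])
  have "w \<notin> f ` B" using w B(1) by blast
  then have "card (insert w (f ` B)) = Suc k" using fc im(2) dims by simp
  then show False using fc dims by simp
qed

end

lemma subspace_closure_normed:
  fixes V :: "'a :: real_normed_vector set"
  assumes V: "subspace V"
  shows "subspace (closure V)"
proof (rule subspaceI)
  show "0 \<in> closure V" using subspace_0[OF V] closure_subset by (rule subsetD[rotated])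
  show "x + y \<in> closure V" if xy: "x \<in> closure V" "y \<in> closure V" for x y
  proof -
    obtain u v where "\<forall>n. u n \<in> V" "u \<longlonglongrightarrow> x" "\<forall>n. v n \<in> V" "v \<longlonglongrightarrow> y"
      using xy unfolding closure_sequential by (elim exE conjE) (rule that)
    then have "(\<forall>n. u n + v n \<in> V) \<and> (\<lambda>n. u n + v n) \<longlonglongrightarrow> x + y"
      using subspace_add[OF V] by (simp add: tendsto_add)
    then show ?thesis unfolding closure_sequential by (rule exI[of _ "\<lambda>n. u n + v n"])
  qed
  show "c *\<^sub>R x \<in> closure V" if x: "x \<in> closure V" for c x
  proof -
    obtain u where "\<forall>n. u n \<in> V" "u \<longlonglongrightarrow> x"
      using x unfolding closure_sequential by (elim exE conjE) (rule that)
    then have "(\<forall>n. c *\<^sub>R u n \<in> V) \<and> (\<lambda>n. c *\<^sub>R u n) \<longlonglongrightarrow> c *\<^sub>R x"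
      using subspace_scale[OF V] by (simp add: tendsto_scaleR)
    then show ?thesis unfolding closure_sequential by (rule exI[of _ "\<lambda>n. c *\<^sub>R u n"])
  qed
qed

section \<open>Moore--Penrose inverses\<close>

text \<open>Uniform boundedness by a gliding hump, which needs no Baire category argument.\<close>

lemma weakly_bounded_imp_bounded:
  fixes W :: "'a :: {real_inner, complete_space} set"
  assumes "\<And>x. \<exists>c. \<forall>w \<in> W. \<bar>inner x w\<bar> \<le> c"
  shows "\<exists>C. \<forall>w \<in> W. norm w \<le> C"
proof (rule ccontr)
  assume "\<nexists>C. \<forall>w \<in> W. norm w \<le> C"
  \<comment> \<open>The factor \<open>3 ^ n\<close> undoes the step length of the hump, the 2 pays
    for the half lost to later steps, and \<open>Suc n\<close> is the growth that remains.\<close>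
  then have "\<exists>w \<in> W. 3 ^ n * (2 * real (Suc n)) < norm w" for n :: nat
    by (meson not_le)
  then obtain w where wW: "\<And>n. w n \<in> W" and w: "\<And>n. 3 ^ n * (2 * real (Suc n)) < norm (w n)"
    by metis
  have wpos: "0 < norm (w n)" for n by (rule less_trans[OF _ w]) simp
  define d where "d n = ((1/3) ^ n / norm (w n)) *\<^sub>R w n" for n
  have nd: "norm (d n) = (1/3) ^ n" for n using wpos[of n] by (simp add: d_def)
  have ind: "inner (d n) (w n) = (1/3) ^ n * norm (w n)" for n
    using wpos[of n] by (simp add: d_def dot_square_norm power2_eq_square)
  \<comment> \<open>The sign of each step is chosen so that the new term adds to what
    \<open>X n\<close> already contributes against \<open>w n\<close>, never cancels it.\<close>
  define X where "X = rec_nat 0 (\<lambda>n x. if 0 \<le> inner x (w n) then x + d n else x - d n)"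
  have XS: "X (Suc n) = (if 0 \<le> inner (X n) (w n) then X n + d n else X n - d n)" for n
    by (simp add: X_def)
  have step: "norm (X (Suc n) - X n) = (1/3) ^ n" for n by (simp add: XS nd)
  have hump: "(1/3) ^ n * norm (w n) \<le> \<bar>inner (X (Suc n)) (w n)\<bar>" for n
  proof -
    have "0 \<le> inner (d n) (w n)" unfolding ind by simp
    then show ?thesis unfolding ind[symmetric] by (simp add: XS inner_add_left inner_diff_left)
  qed
  \<comment> \<open>The right side is the exact geometric sum of the steps after the n-th; it stays
    below half of the n-th step, so the later steps cannot destroy the hump.\<close>
  have tail: "norm (X m - X (Suc n)) \<le> (1/2) * (1/3) ^ n - (3/2) * (1/3) ^ m" if "Suc n \<le> m" for m n
    using that
  proof (induction m rule: dec_induct)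
    case (step m)
    have "norm (X (Suc m) - X (Suc n)) \<le> norm (X (Suc m) - X m) + norm (X m - X (Suc n))"
      using norm_triangle_ineq[of "X (Suc m) - X m" "X m - X (Suc n)"] by simp
    then show ?case using step.IH \<open>\<And>n. norm (X (Suc n) - X n) = (1/3) ^ n\<close>[of m] by simp
  qed simp
  have tail': "norm (X m - X (Suc n)) \<le> (1/2) * (1/3) ^ n" if "Suc n \<le> m" for m n
    using tail[OF that] by (rule order_trans) simp
  have "Cauchy X"
  proof (rule metric_CauchyI)
    fix e :: real assume "0 < e"
    then obtain n where n: "(1/3) ^ n < e" using real_arch_pow_inv[of e "1/3"] by auto
    have "dist (X i) (X j) < e" if "Suc n \<le> i" "Suc n \<le> j" for i j
      using tail'[OF that(1)] tail'[OF that(2)] n norm_triangle_ineq4[of "X i - X (Suc n)" "X j - X (Suc n)"]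
      by (simp add: dist_norm)
    then show "\<exists>M. \<forall>i\<ge>M. \<forall>j\<ge>M. dist (X i) (X j) < e" by blast
  qed
  then obtain x where x: "X \<longlonglongrightarrow> x" by (auto simp: Cauchy_convergent_iff convergent_def)
  have close: "norm (x - X (Suc n)) \<le> (1/2) * (1/3) ^ n" for n
    by (rule LIMSEQ_le_const2[OF tendsto_norm[OF tendsto_diff[OF x tendsto_const]]])
      (use tail' in blast)
  have big: "real (Suc n) \<le> \<bar>inner x (w n)\<bar>" for n
  proof -
    define t where "t = (1/3) ^ n * norm (w n)"
    have "\<bar>inner (x - X (Suc n)) (w n)\<bar> \<le> (1/2) * (1/3) ^ n * norm (w n)"
      using Cauchy_Schwarz_ineq2[of "x - X (Suc n)" "w n"]
        mult_right_mono[OF close[of n] norm_ge_zero[of "w n"]] by linarith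
    then have "\<bar>inner x (w n) - inner (X (Suc n)) (w n)\<bar> \<le> t / 2"
      by (simp add: t_def inner_diff_left)
    then have "t / 2 \<le> \<bar>inner x (w n)\<bar>" using hump[of n, folded t_def] by linarith
    moreover have "2 * real (Suc n) \<le> t"
    proof -
      have "2 * real (Suc n) = (1/3) ^ n * (3 ^ n * (2 * real (Suc n)))"
        by (simp add: power_divide)
      also have "\<dots> \<le> t"
        unfolding t_def by (rule mult_left_mono[OF less_imp_le[OF w]]) simp
      finally show ?thesis .
    qed
    ultimately show ?thesis by argo
  qed
  obtain c where c: "\<forall>v \<in> W. \<bar>inner x v\<bar> \<le> c" using assms by blast
  obtain n :: nat where "c < real n" using reals_Archimedean2 by blast
  then show False using big[of n] c wW[of n] by fastforce
qed

context
  fixes R :: "'a :: chilbert_space \<Rightarrow> 'a"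
  assumes R: "selfadjoint_op R"
begin

text \<open>The kernel of a selfadjoint operator is orthogonal to its range, hence to the closure of
  the range.\<close>

lemma closure_range_kernel:
  assumes "x \<in> closure (range R)" and "R x = 0"
  shows "x = 0"
proof -
  obtain z where z: "\<And>n. z n \<in> range R" "z \<longlonglongrightarrow> x" using assms(1) unfolding closure_sequential by (elim exE conjE) (rule that, simp_all)
  have "inner (z n) x = 0" for n
    using z(1)[of n] sa_inner[OF R, of _ x] assms(2) by auto
  then have "(\<lambda>n. inner (z n) x) \<longlonglongrightarrow> 0" by simp
  moreover have "(\<lambda>n. inner (z n) x) \<longlonglongrightarrow> inner x x" by (intro tendsto_inner z tendsto_const)
  ultimately have "inner x x = 0" by (rule LIMSEQ_unique[rotated])
  then show ?thesis by simp
qed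

lemma subspace_closure_range: "subspace (closure (range R))"
  by (intro subspace_closure_normed csubspace_imp_subspace csubspace_range sa_bounded R)

lemma mp_inverse_eqI:
  assumes "x \<in> closure (range R)" and "R x = b"
  shows "mp_inverse R b = x"
  unfolding mp_inverse_def
proof (rule the_equality)
  show "x \<in> closure (range R) \<and> (\<exists>k. R k = 0 \<and> b = R x + k)"
    using assms clin_zero[OF sa_bounded[OF R]] by auto
  fix x' assume "x' \<in> closure (range R) \<and> (\<exists>k. R k = 0 \<and> b = R x' + k)"
  then obtain k where x': "x' \<in> closure (range R)" and k: "R k = 0" "b = R x' + k" by blast
  have "k = R (x - x')" using k assms by (simp add: clin_diff[OF sa_bounded[OF R]])
  then have "k \<in> closure (range R)" using subsetD[OF closure_subset rangeI] by simp
  then have "k = 0" by (rule closure_range_kernel[OF _ k(1)])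
  then have "R (x' - x) = 0" using k assms by (simp add: clin_diff[OF sa_bounded[OF R]])
  moreover have "x' - x \<in> closure (range R)"
    using x' assms(1) subspace_closure_range by (simp add: subspace_diff)
  ultimately show "x' = x" using closure_range_kernel[of "x' - x"] by simp
qed

lemma
  assumes "b \<in> range R"
  shows mp_inverse_in_closure: "mp_inverse R b \<in> closure (range R)"
    and R_mp_inverse: "R (mp_inverse R b) = b"
proof -
  obtain x where x: "b = R x" using assms by blast
  \<comment> \<open>Project any preimage \<open>x\<close> to the closure of the range. The discarded
    part \<open>x - s\<close> is orthogonal to \<open>R (R (x - s))\<close>, so \<open>R\<close>
    kills it and \<open>s\<close> is still a preimage.\<close>
  obtain s where s: "s \<in> closure (range R)" "\<And>v. v \<in> closure (range R) \<Longrightarrow> inner (x - s) v = 0"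
    using orthogonal_decomposition[OF subspace_closure_range closed_closure, of x] by blast
  have "R (R (x - s)) \<in> closure (range R)" by (rule subsetD[OF closure_subset rangeI])
  then have "inner (R (x - s)) (R (x - s)) = 0" using s(2) sa_inner[OF R, of "x - s"] by simp
  then have "R s = b" by (simp add: x clin_diff[OF sa_bounded[OF R]])
  then have "mp_inverse R b = s" by (rule mp_inverse_eqI[OF s(1)])
  then show "mp_inverse R b \<in> closure (range R)" "R (mp_inverse R b) = b"
    using s(1) \<open>R s = b\<close> by simp_all
qed

text \<open>Boundedness follows from solvability alone. Since
  \<open>(S y, R v) = (y, cadjoint B v)\<close>, the vectors \<open>cadjoint B v\<close> with
  \<open>R v\<close> in the unit ball are weakly bounded, hence bounded. The resulting estimate
  extends from \<open>range R\<close> to its closure, which contains \<open>S y\<close>, and can be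
  tested with \<open>S y\<close> itself.\<close>

lemma bounded_clinear_mp_inverse_comp:
  fixes B :: "'b :: chilbert_space \<Rightarrow> 'a"
  assumes B: "bounded_clinear B" and sub: "range B \<subseteq> range R"
  shows "bounded_clinear (\<lambda>y. mp_inverse R (B y))"
proof -
  define S where "S y = mp_inverse R (B y)" for y
  note Rb = sa_bounded[OF R]
  have Sc: "S y \<in> closure (range R)" and RS: "R (S y) = B y" for y
    using mp_inverse_in_closure[of "B y"] R_mp_inverse[of "B y"] subsetD[OF sub rangeI[of B y]]
    by (simp_all add: S_def)
  have "\<exists>C. \<forall>w \<in> {cadjoint B v |v. norm (R v) \<le> 1}. norm w \<le> C"
  proof (rule weakly_bounded_imp_bounded)
    fix y
    have "\<bar>inner y (cadjoint B v)\<bar> \<le> norm (S y)" if "norm (R v) \<le> 1" for v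
    proof -
      have "inner y (cadjoint B v) = inner (S y) (R v)"
        using sa_inner[OF R, of "S y" v] inner_cadjoint[OF B, of y v] by (simp add: RS)
      then show ?thesis
        using Cauchy_Schwarz_ineq2[of "S y" "R v"] mult_left_mono[OF that norm_ge_zero[of "S y"]]
        by simp
    qed
    then show "\<exists>c. \<forall>w \<in> {cadjoint B v |v. norm (R v) \<le> 1}. \<bar>inner y w\<bar> \<le> c" by blast
  qed
  then obtain C where C: "\<And>v. norm (R v) \<le> 1 \<Longrightarrow> norm (cadjoint B v) \<le> C" by blast
  have est: "\<bar>inner (S y) (R v)\<bar> \<le> C * norm y * norm (R v)" for y v
  proof (cases "R v = 0")
    case False
    define r where "r = inverse (norm (R v))"
    have r: "0 < r" "norm (R v) = inverse r" using False by (simp_all add: r_def)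
    have "norm (R (r *\<^sub>R v)) \<le> 1" using r by (simp add: clin_scaleR[OF Rb])
    then have "norm (cadjoint B (r *\<^sub>R v)) \<le> C" by (rule C)
    then have "r * norm (cadjoint B v) \<le> C"
      using r by (simp add: clin_scaleR[OF bounded_clinear_cadjoint[OF B]])
    then have "norm (cadjoint B v) \<le> C / r" using r(1) by (simp add: pos_le_divide_eq mult.commute)
    then have "norm (cadjoint B v) \<le> C * norm (R v)" by (simp add: r(2) divide_inverse)
    then have "norm y * norm (cadjoint B v) \<le> norm y * (C * norm (R v))"
      by (rule mult_left_mono) simp
    moreover have "inner (S y) (R v) = inner y (cadjoint B v)"
      using sa_inner[OF R, of "S y" v] inner_cadjoint[OF B, of y v] by (simp add: RS)
    ultimately show ?thesis
      using Cauchy_Schwarz_ineq2[of y "cadjoint B v"] by (simp add: mult_ac)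
  qed simp
  have "bounded_clinear S"
  proof (rule bounded_clinearI)
    have cs: "complex_vector.subspace (range R)" by (rule csubspace_range[OF Rb])
    note cl = subspace_closure_range
    show "S (x + y) = S x + S y" for x y
      unfolding S_def[of "x + y"]
      by (rule mp_inverse_eqI)
        (simp_all add: subspace_add cl Sc clin_add[OF Rb] clin_add[OF B] RS)
    show "S (c *\<^sub>C x) = c *\<^sub>C S x" for c x
      unfolding S_def[of "c *\<^sub>C x"]
    proof (rule mp_inverse_eqI)
      obtain z where z: "\<And>n. z n \<in> range R" "z \<longlonglongrightarrow> S x"
        using Sc[of x] unfolding closure_sequential by (elim exE conjE) (rule that, simp_all)
      from clin_tendsto[OF bounded_clinear_scaleC z(2), of c] have "(\<lambda>n. c *\<^sub>C z n) \<longlonglongrightarrow> c *\<^sub>C S x" .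
      moreover have "c *\<^sub>C z n \<in> range R" for n using cs z(1) by (rule complex_vector.subspace_scale)
      ultimately show "c *\<^sub>C S x \<in> closure (range R)"
        unfolding closure_sequential by (intro exI[of _ "\<lambda>n. c *\<^sub>C z n"]) simp
    qed (simp add: clin_scaleC[OF Rb] clin_scaleC[OF B] RS)
    show "norm (S y) \<le> C * norm y" for y
    proof -
      obtain z where z: "\<And>n. z n \<in> range R" "z \<longlonglongrightarrow> S y"
        using Sc[of y] unfolding closure_sequential by (elim exE conjE) (rule that, simp_all)
      have "\<bar>inner (S y) (z n)\<bar> \<le> C * norm y * norm (z n)" for n using z(1)[of n] est by auto
      moreover have "(\<lambda>n. \<bar>inner (S y) (z n)\<bar>) \<longlonglongrightarrow> \<bar>inner (S y) (S y)\<bar>"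
        by (intro tendsto_rabs tendsto_inner tendsto_const z)
      moreover have "(\<lambda>n. C * norm y * norm (z n)) \<longlonglongrightarrow> C * norm y * norm (S y)"
        by (intro tendsto_mult tendsto_const tendsto_norm z)
      ultimately have "\<bar>inner (S y) (S y)\<bar> \<le> C * norm y * norm (S y)"
        by (intro LIMSEQ_le) auto
      then have "norm (S y) * norm (S y) \<le> C * norm y * norm (S y)"
        by (simp add: dot_square_norm power2_eq_square)
      moreover have "0 \<le> C" using C[of 0] norm_ge_zero[of "cadjoint B 0"]
        by (simp add: clin_zero[OF Rb] del: norm_ge_zero)
      ultimately show ?thesis by (cases "S y = 0") simp_all
    qed
  qed
  then show ?thesis by (simp add: S_def[abs_def])
qed

text \<open>The bound makes \<open>R x \<mapsto> inner b x\<close> a bounded functional on the range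
  of \<open>R\<close>; if \<open>s\<close> represents it, then \<open>b = R s\<close> by
  selfadjointness.\<close>

lemma in_range_if_bounded:
  assumes "\<And>x. \<bar>inner b x\<bar> \<le> C * norm (R x)"
  shows "b \<in> range R"
proof -
  have "\<exists>s \<in> closure (R ` UNIV). \<forall>x \<in> UNIV. inner b x = inner s (R x)"
    by (rule riesz_representation_through[where C = C])
      (use assms R in \<open>auto intro: bounded_linear.linear bounded_linear_inner_right
        bounded_clinear_imp_bounded_linear sa_bounded\<close>)
  then obtain s where "\<And>x. inner b x = inner s (R x)" by blast
  then have "inner x b = inner x (R s)" for x
    using sa_inner[OF R, of s x] by (simp only: inner_commute[of x])
  then have "b = R s" by (rule inner_extI)
  then show ?thesis by simp
qed

end

section \<open>Block operators\<close>

text \<open>The data after multiplication by the fundamental symmetries, so that only Hilbert space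
  notions remain. \<open>RR\<close> says that \<open>R\<close> is a square root of the modulus of
  \<open>H\<close>, and \<open>P\<close> is the negative spectral projection, of rank
  \<kappa>.\<close>

locale negative_index_block =
  fixes H R P :: "'a :: chilbert_space \<Rightarrow> 'a" and B :: "'b :: chilbert_space \<Rightarrow> 'a" and \<kappa> :: nat
  assumes H: "selfadjoint_op H" and P: "selfadjoint_op P" and R: "selfadjoint_op R"
    and PP: "\<And>x. P (P x) = P x" and PH: "\<And>x. P (H x) = H (P x)" and PR: "\<And>x. P (R x) = R (P x)"
    and Hneg: "\<And>x. P x = x \<Longrightarrow> x \<noteq> 0 \<Longrightarrow> inner (H x) x < 0"
    and RR: "\<And>x. R (R x) = H (x - 2 *\<^sub>R P x)"
    and dimP: "ecdim (range P) = enat \<kappa>"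
    and B: "bounded_clinear B"
begin

text \<open>The sign of \<open>H\<close>, written \<open>K\<close> in the overview.\<close>

definition J where "J x = x - 2 *\<^sub>R P x"

text \<open>The completed block operator after multiplication by the diagonal symmetry, with
  \<open>D\<close> for the free corner.\<close>

definition M where "M D = (\<lambda>(x, y). (H x + B y, cadjoint B x + D y))"

lemmas lin = clin_simps[OF sa_bounded[OF H]] clin_simps[OF sa_bounded[OF P]]
  clin_simps[OF sa_bounded[OF R]] clin_simps[OF B] clin_simps[OF bounded_clinear_cadjoint[OF B]]

lemma J_selfadjoint: "selfadjoint_op J"
  unfolding J_def[abs_def]
  by (rule selfadjoint_op_diff[OF selfadjoint_op_id selfadjoint_op_scaleR[OF P]])

lemma J_J: "J (J x) = x"
  by (simp add: J_def lin PP scaleR_2)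

lemma R_J: "R (J x) = J (R x)"
  by (simp add: J_def lin PR)

lemma H_eq: "H x = J (R (R x))"
proof -
  have "H (J (J x)) = R (R (J x))" by (simp add: RR J_def)
  then show ?thesis by (simp add: J_J R_J)
qed

lemma inner_J: "inner (J x) x = (norm (x - P x))\<^sup>2 - (norm (P x))\<^sup>2"
  using inner_projection[OF P PP, of x] unfolding power2_norm_eq_inner
  by (simp add: J_def inner_diff inner_commute)

lemma quadratic_M:
  "inner (M D (x, y)) (x, y) = inner (H x) x + 2 * inner (B y) x + inner (D y) y"
  using inner_cadjoint[OF B, of y x] by (simp add: M_def inner_prod_def inner_add inner_commute)

lemma M_bounded_clinear:
  assumes "bounded_clinear D"
  shows "bounded_clinear (M D)"
  unfolding bounded_clinear_def
proof
  note bl = bounded_clinear_imp_bounded_linear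
  have "bounded_linear (\<lambda>z. (H (fst z) + B (snd z), cadjoint B (fst z) + D (snd z)))"
    using bl[OF sa_bounded[OF H]] bl[OF B] bl[OF bounded_clinear_cadjoint[OF B]] bl[OF assms]
    by (intro bounded_linear_Pair bounded_linear_add
        bounded_linear_compose[OF _ bounded_linear_fst] bounded_linear_compose[OF _ bounded_linear_snd])
  then show "bounded_linear (M D)" by (simp add: M_def case_prod_beta')
  show "\<forall>c z. M D (c *\<^sub>C z) = c *\<^sub>C M D z"
    by (simp add: M_def case_prod_beta' scaleC_prod_def lin clin_simps[OF assms] scaleC_add_right)
qed

lemma M_selfadjoint:
  assumes D: "selfadjoint_op D"
  shows "selfadjoint_op (M D)"
proof (rule selfadjoint_opI[OF M_bounded_clinear[OF sa_bounded[OF D]]])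
  fix z w
  show "inner (M D z) w = inner z (M D w)"
    using inner_cadjoint[OF B, of "snd z" "fst w"] inner_cadjoint[OF B, of "snd w" "fst z"]
    by (simp add: M_def case_prod_beta' inner_prod_def inner_add sa_inner[OF H] sa_inner[OF D])
      (simp add: inner_commute)
qed

lemma embed_bounded_clinear: "bounded_clinear (\<lambda>x :: 'a. (x, 0 :: 'b))"
  by (rule bounded_clinearI[where K = 1]) (simp_all add: scaleC_prod_def norm_Pair)

lemma embed_injective:
  assumes D: "selfadjoint_op D" and Q: "selfadjoint_op Q"
    and Qpos: "\<And>z. Q z = 0 \<Longrightarrow> 0 \<le> inner (M D z) z"
    and v: "v \<in> range P" "Q (v, 0) = 0"
  shows "v = 0"
proof (rule ccontr)
  assume "v \<noteq> 0"
  moreover have "P v = v" using v PP by auto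
  ultimately have "inner (M D (v, 0)) (v, 0) < 0"
    using Hneg[of v] by (simp add: quadratic_M lin clin_zero[OF sa_bounded[OF D]])
  then show False using Qpos[OF v(2)] by simp
qed

lemma nonneg_translate:
  assumes D: "selfadjoint_op D" and nu: "nu_minus (M D) = enat \<kappa>"
  obtains u where "P u = u" and "0 \<le> inner (M D (x - u, y)) (x - u, y)"
proof -
  obtain Q where Q: "selfadjoint_op Q" "\<And>z. Q (Q z) = Q z"
    and Qpos: "\<And>z. Q z = 0 \<Longrightarrow> 0 \<le> inner (M D z) z" and dimQ: "nu_minus (M D) = ecdim (range Q)"
    by (rule negative_projection[OF M_selfadjoint[OF D]]) (rule that; assumption)
  note Qb = sa_bounded[OF Q(1)]
  \<comment> \<open>The dimension count: this map is injective by \<open>embed_injective\<close>,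
    and both ranges have the same finite dimension.\<close>
  have "(\<lambda>v. Q (v, 0)) ` range P = range Q"
  proof (rule image_eq_if_ecdim_eq)
    show "bounded_clinear (\<lambda>v. Q (v, 0))"
      by (rule bounded_clinear_compose[OF Qb embed_bounded_clinear])
    show "complex_vector.subspace (range P)" by (rule csubspace_range[OF sa_bounded[OF P]])
    show "v = 0" if "v \<in> range P" "Q (v, 0) = 0" for v
      using embed_injective[OF D Q(1) Qpos] that by blast
    show "ecdim (range P) = enat \<kappa>" by (rule dimP)
    show "ecdim (range Q) = enat \<kappa>" using dimQ nu by simp
  qed auto
  then have "Q (x, y) \<in> (\<lambda>v. Q (v, 0)) ` range P" by simp
  then obtain v where v: "Q (x, y) = Q (P v, 0)" by auto
  have "Q (x - P v, y) = Q ((x, y) - (P v, 0))" by simp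
  also have "\<dots> = 0" by (simp only: clin_diff[OF Qb] v diff_self)
  finally have "0 \<le> inner (M D (x - P v, y)) (x - P v, y)" by (rule Qpos)
  then show thesis using that[of "P v"] PP by simp
qed

text \<open>A kernel vector of \<open>R\<close> in \<open>range P\<close> would be killed by
  \<open>H\<close>, against strict negativity; injectivity on a finite-dimensional invariant
  subspace gives surjectivity.\<close>

lemma R_onto: "R ` range P = range P"
proof (rule image_eq_if_ecdim_eq[OF sa_bounded[OF R] csubspace_range[OF sa_bounded[OF P]] _ _ dimP dimP])
  show "R ` range P \<subseteq> range P" using PR by (auto simp flip: PR)
  show "v = 0" if "v \<in> range P" "R v = 0" for v
  proof (rule ccontr)
    assume "v \<noteq> 0"
    moreover have "P v = v" using that PP by auto
    moreover have "H v = 0" using that by (simp add: H_eq J_def lin)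
    ultimately show False using Hneg[of v] by simp
  qed
qed

lemma inner_H: "inner (H x) x = inner (J (R x)) (R x)"
  by (simp add: H_eq sa_inner[OF R] flip: R_J)

lemma inner_H_neg: "P u = u \<Longrightarrow> inner (H u) u = - (norm (R u))\<^sup>2"
  using PR[of u] by (simp add: inner_H inner_J)

lemma inner_H_pos: "P u = 0 \<Longrightarrow> inner (H u) u = (norm (R u))\<^sup>2"
  using PR[of u] by (simp add: inner_H inner_J lin)

text \<open>The functional \<open>inner b\<close> is bounded by the norm of \<open>R x\<close>
  separately on two parts: on \<open>P x\<close> because \<open>P b = R s\<close>, and on
  \<open>x - P x\<close> because a quadratic inequality there yields a discriminant bound under
  scaling of \<open>x\<close>.\<close>

lemma range_subset_if_nu_minus_eq:
  assumes D: "selfadjoint_op D" and nu: "nu_minus (M D) = enat \<kappa>"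
  shows "range B \<subseteq> range R"
proof
  fix b assume "b \<in> range B"
  then obtain y where b: "b = B y" by blast
  note Db = sa_bounded[OF D]
  have "P b \<in> R ` range P" using R_onto by simp
  then obtain v where "P b = R (P v)" by auto
  define s where "s = P v"
  have s: "P b = R s" by (simp add: s_def \<open>P b = R (P v)\<close>)
  \<comment> \<open>The translation \<open>u\<close> depends on \<open>x\<close> and is not
    controlled. Its terms are \<open>(norm s)\<^sup>2 - (norm (s + R u))\<^sup>2\<close> after
    completing the square, hence at most \<open>(norm s)\<^sup>2\<close>, so this constant does not
    depend on \<open>x\<close>.\<close>
  define a where "a = inner (D y) y + (norm s)\<^sup>2"
  have quad: "0 \<le> a + 2 * inner b x + (norm (R x))\<^sup>2" if x: "P x = 0" for x
  proof -
    obtain u where u: "P u = u" and q: "0 \<le> inner (M D (x - u, y)) (x - u, y)"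
      using nonneg_translate[OF D nu] .
    have "inner (H u) x = inner (H (P u)) x" by (simp add: u)
    also have "\<dots> = inner (H u) (P x)" using sa_inner[OF P, of "H u" x] by (simp add: PH)
    finally have Hux: "inner (H u) x = 0" by (simp add: x)
    then have Hxu: "inner (H x) u = 0" using sa_inner[OF H, of x u] by (simp add: inner_commute)
    have "inner b u = inner (P b) u" using sa_inner[OF P, of b u] by (simp add: u)
    then have bu: "inner b u = inner s (R u)" by (simp add: s sa_inner[OF R])
    have "inner (M D (x - u, y)) (x - u, y)
        = (norm (R x))\<^sup>2 - (norm (R u))\<^sup>2 + 2 * inner b x - 2 * inner s (R u) + inner (D y) y"
      using inner_H_pos[OF x] inner_H_neg[OF u]
      by (simp add: quadratic_M lin inner_diff Hux Hxu b[symmetric] bu)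
    moreover have "(norm (s + R u))\<^sup>2 = (norm s)\<^sup>2 + 2 * inner s (R u) + (norm (R u))\<^sup>2"
      unfolding power2_norm_eq_inner by (simp add: inner_add inner_commute)
    moreover have "0 \<le> (norm (s + R u))\<^sup>2" by simp
    ultimately show ?thesis using q unfolding a_def by linarith
  qed
  have est: "\<bar>inner b x\<bar> \<le> sqrt a * norm (R x)" if x: "P x = 0" for x
  proof -
    have "0 \<le> a + 2 * r * inner b x + r\<^sup>2 * (norm (R x))\<^sup>2" for r
      using quad[of "r *\<^sub>R x"] x by (simp add: lin power_mult_distrib)
    then have "(inner b x)\<^sup>2 \<le> a * (norm (R x))\<^sup>2"
      by (rule discriminant_if_quadratic_nonneg) simp
    then have "sqrt ((inner b x)\<^sup>2) \<le> sqrt (a * (norm (R x))\<^sup>2)" by (rule real_sqrt_le_mono)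
    then show ?thesis by (simp add: real_sqrt_mult)
  qed
  have a: "0 \<le> sqrt a" using quad[of 0] by (simp add: lin)
  have "\<bar>inner b x\<bar> \<le> (norm s + sqrt a) * norm (R x)" for x
  proof -
    have "inner b (P x) = inner s (R x)"
      using sa_inner[OF P, of b x] sa_inner[OF R, of s x] by (simp add: s)
    then have 1: "\<bar>inner b (P x)\<bar> \<le> norm s * norm (R x)"
      using Cauchy_Schwarz_ineq2[of s "R x"] by simp
    have "inner (R x - P (R x)) (P (R x)) = 0"
      using sa_inner[OF P, of "R x - P (R x)" "R x"] by (simp add: lin PP)
    then have "(norm (R x))\<^sup>2 = (norm (R x - P (R x)))\<^sup>2 + (norm (P (R x)))\<^sup>2"
      unfolding power2_norm_eq_inner by (simp add: inner_diff inner_commute)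
    then have "(norm (R x - P (R x)))\<^sup>2 \<le> (norm (R x))\<^sup>2" by simp
    then have "norm (R (x - P x)) \<le> norm (R x)"
      unfolding lin PR by (rule power2_le_imp_le) simp
    then have "sqrt a * norm (R (x - P x)) \<le> sqrt a * norm (R x)" using a by (rule mult_left_mono)
    moreover have "\<bar>inner b (x - P x)\<bar> \<le> sqrt a * norm (R (x - P x))"
      by (rule est) (simp add: lin PP)
    moreover have "inner b x = inner b (P x) + inner b (x - P x)" by (simp add: inner_diff_right)
    ultimately show ?thesis using 1 by (simp add: distrib_right)
  qed
  then show "b \<in> range R" by (rule in_range_if_bounded[OF R])
qed

section \<open>Completing the square with the factor \<open>S\<close>\<close>

context
  fixes S
  assumes S: "bounded_clinear S" and RS: "\<And>y. R (S y) = B y"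
    and Sc: "\<And>y. S y \<in> closure (range R)"
begin

text \<open>The shift is \<open>J (S y)\<close> and not \<open>S y\<close> because the outer form
  already contains \<open>J\<close>: since \<open>J\<close> squares to the identity, the cross term
  becomes \<open>inner (R x) (S y) = inner x (B y)\<close>.\<close>

lemma quadratic_M_S:
  "inner (M D (x, y)) (x, y) = inner (J (R x + J (S y))) (R x + J (S y))
     + inner (D y - cadjoint S (J (S y))) y"
proof -
  note Jb = clin_simps[OF sa_bounded[OF J_selfadjoint]]
  have "inner (J (R x + J (S y))) (R x + J (S y))
      = inner (J (R x)) (R x) + inner (J (R x)) (J (S y)) + inner (S y) (R x) + inner (S y) (J (S y))"
    by (simp add: Jb J_J inner_add)
  moreover have "inner (J (R x)) (J (S y)) = inner (R x) (S y)"
    using sa_inner[OF J_selfadjoint, of "R x" "J (S y)"] by (simp add: J_J)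
  moreover have "inner (B y) x = inner (S y) (R x)" using sa_inner[OF R, of "S y" x] by (simp add: RS)
  moreover have "inner (cadjoint S (J (S y))) y = inner (S y) (J (S y))"
    using inner_cadjoint[OF S, of y "J (S y)"] by (simp add: inner_commute)
  ultimately show ?thesis
    unfolding quadratic_M inner_H inner_diff_left by (simp add: inner_commute)
qed

text \<open>If the form were \<open>- e^2\<close> at \<open>y\<close>, choose \<open>x\<close> with
  \<open>R x + J (S y)\<close> shorter than \<open>e\<close>. The translation by \<open>u\<close>
  changes only the \<open>P\<close>-component of this vector, which enters the form of
  \<open>J\<close> with a minus sign, so the form of \<open>M D\<close> at \<open>(x - u, y)\<close>
  stays negative.\<close>

lemma nonneg_if_nu_minus_eq:
  assumes D: "selfadjoint_op D" and nu: "nu_minus (M D) = enat \<kappa>"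
  shows "0 \<le> inner (D y - cadjoint S (J (S y))) y"
proof (rule ccontr)
  assume "\<not> ?thesis"
  then have neg: "inner (D y - cadjoint S (J (S y))) y < 0" by simp
  define e where "e = sqrt (- inner (D y - cadjoint S (J (S y))) y)"
  have e: "0 < e" "e\<^sup>2 = - inner (D y - cadjoint S (J (S y))) y" using neg by (simp_all add: e_def)
  \<comment> \<open>\<open>J\<close> commutes with \<open>R\<close>, so it maps
    \<open>range R\<close> into itself and, by continuity, the closure as well.\<close>
  have "J (S y) \<in> closure (range R)"
  proof -
    obtain z where z: "\<forall>n. z n \<in> range R" "z \<longlonglongrightarrow> S y"
      using Sc[of y] unfolding closure_sequential by (elim exE conjE) (rule that)
    have "J (z n) \<in> range R" for n using z(1) R_J by (metis imageE rangeI)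
    moreover have "(\<lambda>n. J (z n)) \<longlonglongrightarrow> J (S y)"
      by (rule clin_tendsto[OF sa_bounded[OF J_selfadjoint] z(2)])
    ultimately show ?thesis unfolding closure_sequential by (intro exI[of _ "\<lambda>n. J (z n)"]) simp
  qed
  then obtain x' where x': "dist (R x') (J (S y)) < e"
    using e(1) by (auto simp: closure_approachable)
  define x where "x = - x'"
  have x: "norm (R x + J (S y)) < e" using x' by (simp add: x_def lin dist_norm norm_minus_commute)
  obtain u where u: "P u = u" and q: "0 \<le> inner (M D (x - u, y)) (x - u, y)"
    using nonneg_translate[OF D nu] .
  define w w0 where "w = R (x - u) + J (S y)" and "w0 = R x + J (S y)"
  have "P (R u) = R u" by (simp add: PR u)
  then have eq: "w - P w = w0 - P w0" by (simp add: w_def w0_def lin)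
  have "inner (w0 - P w0) (P w0) = 0"
    using sa_inner[OF P, of "w0 - P w0" "w0"] by (simp add: lin PP)
  then have "(norm w0)\<^sup>2 = (norm (w0 - P w0))\<^sup>2 + (norm (P w0))\<^sup>2"
    unfolding power2_norm_eq_inner by (simp add: inner_diff inner_commute)
  then have "inner (J w) w \<le> (norm w0)\<^sup>2"
    using zero_le_power2[of "norm (P w)"] zero_le_power2[of "norm (P w0)"] unfolding inner_J eq by linarith
  also have "\<dots> < e\<^sup>2" using x by (intro power_strict_mono) (simp_all add: w0_def)
  finally have "inner (J w) w < e\<^sup>2" .
  then show False using q e(2) by (simp add: quadratic_M_S w_def)
qed

text \<open>Two injections. One is \<open>v \<mapsto> Q (v, 0)\<close> as before; the other sends
  \<open>z\<close> in \<open>range Q\<close> to the \<open>P\<close>-part of the completed square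
  \<open>g z\<close>. If that part vanishes, the form at \<open>z\<close> is a squared norm plus a
  nonnegative term, yet it is negative on nonzero vectors of \<open>range Q\<close>.\<close>

lemma nu_minus_eq_if_nonneg:
  assumes D: "selfadjoint_op D" and nn: "\<And>y. 0 \<le> inner (D y - cadjoint S (J (S y))) y"
  shows "nu_minus (M D) = enat \<kappa>"
proof -
  obtain Q where Q: "selfadjoint_op Q" "\<And>z. Q (Q z) = Q z"
    and Qneg: "\<And>z. Q z = z \<Longrightarrow> z \<noteq> 0 \<Longrightarrow> inner (M D z) z < 0"
    and Qpos: "\<And>z. Q z = 0 \<Longrightarrow> 0 \<le> inner (M D z) z" and dimQ: "nu_minus (M D) = ecdim (range Q)"
    by (rule negative_projection[OF M_selfadjoint[OF D]]) (rule that; assumption)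
  note Qb = sa_bounded[OF Q(1)]
  have "ecdim (range P) \<le> ecdim (range Q)"
  proof (rule ecdim_le_if_injective)
    show "bounded_clinear (\<lambda>v. Q (v, 0))"
      by (rule bounded_clinear_compose[OF Qb embed_bounded_clinear])
    show "complex_vector.subspace (range P)" by (rule csubspace_range[OF sa_bounded[OF P]])
    show "v = 0" if "v \<in> range P" "Q (v, 0) = 0" for v
      using embed_injective[OF D Q(1) Qpos] that by blast
  qed auto
  moreover have "ecdim (range Q) \<le> ecdim (range P)"
  proof (rule ecdim_le_if_injective)
    define g where "g z = R (fst z) + J (S (snd z))" for z
    have JS: "bounded_clinear (\<lambda>y. J (S y))"
      by (rule bounded_clinear_compose[OF sa_bounded[OF J_selfadjoint] S])
    have fst: "bounded_clinear (fst :: 'a \<times> 'b \<Rightarrow> 'a)" and snd: "bounded_clinear (snd :: 'a \<times> 'b \<Rightarrow> 'b)"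
      by (simp_all add: bounded_clinear_def bounded_linear_fst bounded_linear_snd scaleC_prod_def)
    have g: "bounded_clinear g"
      unfolding g_def[abs_def]
      by (rule bounded_clinear_add[OF bounded_clinear_compose[OF sa_bounded[OF R] fst]
            bounded_clinear_compose[OF JS snd]])
    show "bounded_clinear (\<lambda>z. P (g z))" by (rule bounded_clinear_compose[OF sa_bounded[OF P] g])
    show "complex_vector.subspace (range Q)" by (rule csubspace_range[OF Qb])
    show "z = 0" if z: "z \<in> range Q" and 0: "P (g z) = 0" for z
    proof (rule ccontr)
      assume "z \<noteq> 0"
      moreover have "Q z = z" using z Q(2) by auto
      ultimately have "inner (M D z) z < 0" by (rule Qneg[rotated])
      moreover have "inner (M D z) z = inner (J (g z)) (g z) + inner (D (snd z) - cadjoint S (J (S (snd z)))) (snd z)"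
        using quadratic_M_S[of D "fst z" "snd z"] by (simp add: g_def)
      moreover have "inner (J (g z)) (g z) = (norm (g z))\<^sup>2" using 0 by (simp add: inner_J)
      ultimately show False using nn[of "snd z"] zero_le_power2[of "norm (g z)"] by linarith
    qed
  qed auto
  ultimately show ?thesis using dimQ dimP by simp
qed

end

end

section \<open>Krein spaces\<close>

lemma
  assumes "krein_space J"
  shows krein_space_selfadjoint: "selfadjoint_op J" and krein_space_involution: "J (J x) = x"
proof -
  show "selfadjoint_op J" using assms by (simp add: krein_space_def)
  have "J \<circ> J = id" using assms by (simp add: krein_space_def)
  from fun_cong[OF this, of x] show "J (J x) = x" by simp
qed

lemma cadjoint_if_selfadjoint_comp:
  assumes J: "krein_space J" and X: "bounded_clinear X" and JX: "selfadjoint_op (J \<circ> X)"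
  shows "cadjoint X = (\<lambda>x. J (X (J x)))"
proof (rule cadjoint_eqI[OF X])
  fix x y
  have "inner (X x) y = inner (J (X x)) (J y)"
    using sa_inner[OF krein_space_selfadjoint[OF J], of "J (X x)" y]
    by (simp add: krein_space_involution[OF J])
  then show "inner (X x) y = inner x (J (X (J y)))"
    using sa_inner[OF JX, of x "J y"] by simp
qed

lemma krein_selfadjoint_iff:
  assumes J: "krein_space J"
  shows "krein_selfadjoint J X \<longleftrightarrow> bounded_clinear X \<and> selfadjoint_op (J \<circ> X)"
proof (intro iffI conjI)
  note Jsa = krein_space_selfadjoint[OF J] and JJ = krein_space_involution[OF J]
  assume k: "krein_selfadjoint J X"
  then show X: "bounded_clinear X" by (simp add: krein_selfadjoint_def)
  have eq: "X = J \<circ> cadjoint X \<circ> J"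
    using k by (simp add: krein_selfadjoint_def krein_adjoint_def)
  show "selfadjoint_op (J \<circ> X)"
  proof (rule selfadjoint_opI[OF bounded_clinear_comp[OF sa_bounded[OF Jsa] X]])
    fix x y
    have "inner (J (X x)) y = inner x (cadjoint X (J y))"
      by (simp add: sa_inner[OF Jsa] inner_cadjoint[OF X])
    also have "cadjoint X (J y) = J (X y)" using fun_cong[OF eq, of y] by (simp add: JJ)
    finally show "inner ((J \<circ> X) x) y = inner x ((J \<circ> X) y)" by simp
  qed
next
  assume "bounded_clinear X \<and> selfadjoint_op (J \<circ> X)"
  then have X: "bounded_clinear X" and JX: "selfadjoint_op (J \<circ> X)" by simp_all
  show "krein_selfadjoint J X"
    unfolding krein_selfadjoint_def krein_adjoint_def cadjoint_if_selfadjoint_comp[OF J X JX]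
    by (simp add: X krein_space_involution[OF J] fun_eq_iff)
qed

lemma bounded_clinear_block_op:
  assumes "bounded_clinear A" "bounded_clinear B" "bounded_clinear C" "bounded_clinear D"
  shows "bounded_clinear (block_op A B C D)"
  unfolding bounded_clinear_def
proof
  note bl = assms[THEN bounded_clinear_imp_bounded_linear]
  have "bounded_linear (\<lambda>z. (A (fst z) + B (snd z), C (fst z) + D (snd z)))"
    using bl by (intro bounded_linear_Pair bounded_linear_add
        bounded_linear_compose[OF _ bounded_linear_fst] bounded_linear_compose[OF _ bounded_linear_snd])
  then show "bounded_linear (block_op A B C D)" by (simp add: block_op_def case_prod_beta')
  show "\<forall>c z. block_op A B C D (c *\<^sub>C z) = c *\<^sub>C block_op A B C D z"
    by (simp add: block_op_def case_prod_beta' scaleC_prod_def assms[THEN clin_scaleC] scaleC_add_right)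
qed

text \<open>The modulus is \<open>H\<close> times its sign: with \<open>u = P x\<close> and
  \<open>v = x - P x\<close> the mixed terms cancel and the form is that of \<open>H\<close> at
  \<open>v\<close> minus that at \<open>u\<close>. The square is \<open>H H\<close> since the sign
  squares to the identity, and nonnegative roots are unique.\<close>

lemma op_abs_eq_sign_mult:
  assumes H: "selfadjoint_op H" and P: "selfadjoint_op P"
    and PP: "\<And>x. P (P x) = P x" and PH: "\<And>x. P (H x) = H (P x)"
    and neg: "\<And>x. P x = x \<Longrightarrow> x \<noteq> 0 \<Longrightarrow> inner (H x) x < 0" and pos: "\<And>x. P x = 0 \<Longrightarrow> 0 \<le> inner (H x) x"
  shows "nonneg_op (\<lambda>x. H (x - 2 *\<^sub>R P x))" and "op_sqrt (\<lambda>x. H (H x)) = (\<lambda>x. H (x - 2 *\<^sub>R P x))"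
proof -
  note lin = clin_simps[OF sa_bounded[OF H]] clin_simps[OF sa_bounded[OF P]]
  have J: "selfadjoint_op (\<lambda>x. x - 2 *\<^sub>R P x)"
    by (rule selfadjoint_op_diff[OF selfadjoint_op_id selfadjoint_op_scaleR[OF P]])
  have sa: "selfadjoint_op (\<lambda>x. H (x - 2 *\<^sub>R P x))"
    by (rule selfadjoint_op_compose[OF H J]) (simp add: lin PH)
  have "0 \<le> inner (H (x - 2 *\<^sub>R P x)) x" for x
  proof -
    define u v where "u = P x" and "v = x - P x"
    have x: "x - 2 *\<^sub>R P x = v - u" "x = v + u" by (simp_all add: u_def v_def scaleR_2)
    have "inner (H v) u = inner (H u) v" using sa_inner[OF H, of v u] by (simp add: inner_commute)
    then have "inner (H (v - u)) (v + u) = inner (H v) v - inner (H u) u"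
      by (simp add: lin inner_add inner_diff)
    moreover have "0 \<le> inner (H v) v" by (rule pos) (simp add: v_def lin PP)
    moreover have "inner (H u) u \<le> 0"
      using neg[of u] PP by (cases "u = 0") (auto simp: u_def lin less_imp_le)
    ultimately show ?thesis unfolding x(1) using x(2) by simp
  qed
  with sa show nn: "nonneg_op (\<lambda>x. H (x - 2 *\<^sub>R P x))" by (simp add: nonneg_op_iff)
  have HH: "nonneg_op (\<lambda>x. H (H x))"
    unfolding nonneg_op_iff
    using selfadjoint_op_compose[OF H H] by (simp add: sa_inner[OF H, of "H _"])
  show "op_sqrt (\<lambda>x. H (H x)) = (\<lambda>x. H (x - 2 *\<^sub>R P x))"
    by (rule op_sqrt_eqI[OF HH nn]) (simp add: lin PH PP scaleR_2)
qed

theorem theorem2p1: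
  fixes J1 :: "'a :: chilbert_space \<Rightarrow> 'a"
    and J2 :: "'b :: chilbert_space \<Rightarrow> 'b"
    and A11 :: "'a \<Rightarrow> 'a" and A12 :: "'b \<Rightarrow> 'a" and A21 :: "'a \<Rightarrow> 'b"
    and \<kappa> :: nat
  defines "J11 \<equiv> sign_op (J1 \<circ> A11)"
    and "S \<equiv> mp_inverse (op_sqrt (op_abs A11)) \<circ> J1 \<circ> A12"
    and "Sol \<equiv> {A22. krein_selfadjoint J2 A22 \<and>
                 krein_nu_minus (diag_op J1 J2) (block_op A11 A12 A21 A22) = enat \<kappa>}"
  assumes "krein_space J1" and "krein_space J2"
    and "krein_selfadjoint J1 A11"
    and "bounded_clinear A12" and "bounded_clinear A21"
    and "A21 = krein_adjoint J2 J1 A12"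
    and "krein_nu_minus J1 A11 = enat \<kappa>"
  shows
    "((\<exists>A A22. krein_selfadjoint J2 A22 \<and> A = block_op A11 A12 A21 A22 \<and> bounded_clinear A \<and>
         krein_nu_minus (diag_op J1 J2) A = krein_nu_minus J1 A11 \<and> krein_nu_minus J1 A11 = enat \<kappa>)
      \<longleftrightarrow> range (J1 \<circ> A12) \<subseteq> range (op_sqrt (op_abs A11)))
     \<and>
     (range (J1 \<circ> A12) \<subseteq> range (op_sqrt (op_abs A11)) \<longrightarrow>
        range (J1 \<circ> A12) \<subseteq> mp_domain (op_sqrt (op_abs A11)) \<and>
        bounded_clinear S \<and>
        krein_adjoint J2 J1 S \<circ> J1 \<circ> J11 \<circ> S \<in> Sol \<and>
        (\<forall>X\<in>Sol. krein_le J2 (krein_adjoint J2 J1 S \<circ> J1 \<circ> J11 \<circ> S) X) \<and>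
        Sol = {A22. bounded_clinear A22 \<and>
                (\<exists>Y. nonneg_op Y \<and>
                   A22 = J2 \<circ> (\<lambda>x. (cadjoint S \<circ> J11 \<circ> S) x + Y x) \<and>
                   A22 = (\<lambda>x. (krein_adjoint J2 J1 S \<circ> J1 \<circ> J11 \<circ> S) x + J2 (Y x)))})"
proof -
  note defs = assms(1-3)
  have K1: "krein_space J1" and K2: "krein_space J2" and A11: "krein_selfadjoint J1 A11"
    and A12: "bounded_clinear A12" and A21b: "bounded_clinear A21"
    and A21: "A21 = krein_adjoint J2 J1 A12" and nu: "krein_nu_minus J1 A11 = enat \<kappa>"
    by fact+
  note J1sa = krein_space_selfadjoint[OF K1] and J2sa = krein_space_selfadjoint[OF K2]
    and JJ = krein_space_involution[OF K1] krein_space_involution[OF K2]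
  have A11b: "bounded_clinear A11" and H: "selfadjoint_op (J1 \<circ> A11)"
    using A11 by (simp_all add: krein_selfadjoint_iff[OF K1])
  define H where "H = J1 \<circ> A11"
  define B where "B = J1 \<circ> A12"
  have Hsa: "selfadjoint_op H" using H by (simp add: H_def)
  have Bb: "bounded_clinear B"
    unfolding B_def by (rule bounded_clinear_comp[OF sa_bounded[OF J1sa] A12])
  obtain P where P: "selfadjoint_op P" and PP: "\<And>x. P (P x) = P x" and PH: "\<And>x. P (H x) = H (P x)"
    and neg: "\<And>x. P x = x \<Longrightarrow> x \<noteq> 0 \<Longrightarrow> inner (H x) x < 0"
    and pos: "\<And>x. P x = 0 \<Longrightarrow> 0 \<le> inner (H x) x"
    and sgn: "sign_op H = (\<lambda>x. x - 2 *\<^sub>R P x)" and nuP: "nu_minus H = ecdim (range P)"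
    by (rule negative_projection[OF Hsa]) (rule that; assumption)
  define Ab where "Ab x = H (x - 2 *\<^sub>R P x)" for x
  have Abn: "nonneg_op Ab" and HHAb: "op_sqrt (\<lambda>x. H (H x)) = Ab"
    using op_abs_eq_sign_mult[OF Hsa P PP PH neg pos] by (simp_all add: Ab_def[abs_def])
  \<comment> \<open>The adjoint of \<open>A11\<close> is \<open>J1 A11 J1\<close>, so
    \<open>J1\<close> is absorbed into the two factors \<open>H\<close>.\<close>
  have "cadjoint A11 \<circ> A11 = (\<lambda>x. H (H x))"
    by (simp add: cadjoint_if_selfadjoint_comp[OF K1 A11b H] H_def fun_eq_iff)
  then have absA: "op_abs A11 = Ab" by (simp add: op_abs_def HHAb)
  define R where "R = op_sqrt (op_abs A11)"
  have R: "selfadjoint_op R" and RR: "\<And>x. R (R x) = H (x - 2 *\<^sub>R P x)"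
    using nonneg_op_sqrt[OF Abn] op_sqrt_comp[OF Abn] by (simp_all add: R_def absA nonneg_op_iff Ab_def)
  have PR: "P (R x) = R (P x)" for x
    unfolding R_def absA
    by (rule op_sqrt_commute[OF Abn sa_bounded[OF P]])
      (simp add: Ab_def PH clin_simps[OF sa_bounded[OF P]] PP)
  have dimP: "ecdim (range P) = enat \<kappa>" using nu nuP by (simp add: krein_nu_minus_def H_def)
  interpret negative_index_block H R P B \<kappa>
    using Hsa P R PP PH PR neg RR dimP Bb by (rule negative_index_block.intro)
  have J11: "J11 = J" by (simp add: defs(1) J_def[abs_def] sgn flip: H_def)
  have cB: "cadjoint B = (\<lambda>x. cadjoint A12 (J1 x))"
    by (rule cadjoint_eqI[OF Bb]) (simp add: B_def sa_inner[OF J1sa] inner_cadjoint[OF A12])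
  have block: "krein_nu_minus (diag_op J1 J2) (block_op A11 A12 A21 A22) = nu_minus (M (J2 \<circ> A22))" for A22
  proof -
    have "diag_op J1 J2 \<circ> block_op A11 A12 A21 A22 = M (J2 \<circ> A22)"
      unfolding M_def cB
      by (auto simp: fun_eq_iff diag_op_def block_op_def A21 krein_adjoint_def H_def B_def JJ
          clin_simps[OF sa_bounded[OF J1sa]] clin_simps[OF sa_bounded[OF J2sa]])
    then show ?thesis by (simp add: krein_nu_minus_def)
  qed
  have Sol: "A22 \<in> Sol \<longleftrightarrow> bounded_clinear A22 \<and> selfadjoint_op (J2 \<circ> A22) \<and> nu_minus (M (J2 \<circ> A22)) = enat \<kappa>"
    for A22
    by (simp add: defs(3) krein_selfadjoint_iff[OF K2] block)
  have ran: "range (J1 \<circ> A12) = range B" by (simp add: B_def)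
  have necessary: "range B \<subseteq> range R" if "A22 \<in> Sol" for A22
    using that range_subset_if_nu_minus_eq by (auto simp: Sol)
  define T where "T = (\<lambda>x. cadjoint S (J (S x)))"
  \<comment> \<open>The two copies of \<open>J1\<close>, one from the Krein adjoint and one
    explicit, cancel.\<close>
  have T: "krein_adjoint J2 J1 S \<circ> J1 \<circ> J11 \<circ> S = (\<lambda>x. J2 (T x))"
    by (simp add: krein_adjoint_def T_def J11 JJ fun_eq_iff)
  have S_facts: "bounded_clinear S" "\<And>y. R (S y) = B y" "\<And>y. S y \<in> closure (range R)"
    if sub: "range B \<subseteq> range R"
  proof -
    have S: "S = (\<lambda>y. mp_inverse R (B y))" by (simp add: defs(2) R_def B_def fun_eq_iff)
    show "bounded_clinear S" unfolding S by (rule bounded_clinear_mp_inverse_comp[OF R Bb sub])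
    show "R (S y) = B y" "S y \<in> closure (range R)" for y
      using R_mp_inverse[OF R subsetD[OF sub rangeI[of B y]]]
        mp_inverse_in_closure[OF R subsetD[OF sub rangeI[of B y]]]
      by (simp_all add: S)
  qed
  have T_sa: "selfadjoint_op T" if "bounded_clinear S"
  proof (rule selfadjoint_opI)
    show "bounded_clinear T"
      unfolding T_def
      by (rule bounded_clinear_compose[OF bounded_clinear_cadjoint[OF that]
            bounded_clinear_compose[OF sa_bounded[OF J_selfadjoint] that]])
    show "inner (T x) y = inner x (T y)" for x y
      using inner_cadjoint[OF that, of y "J (S x)"] inner_cadjoint[OF that, of x "J (S y)"]
        sa_inner[OF J_selfadjoint, of "S x" "S y"]
      by (simp add: T_def inner_commute)
  qed
  \<comment> \<open>\<open>Y = J2 A22 - T\<close> is the parameter of the description. Minimality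
    and the parametrization both follow from this equivalence.\<close>
  have sol_iff: "A22 \<in> Sol \<longleftrightarrow> bounded_clinear A22 \<and> nonneg_op (\<lambda>x. J2 (A22 x) - T x)"
    if sub: "range B \<subseteq> range R" for A22
  proof -
    note S = S_facts[OF sub]
    have *: "selfadjoint_op (J2 \<circ> A22) \<longleftrightarrow> selfadjoint_op (\<lambda>x. J2 (A22 x) - T x)"
      using selfadjoint_op_diff[OF _ T_sa[OF S(1)], of "J2 \<circ> A22"]
        selfadjoint_op_add[OF _ T_sa[OF S(1)], of "\<lambda>x. J2 (A22 x) - T x"]
      by (auto simp: comp_def)
    show ?thesis
    proof
      assume "A22 \<in> Sol"
      then have a: "bounded_clinear A22" "selfadjoint_op (J2 \<circ> A22)" "nu_minus (M (J2 \<circ> A22)) = enat \<kappa>"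
        by (simp_all add: Sol)
      have "0 \<le> inner (J2 (A22 x) - T x) x" for x
        using nonneg_if_nu_minus_eq[OF S a(2,3), of x] by (simp add: T_def)
      then show "bounded_clinear A22 \<and> nonneg_op (\<lambda>x. J2 (A22 x) - T x)"
        using a * by (simp add: nonneg_op_iff)
    next
      assume "bounded_clinear A22 \<and> nonneg_op (\<lambda>x. J2 (A22 x) - T x)"
      then have a: "bounded_clinear A22" "selfadjoint_op (J2 \<circ> A22)"
        "\<And>x. 0 \<le> inner (J2 (A22 x) - T x) x"
        using * by (simp_all add: nonneg_op_iff)
      have "nu_minus (M (J2 \<circ> A22)) = enat \<kappa>"
        by (rule nu_minus_eq_if_nonneg[OF S a(2)]) (use a(3) in \<open>simp add: T_def\<close>)
      then show "A22 \<in> Sol" using a by (simp add: Sol)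
    qed
  qed
  \<comment> \<open>The parameter \<open>Y = 0\<close>; this solution also serves as the completion
    claimed in the first part.\<close>
  have minimal: "(\<lambda>x. J2 (T x)) \<in> Sol" if sub: "range B \<subseteq> range R"
  proof -
    note S = S_facts(1)[OF sub]
    have "bounded_clinear (\<lambda>x. J2 (T x))"
      by (rule bounded_clinear_compose[OF sa_bounded[OF J2sa] sa_bounded[OF T_sa[OF S]]])
    moreover have "nonneg_op (\<lambda>x :: 'b. 0 :: 'b)"
      by (simp add: nonneg_op_iff selfadjoint_op_iff bounded_clinear_zero)
    ultimately show ?thesis by (simp add: sol_iff[OF sub] JJ)
  qed
  have le: "krein_le J2 (\<lambda>x. J2 (T x)) X" if sub: "range B \<subseteq> range R" and X: "X \<in> Sol" for X
    using X unfolding krein_le_def krein_inner_def inner_eq_Re_cinner[symmetric]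
    by (simp add: sol_iff[OF sub] nonneg_op_iff clin_diff[OF sa_bounded[OF J2sa]] JJ)
  have description: "Sol = {A22. bounded_clinear A22 \<and>
                (\<exists>Y. nonneg_op Y \<and>
                   A22 = J2 \<circ> (\<lambda>x. (cadjoint S \<circ> J11 \<circ> S) x + Y x) \<and>
                   A22 = (\<lambda>x. (krein_adjoint J2 J1 S \<circ> J1 \<circ> J11 \<circ> S) x + J2 (Y x)))}"
    if sub: "range B \<subseteq> range R"
  proof (intro equalityI subsetI CollectI)
    fix A22 assume "A22 \<in> Sol"
    then have a: "bounded_clinear A22" "nonneg_op (\<lambda>x. J2 (A22 x) - T x)"
      by (simp_all add: sol_iff[OF sub])
    moreover have "A22 = J2 \<circ> (\<lambda>x. (cadjoint S \<circ> J11 \<circ> S) x + (J2 (A22 x) - T x))"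
      by (simp add: fun_eq_iff J11 T_def JJ)
    moreover have "A22 = (\<lambda>x. (krein_adjoint J2 J1 S \<circ> J1 \<circ> J11 \<circ> S) x + J2 (J2 (A22 x) - T x))"
      unfolding T by (simp add: clin_diff[OF sa_bounded[OF J2sa]] JJ)
    ultimately show "bounded_clinear A22 \<and> (\<exists>Y. nonneg_op Y \<and>
        A22 = J2 \<circ> (\<lambda>x. (cadjoint S \<circ> J11 \<circ> S) x + Y x) \<and>
        A22 = (\<lambda>x. (krein_adjoint J2 J1 S \<circ> J1 \<circ> J11 \<circ> S) x + J2 (Y x)))"
      by (intro conjI exI[of _ "\<lambda>x. J2 (A22 x) - T x"])
  next
    fix A22 assume "A22 \<in> {A22. bounded_clinear A22 \<and>
                (\<exists>Y. nonneg_op Y \<and>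
                   A22 = J2 \<circ> (\<lambda>x. (cadjoint S \<circ> J11 \<circ> S) x + Y x) \<and>
                   A22 = (\<lambda>x. (krein_adjoint J2 J1 S \<circ> J1 \<circ> J11 \<circ> S) x + J2 (Y x)))}"
    then obtain Y where b: "bounded_clinear A22" and Y: "nonneg_op Y"
      and eq: "A22 = J2 \<circ> (\<lambda>x. (cadjoint S \<circ> J11 \<circ> S) x + Y x)"
      by (elim CollectE conjE exE)
    have "(\<lambda>x. J2 (A22 x) - T x) = Y" by (simp add: fun_eq_iff eq J11 T_def JJ)
    then show "A22 \<in> Sol" using b Y by (simp add: sol_iff[OF sub])
  qed
  have domain: "range B \<subseteq> mp_domain R" if "range B \<subseteq> range R"
  proof
    fix b assume "b \<in> range B"
    then have "b \<in> range R" using that by (rule subsetD[rotated])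
    moreover have "R 0 = 0" by (rule clin_zero[OF sa_bounded[OF R]])
    ultimately show "b \<in> mp_domain R"
      unfolding mp_domain_def by (intro CollectI exI[of _ b] exI[of _ 0]) simp
  qed
  show ?thesis
    unfolding R_def[symmetric] ran T
  proof (intro conjI impI iffI)
    assume "\<exists>A A22. krein_selfadjoint J2 A22 \<and> A = block_op A11 A12 A21 A22 \<and> bounded_clinear A \<and>
      krein_nu_minus (diag_op J1 J2) A = krein_nu_minus J1 A11 \<and> krein_nu_minus J1 A11 = enat \<kappa>"
    then obtain A22 where "A22 \<in> Sol" using defs(3) by auto
    then show "range B \<subseteq> range R" by (rule necessary)
  next
    assume sub: "range B \<subseteq> range R"
    have "krein_selfadjoint J2 (\<lambda>x. J2 (T x))"
      and "krein_nu_minus (diag_op J1 J2) (block_op A11 A12 A21 (\<lambda>x. J2 (T x))) = enat \<kappa>"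
      using minimal[OF sub] by (simp_all add: defs(3))
    then show "\<exists>A A22. krein_selfadjoint J2 A22 \<and> A = block_op A11 A12 A21 A22 \<and> bounded_clinear A \<and>
      krein_nu_minus (diag_op J1 J2) A = krein_nu_minus J1 A11 \<and> krein_nu_minus J1 A11 = enat \<kappa>"
      using bounded_clinear_block_op[OF A11b A12 A21b] nu
      by (intro exI[of _ "block_op A11 A12 A21 (\<lambda>x. J2 (T x))"] exI[of _ "\<lambda>x. J2 (T x)"])
        (simp add: krein_selfadjoint_def)
  next
    assume sub: "range B \<subseteq> range R"
    show "range B \<subseteq> mp_domain R" by (rule domain[OF sub])
    show "bounded_clinear S" by (rule S_facts(1)[OF sub])
    show "(\<lambda>x. J2 (T x)) \<in> Sol" by (rule minimal[OF sub])
    show "\<forall>X\<in>Sol. krein_le J2 (\<lambda>x. J2 (T x)) X" using le[OF sub] by blast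
    show "Sol = {A22. bounded_clinear A22 \<and>
                (\<exists>Y. nonneg_op Y \<and>
                   A22 = J2 \<circ> (\<lambda>x. (cadjoint S \<circ> J11 \<circ> S) x + Y x) \<and>
                   A22 = (\<lambda>x. J2 (T x) + J2 (Y x)))}"
      using description[OF sub] unfolding T .
  qed
qed

end
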